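(* Let $f:\mathbb{R}\to\mathbb{R}_+$ be measurable and either bounded or Lipschitz continuous. For any choice of $T>0$, $L\ge1$, $n_i\in\mathbb{N}$, $c_i\in\mathbb{R}$, $\alpha_i>0$ for $1\le i\le L$, and $x_0\in\mathbb{R}^\kappa$, the algorithm described in the context terminates almost surely within finite time. If additionally $x_0$ is given by $$x_0^{(i,k)}=\int_{]-\infty,0]}c_i e^{\alpha_i s}\frac{(-s)^{n_i-k}}{(n_i-k)!}\,\eta(ds),\qquad 1\le i\le L,\ 0\le k\le n_i,$$ for a deterministic point process $\eta$ on $]-\infty,0]$ such that $\int_{]-\infty,0]}h(t-s)\,\eta(ds)<\infty$ for all $t\ge0$, where $h(t)=\sum_{i=1}^L c_ie^{-\alpha_i t}\frac{t^{n_i}}{n_i!}$, then the output $(N_t)_{t\in[0,T]}$ of the algorithm follows the distribution (on $[0,T]$) of a Hawkes process with intensity $$\lambda_t=f\left(\int_{]-\infty,0]}h(t-s)\,\eta(ds)+\int_{]0,t[}h(t-s)\,dN_s\right).$$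
   Context: $\mathbb{N}$ denotes the non-negative integers; $\kappa=L+\sum_{i=1}^L n_i$. Elements of $\mathbb{R}^\kappa$ are written $x=(x^{(1)},\ldots,x^{(L)})$ with $x^{(i)}=(x^{(i,0)},\ldots,x^{(i,n_i)})$; $e_{(i,n_i)}\in\mathbb{R}^\kappa$ is the unit vector with entry $1$ in coordinate $(i,n_i)$. The flow $\varphi_t:\mathbb{R}^\kappa\to\mathbb{R}^\kappa$, $t\ge 0$, is $$\varphi_t^{(i,k)}(x)=e^{-\alpha_i t}\sum_{m=0}^{n_i-k}\frac{t^m}{m!}x^{(i,k+m)},\qquad 1\le i\le L,\ 0\le k\le n_i.$$ Let $M(x)=\max\{|\varphi_t^{(i,0)}(x)|:1\le i\le L,\ t\ge0\}$, and $$f^*(x)=\begin{cases}\max\{f(y):y\in[0,LM(x)]\},&x\in\mathbb{R}_+^\kappa,\\ \max\{f(y):y\in[-LM(x),0]\},&x\in\mathbb{R}_-^\kappa,\\ \max\{f(y):y\in[-LM(x),LM(x)]\},&\text{else}\end{cases}$$ (the max being read as a supremum if it is not attained). Algorithm. Input: $f$, $L$, $(n_i)$, $(\alpha_i)$, $(c_i)$, $T>0$, $x_0\in\mathbb{R}^\kappa$. Output: $(N_t)_{t\in[0,T]}$. Initialise $x\leftarrow x_0$, $D\leftarrow0$, $N_0\leftarrow0$. While $D<T$, do the following: - Set $f^*\leftarrow f^*(x)$ and draw $\tau$ exponential with parameter $f^*$ ($\tau=+\infty$ if $f^*=0$), independently of the past. - If $\tau\le T-D$: draw $U$ uniform on $[0,1]$,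 independent of everything else. If $U\le f(\sum_{i=1}^L\varphi_\tau^{(i,0)}(x))/f^*$, set $x\leftarrow\varphi_\tau(x)+\sum_{i=1}^Lc_ie_{(i,n_i)}$, $N_t\leftarrow N_D$ for $D\le t<D+\tau$ and $N_{D+\tau}\leftarrow N_D+1$. Otherwise set $x\leftarrow\varphi_\tau(x)$ and $N_t\leftarrow N_D$ for $D\le t\le D+\tau$. - If $\tau>T-D$: set $N_t\leftarrow N_D$ for $D\le t\le T$. - In all cases set $D\leftarrow D+\tau$. Return $(N_t)_{t\in[0,T]}$. Termination within finite time means that the while loop is executed only finitely many times. A Hawkes process with parameters $(f,h)$ and initial condition $\eta$ is (the law of) a simple point process on $(0,\infty)$ with counting process $N_t=N((0,t])$ whose compensator with respect to $\mathcal{F}_t=\sigma\{N(A):A\in\mathcal{B}((0,t])\}$ is $(\int_0^t\lambda_s\,ds)_{t\ge0}$, with $\lambda_t$ the predictable process given by the displayed intensity formula. The integrals defining $x_0$ from $\eta$ are assumed well defined and finite. *)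

theory Defs
  imports "HOL-Probability.Probability"
begin

section \<open>The flow and the bound on the intensity\<close>

text \<open>
  A point \<open>x\<close> of \<open>\<real>\<^sup>\<kappa>\<close>, \<open>\<kappa> = L + n\<^sub>1 + \<dots> + n\<^sub>L\<close>, is a function
  with \<open>x i k\<close> the coordinate \<open>(i,k)\<close>, for \<open>1 \<le> i \<le> L\<close> and \<open>0 \<le> k \<le> n i\<close>.  Values at other
  pairs of indices influence none of the quantities derived from \<open>x\<close> at these coordinates.
\<close>

type_synonym vec = "nat \<Rightarrow> nat \<Rightarrow> real"

definition flow :: "(nat \<Rightarrow> nat) \<Rightarrow> (nat \<Rightarrow> real) \<Rightarrow> real \<Rightarrow> vec \<Rightarrow> vec" where
  "flow n \<alpha> t x i k = exp (- \<alpha> i * t) * (\<Sum>m = 0..n i - k. t ^ m / fact m * x i (k + m))"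

definition unit_vec :: "nat \<Rightarrow> nat \<Rightarrow> vec" where
  "unit_vec i k = (\<lambda>i' k'. if i' = i \<and> k' = k then 1 else 0)"

definition kick :: "nat \<Rightarrow> (nat \<Rightarrow> nat) \<Rightarrow> (nat \<Rightarrow> real) \<Rightarrow> vec \<Rightarrow> vec" where
  "kick L n c x = (\<lambda>i k. x i k + (\<Sum>j = 1..L. c j * unit_vec j (n j) i k))"

definition flow_max :: "nat \<Rightarrow> (nat \<Rightarrow> nat) \<Rightarrow> (nat \<Rightarrow> real) \<Rightarrow> vec \<Rightarrow> real" where
  "flow_max L n \<alpha> x = (SUP (i, t)\<in>{1..L} \<times> {0..}. \<bar>flow n \<alpha> t x i 0\<bar>)"

definition rate_bound ::
  "(real \<Rightarrow> real) \<Rightarrow> nat \<Rightarrow> (nat \<Rightarrow> nat) \<Rightarrow> (nat \<Rightarrow> real) \<Rightarrow> vec \<Rightarrow> real" where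
  "rate_bound f L n \<alpha> x =
    (let b = real L * flow_max L n \<alpha> x in
     if \<forall>i\<in>{1..L}. \<forall>k\<le>n i. 0 \<le> x i k then SUP y\<in>{0..b}. f y
     else if \<forall>i\<in>{1..L}. \<forall>k\<le>n i. x i k \<le> 0 then SUP y\<in>{-b..0}. f y
     else SUP y\<in>{-b..b}. f y)"


section \<open>The algorithm\<close>

text \<open>
  The loop variables \<open>x\<close>, \<open>D\<close> and \<open>N\<close>.  The clock \<open>D\<close> becomes \<open>\<infinity>\<close> after a draw \<open>\<tau> = \<infinity>\<close>.
\<close>

datatype loop_state =
  Loop_State (pos: vec) (clock: ereal) (cnt: "real \<Rightarrow> nat")

definition loop_body ::
  "(real \<Rightarrow> real) \<Rightarrow> nat \<Rightarrow> (nat \<Rightarrow> nat) \<Rightarrow> (nat \<Rightarrow> real) \<Rightarrow> (nat \<Rightarrow> real) \<Rightarrow> real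
    \<Rightarrow> ereal \<Rightarrow> real \<Rightarrow> loop_state \<Rightarrow> loop_state" where
  "loop_body f L n \<alpha> c T \<tau> u s =
    (let x = pos s; D = clock s; N = cnt s;
         d = real_of_ereal D; y = flow n \<alpha> (real_of_ereal \<tau>) x
     in if \<tau> \<le> ereal T - D then
          (if u \<le> f (\<Sum>i = 1..L. y i 0) / rate_bound f L n \<alpha> x
           then Loop_State (kick L n c y) (D + \<tau>)
                  (\<lambda>t. if D \<le> ereal t \<and> ereal t < D + \<tau> then N d
                       else if ereal t = D + \<tau> then N d + 1 else N t)
           else Loop_State y (D + \<tau>)
                  (\<lambda>t. if D \<le> ereal t \<and> ereal t \<le> D + \<tau> then N d else N t))
        else Loop_State x (D + \<tau>)
               (\<lambda>t. if D \<le> ereal t \<and> t \<le> T then N d else N t))"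

text \<open>
  The state before iteration \<open>j\<close> of the while loop, as a function of the successive draws;
  once the loop condition \<open>D < T\<close> fails, the state does not change any more.
\<close>

primrec loop_run ::
  "(real \<Rightarrow> real) \<Rightarrow> nat \<Rightarrow> (nat \<Rightarrow> nat) \<Rightarrow> (nat \<Rightarrow> real) \<Rightarrow> (nat \<Rightarrow> real) \<Rightarrow> real \<Rightarrow> vec
    \<Rightarrow> (nat \<Rightarrow> ereal) \<Rightarrow> (nat \<Rightarrow> real) \<Rightarrow> nat \<Rightarrow> loop_state" where
  "loop_run f L n \<alpha> c T x0 \<tau> u 0 = Loop_State x0 0 (\<lambda>_. 0)"
| "loop_run f L n \<alpha> c T x0 \<tau> u (Suc j) =
    (let s = loop_run f L n \<alpha> c T x0 \<tau> u j in
     if clock s < ereal T then loop_body f L n \<alpha> c T (\<tau> j) (u j) s else s)"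

definition terminates ::
  "(real \<Rightarrow> real) \<Rightarrow> nat \<Rightarrow> (nat \<Rightarrow> nat) \<Rightarrow> (nat \<Rightarrow> real) \<Rightarrow> (nat \<Rightarrow> real) \<Rightarrow> real \<Rightarrow> vec
    \<Rightarrow> (nat \<Rightarrow> ereal) \<Rightarrow> (nat \<Rightarrow> real) \<Rightarrow> bool" where
  "terminates f L n \<alpha> c T x0 \<tau> u \<longleftrightarrow>
    (\<exists>j. \<not> clock (loop_run f L n \<alpha> c T x0 \<tau> u j) < ereal T)"

text \<open>The returned counting path; its value is irrelevant if the loop does not terminate.\<close>

definition alg_output ::
  "(real \<Rightarrow> real) \<Rightarrow> nat \<Rightarrow> (nat \<Rightarrow> nat) \<Rightarrow> (nat \<Rightarrow> real) \<Rightarrow> (nat \<Rightarrow> real) \<Rightarrow> real \<Rightarrow> vec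
    \<Rightarrow> (nat \<Rightarrow> ereal) \<Rightarrow> (nat \<Rightarrow> real) \<Rightarrow> real \<Rightarrow> nat" where
  "alg_output f L n \<alpha> c T x0 \<tau> u =
    cnt (loop_run f L n \<alpha> c T x0 \<tau> u
          (LEAST j. \<not> clock (loop_run f L n \<alpha> c T x0 \<tau> u j) < ereal T))"


section \<open>The law of the draws\<close>

definition exp_law :: "real \<Rightarrow> ereal measure" where
  "exp_law r =
    (if r = 0 then return borel \<infinity>
     else distr (density lborel (exponential_density r)) borel ereal)"

definition past :: "'w measure \<Rightarrow> (nat \<Rightarrow> 'w \<Rightarrow> ereal) \<Rightarrow> nat \<Rightarrow> (nat \<Rightarrow> 'w \<Rightarrow> real) \<Rightarrow> nat
    \<Rightarrow> 'w measure" where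
  "past M \<tau> a U b = sigma (space M)
    ({\<tau> i -` B \<inter> space M | i B. i < a \<and> B \<in> sets borel} \<union>
     {U i -` B \<inter> space M | i B. i < b \<and> B \<in> sets borel})"

text \<open>
  On the event \<open>H\<close>, the kernel \<open>K\<close> is the conditional law of \<open>X\<close> given the
  \<open>\<sigma>\<close>-algebra \<open>G\<close>.  If \<open>K\<close> is constant, \<open>X\<close> has law \<open>K\<close> and is independent of \<open>G\<close> there.
\<close>

definition has_cond_law :: "'w measure \<Rightarrow> 'w measure \<Rightarrow> 'w set
    \<Rightarrow> ('w \<Rightarrow> 'b::topological_space) \<Rightarrow> ('w \<Rightarrow> 'b measure) \<Rightarrow> bool" where
  "has_cond_law M G H X K \<longleftrightarrow>
    X \<in> borel_measurable M \<and>
    (\<forall>A\<in>sets G. A \<subseteq> H \<longrightarrow> (\<forall>B\<in>sets borel.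
       emeasure M (A \<inter> X -` B) = (\<integral>\<^sup>+\<omega>\<in>A. emeasure (K \<omega>) B \<partial>M)))"

text \<open>
  The draws \<open>\<tau> j\<close> and \<open>U j\<close> of iteration \<open>j\<close> are constrained only on the events on which the
  algorithm makes them: \<open>D < T\<close> for \<open>\<tau> j\<close>, and also \<open>\<tau> j \<le> T - D\<close> for \<open>U j\<close>.
\<close>

definition valid_draws ::
  "(real \<Rightarrow> real) \<Rightarrow> nat \<Rightarrow> (nat \<Rightarrow> nat) \<Rightarrow> (nat \<Rightarrow> real) \<Rightarrow> (nat \<Rightarrow> real) \<Rightarrow> real \<Rightarrow> vec
    \<Rightarrow> 'w measure \<Rightarrow> (nat \<Rightarrow> 'w \<Rightarrow> ereal) \<Rightarrow> (nat \<Rightarrow> 'w \<Rightarrow> real) \<Rightarrow> bool" where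
  "valid_draws f L n \<alpha> c T x0 M \<tau> U \<longleftrightarrow>
    prob_space M \<and>
    (\<forall>j. let S = (\<lambda>\<omega>. loop_run f L n \<alpha> c T x0 (\<lambda>i. \<tau> i \<omega>) (\<lambda>i. U i \<omega>) j) in
      has_cond_law M (past M \<tau> j U j) {\<omega>. clock (S \<omega>) < ereal T}
        (\<tau> j) (\<lambda>\<omega>. exp_law (rate_bound f L n \<alpha> (pos (S \<omega>)))) \<and>
      has_cond_law M (past M \<tau> (Suc j) U j)
        {\<omega>. clock (S \<omega>) < ereal T \<and> \<tau> j \<omega> \<le> ereal T - clock (S \<omega>)}
        (U j) (\<lambda>\<omega>. uniform_measure lborel {0..1}))"


section \<open>Compensators\<close>

text \<open>Time is \<open>[0, \<infinity>)\<close>; filtrations are not completed.\<close>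

definition predictable_sigma :: "'w measure \<Rightarrow> (real \<Rightarrow> 'w measure) \<Rightarrow> (real \<times> 'w) measure" where
  "predictable_sigma Q F = sigma ({0..} \<times> space Q)
    ({{0} \<times> A | A. A \<in> sets (F 0)} \<union>
     {{s<..t} \<times> A | s t A. 0 \<le> s \<and> s \<le> t \<and> A \<in> sets (F s)})"

definition predictable :: "'w measure \<Rightarrow> (real \<Rightarrow> 'w measure) \<Rightarrow> (real \<Rightarrow> 'w \<Rightarrow> real) \<Rightarrow> bool" where
  "predictable Q F X \<longleftrightarrow> (\<lambda>(t, \<omega>). X t \<omega>) \<in> borel_measurable (predictable_sigma Q F)"

definition is_martingale :: "'w measure \<Rightarrow> (real \<Rightarrow> 'w measure) \<Rightarrow> (real \<Rightarrow> 'w \<Rightarrow> real) \<Rightarrow> bool" where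
  "is_martingale Q F X \<longleftrightarrow>
    (\<forall>t\<ge>0. X t \<in> borel_measurable (F t) \<and> integrable Q (X t)) \<and>
    (\<forall>s t. 0 \<le> s \<and> s \<le> t \<longrightarrow> (AE \<omega> in Q. real_cond_exp Q (F s) (X t) \<omega> = X s \<omega>))"

definition is_local_martingale ::
  "'w measure \<Rightarrow> (real \<Rightarrow> 'w measure) \<Rightarrow> (real \<Rightarrow> 'w \<Rightarrow> real) \<Rightarrow> bool" where
  "is_local_martingale Q F X \<longleftrightarrow>
    (\<exists>\<sigma> :: nat \<Rightarrow> 'w \<Rightarrow> real.
      (\<forall>k. stopping_time F (\<sigma> k) \<and> (\<forall>\<omega>\<in>space Q. 0 \<le> \<sigma> k \<omega>)) \<and>
      (AE \<omega> in Q. incseq (\<lambda>k. \<sigma> k \<omega>) \<and> filterlim (\<lambda>k. \<sigma> k \<omega>) at_top sequentially) \<and>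
      (\<forall>k. is_martingale Q F (\<lambda>t \<omega>. X (min t (\<sigma> k \<omega>)) \<omega>)))"

definition is_compensator ::
  "'w measure \<Rightarrow> (real \<Rightarrow> 'w measure) \<Rightarrow> (real \<Rightarrow> 'w \<Rightarrow> real) \<Rightarrow> (real \<Rightarrow> 'w \<Rightarrow> real) \<Rightarrow> bool" where
  "is_compensator Q F N A \<longleftrightarrow>
    predictable Q F A \<and>
    (\<forall>\<omega>\<in>space Q. A 0 \<omega> = 0 \<and> mono_on {0..} (\<lambda>t. A t \<omega>) \<and>
       (\<forall>t\<ge>0. continuous (at_right t) (\<lambda>s. A s \<omega>))) \<and>
    is_local_martingale Q F (\<lambda>t \<omega>. N t \<omega> - A t \<omega>)"


section \<open>Point processes and Hawkes processes\<close>

text \<open>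
  A simple point process on \<open>(0, \<infinity>)\<close> is given by its random set of points \<open>\<Phi> \<omega>\<close>;
  \<open>N(B) = card (\<Phi> \<omega> \<inter> B)\<close> is finite for bounded \<open>B\<close>.
\<close>

definition simple_point_process :: "'w measure \<Rightarrow> ('w \<Rightarrow> real set) \<Rightarrow> bool" where
  "simple_point_process Q \<Phi> \<longleftrightarrow>
    prob_space Q \<and>
    (\<forall>\<omega>\<in>space Q. \<Phi> \<omega> \<subseteq> {0<..} \<and> (\<forall>t. finite (\<Phi> \<omega> \<inter> {0<..t}))) \<and>
    (\<forall>t. \<forall>B\<in>sets borel. B \<subseteq> {0<..t} \<longrightarrow>
       (\<lambda>\<omega>. card (\<Phi> \<omega> \<inter> B)) \<in> measurable Q (count_space UNIV))"

definition counting :: "('w \<Rightarrow> real set) \<Rightarrow> real \<Rightarrow> 'w \<Rightarrow> nat" where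
  "counting \<Phi> t \<omega> = card (\<Phi> \<omega> \<inter> {0<..t})"

definition natural_filtration :: "'w measure \<Rightarrow> ('w \<Rightarrow> real set) \<Rightarrow> real \<Rightarrow> 'w measure" where
  "natural_filtration Q \<Phi> t = sigma (space Q)
    {(\<lambda>\<omega>. card (\<Phi> \<omega> \<inter> B)) -` {m} \<inter> space Q | B m. B \<in> sets borel \<and> B \<subseteq> {0<..t}}"

text \<open>
  The initial condition: an integer-valued, locally finite measure on the line
  which is carried by \<open>]-\<infinity>,0]\<close>.
\<close>

definition initial_point_process :: "real measure \<Rightarrow> bool" where
  "initial_point_process \<eta> \<longleftrightarrow>
    sets \<eta> = sets borel \<and> emeasure \<eta> {0<..} = 0 \<and>
    (\<forall>B\<in>sets borel. bounded B \<longrightarrow> (\<exists>m::nat. emeasure \<eta> B = of_nat m))"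

text \<open>The integral of \<open>h (t - s)\<close> against \<open>dN\<^sub>s\<close> over \<open>]0,t[\<close> is a finite sum over points.\<close>

definition hawkes_intensity ::
  "(real \<Rightarrow> real) \<Rightarrow> (real \<Rightarrow> real) \<Rightarrow> real measure \<Rightarrow> ('w \<Rightarrow> real set) \<Rightarrow> real \<Rightarrow> 'w \<Rightarrow> real" where
  "hawkes_intensity f h \<eta> \<Phi> t \<omega> =
    f ((LINT s:{..0}|\<eta>. h (t - s)) + (\<Sum>s\<in>\<Phi> \<omega> \<inter> {0<..<t}. h (t - s)))"

definition hawkes_process ::
  "(real \<Rightarrow> real) \<Rightarrow> (real \<Rightarrow> real) \<Rightarrow> real measure \<Rightarrow> 'w measure \<Rightarrow> ('w \<Rightarrow> real set) \<Rightarrow> bool" where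
  "hawkes_process f h \<eta> Q \<Phi> \<longleftrightarrow>
    (let F = natural_filtration Q \<Phi>; intens = hawkes_intensity f h \<eta> \<Phi> in
     simple_point_process Q \<Phi> \<and>
     predictable Q F intens \<and>
     (\<forall>\<omega>\<in>space Q. \<forall>t\<ge>0. set_integrable lborel {0..t} (\<lambda>s. intens s \<omega>)) \<and>
     is_compensator Q F (\<lambda>t \<omega>. real (counting \<Phi> t \<omega>)) (\<lambda>t \<omega>. LINT s:{0..t}|lborel. intens s \<omega>))"

definition erlang_kernel ::
  "nat \<Rightarrow> (nat \<Rightarrow> nat) \<Rightarrow> (nat \<Rightarrow> real) \<Rightarrow> (nat \<Rightarrow> real) \<Rightarrow> real \<Rightarrow> real" where
  "erlang_kernel L n \<alpha> c t = (\<Sum>i = 1..L. c i * exp (- \<alpha> i * t) * t ^ n i / fact (n i))"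

text \<open>
  The law on \<open>[0,T]\<close> of an integer-valued process, on the product \<open>\<sigma>\<close>-algebra
  (generated by the evaluations of paths at single times).
\<close>

definition path_space :: "real \<Rightarrow> (real \<Rightarrow> nat) measure" where
  "path_space T = PiM {0..T} (\<lambda>_. count_space UNIV)"

definition path_law :: "'w measure \<Rightarrow> real \<Rightarrow> (real \<Rightarrow> 'w \<Rightarrow> nat) \<Rightarrow> (real \<Rightarrow> nat) measure" where
  "path_law M T N = distr M (path_space T) (\<lambda>\<omega>. \<lambda>t\<in>{0..T}. N t \<omega>)"

end

theory Submission
  imports Defs
begin

text \<open>
  The algorithm is a thinning procedure. Candidate times arrive at a rate that bounds the
  intensity until the next candidate, and a candidate is kept with probability intensity over
  rate.

  The coordinates with index \<open>i\<close> form a Jordan block of a linear system, so the flow is a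
  semigroup, and the kick at an accepted point adds the kernel \<open>h\<close> to the sum of the flows.
  Hence the sum of the coordinates \<open>(i, 0)\<close> of the flowing state is the argument of \<open>f\<close> in the
  intensity (\<open>flow_sum_state\<close>, and \<open>initial_intensity\<close> for the points before time 0), and the rate
  bounds the intensity (\<open>rate_dominates\<close>).

  Let \<open>r\<close> be the rate and \<open>\<lambda> y\<close> the intensity a time \<open>y\<close> after the last candidate. The next
  candidate comes at \<open>y\<close> with density \<open>r exp (-r y)\<close> and is accepted with probability \<open>\<lambda> y / r\<close>; the
  product \<open>\<lambda> y exp (-r y)\<close> is also the intensity at \<open>y\<close> times the probability that no candidate
  has come before. Summed over all candidates this says that, for every predictable \<open>Z \<ge> 0\<close>, the
  expected sum of \<open>Z\<close> over the accepted points is the expected integral of \<open>Z\<close> against the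
  intensity (\<open>compensation_formula_points\<close>). For the indicator of a predictable rectangle,
  stopped so that the counts stay bounded, it is the martingale property of the compensated
  counting process (\<open>is_compensator_comp\<close>).

  An acceptance raises the supremum of the flow by at most a constant, so the rate grows at
  most linearly in the number of candidates. The Laplace transform of the \<open>j\<close>-th candidate time,
  at a suitable argument, is then at most \<open>1 / (j + 1)\<close> (\<open>laplace_time\<close>). So the candidate times
  are almost surely unbounded, and the loop terminates.

  A Hawkes process lives on all of \<open>(0, \<infinity>)\<close>, but the given draws only reach up to \<open>T\<close>. They are
  continued, on a product space, by independent exponential and uniform draws (locale
  \<open>coupling\<close>). Each wait and each mark is either a draw of the algorithm or a fresh one, so its
  conditional law can be checked with the other kind of draw held fixed (\<open>wait_cond_law\<close>,
  \<open>mark_cond_law\<close>). Up to \<open>T\<close> the continued candidate process almost surely makes the same moves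
  as the algorithm (\<open>output_agrees\<close>). So the law of its accepted points is a Hawkes process
  which has, on \<open>[0, T]\<close>, the law of the output.
\<close>

section \<open>Flow, kicks and the rate bound\<close>

definition flow_sum :: "nat \<Rightarrow> (nat \<Rightarrow> nat) \<Rightarrow> (nat \<Rightarrow> real) \<Rightarrow> real \<Rightarrow> vec \<Rightarrow> real" where
  "flow_sum L n \<alpha> t x = (\<Sum>i = 1..L. flow n \<alpha> t x i 0)"

lemma binomial_fact_split:
  fixes s t :: real
  shows "(s + t) ^ m / fact m = (\<Sum>p = 0..m. (s ^ p / fact p) * (t ^ (m - p) / fact (m - p)))"
proof -
  have "(s + t) ^ m / fact m = (\<Sum>p\<le>m. of_nat (m choose p) * s ^ p * t ^ (m - p)) / fact m"
    by (simp add: binomial_ring)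
  also have "\<dots> = (\<Sum>p\<le>m. (s ^ p / fact p) * (t ^ (m - p) / fact (m - p)))"
    unfolding sum_divide_distrib
    by (intro sum.cong refl) (simp add: binomial_fact field_simps)
  finally show ?thesis by (simp add: atMost_atLeast0)
qed

text \<open>
  For fixed \<open>i\<close> the flow is the exponential of a Jordan block, hence additive in time: after
  exchanging the two sums, the coefficients recombine by the binomial theorem.
\<close>

lemma flow_add:
  assumes "k \<le> n i"
  shows "flow n \<alpha> s (flow n \<alpha> t x) i k = flow n \<alpha> (s + t) x i k"
proof -
  define b where "b = n i - k"
  define y where "y q = x i (k + q)" for q
  have fl: "flow n \<alpha> t x i (k + p) = exp (- \<alpha> i * t) * (\<Sum>m = 0..b - p. t ^ m / fact m * y (p + m))" for p
    by (simp add: flow_def b_def y_def add.assoc)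
  \<comment> \<open>The double sum is reordered along \<open>q = p + m\<close>.\<close>
  have "(\<Sum>p = 0..b. s ^ p / fact p * (\<Sum>m = 0..b - p. t ^ m / fact m * y (p + m)))
     = (\<Sum>p = 0..b. \<Sum>m = 0..b - p. s ^ p / fact p * (t ^ m / fact m) * y (p + m))"
    by (simp add: sum_distrib_left mult.assoc)
  also have "\<dots> = (\<Sum>(p, m)\<in>Sigma {0..b} (\<lambda>p. {0..b - p}). s ^ p / fact p * (t ^ m / fact m) * y (p + m))"
    by (simp add: sum.Sigma)
  also have "\<dots> = (\<Sum>(q, p)\<in>Sigma {0..b} (\<lambda>q. {0..q}). s ^ p / fact p * (t ^ (q - p) / fact (q - p)) * y q)"
    by (rule sum.reindex_bij_witness[where i = "\<lambda>(q, p). (p, q - p)" and j = "\<lambda>(p, m). (p + m, p)"]) auto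
  also have "\<dots> = (\<Sum>q = 0..b. (\<Sum>p = 0..q. s ^ p / fact p * (t ^ (q - p) / fact (q - p))) * y q)"
    by (simp add: sum.Sigma[symmetric] sum_distrib_right)
  also have "\<dots> = (\<Sum>q = 0..b. (s + t) ^ q / fact q * y q)"
    by (simp only: binomial_fact_split[symmetric])
  finally have key: "(\<Sum>p = 0..b. s ^ p / fact p * (\<Sum>m = 0..b - p. t ^ m / fact m * y (p + m)))
     = (\<Sum>q = 0..b. (s + t) ^ q / fact q * y q)" .
  have "flow n \<alpha> s (flow n \<alpha> t x) i k = exp (- \<alpha> i * s) * (\<Sum>p = 0..b. s ^ p / fact p *
      (exp (- \<alpha> i * t) * (\<Sum>m = 0..b - p. t ^ m / fact m * y (p + m))))"
    by (subst flow_def) (simp add: fl b_def)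
  also have "\<dots> = exp (- \<alpha> i * s) * exp (- \<alpha> i * t) *
      (\<Sum>p = 0..b. s ^ p / fact p * (\<Sum>m = 0..b - p. t ^ m / fact m * y (p + m)))"
    by (simp add: sum_distrib_left mult_ac)
  also have "\<dots> = exp (- \<alpha> i * (s + t)) * (\<Sum>q = 0..b. (s + t) ^ q / fact q * y q)"
    unfolding key by (simp add: exp_add[symmetric] algebra_simps)
  also have "\<dots> = flow n \<alpha> (s + t) x i k"
    by (simp add: flow_def b_def y_def)
  finally show ?thesis .
qed

lemma flow_sum_flow: "flow_sum L n \<alpha> s (flow n \<alpha> t x) = flow_sum L n \<alpha> (s + t) x"
  by (simp add: flow_sum_def flow_add)

lemma kick_apply: "kick L n c x i k = x i k + (if i \<in> {1..L} \<and> k = n i then c i else 0)"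
proof -
  have "(\<Sum>j = 1..L. c j * unit_vec j (n j) i k) =
      (\<Sum>j\<in>{1..L}. if j = i then (if k = n i then c i else 0) else 0)"
    by (intro sum.cong) (auto simp: unit_vec_def)
  also have "\<dots> = (if i \<in> {1..L} \<and> k = n i then c i else 0)"
    by (simp add: sum.delta)
  finally show ?thesis by (simp add: kick_def)
qed

lemma flow_kick:
  assumes "i \<in> {1..L}"
  shows "flow n \<alpha> t (kick L n c x) i 0 =
    flow n \<alpha> t x i 0 + c i * exp (- \<alpha> i * t) * t ^ n i / fact (n i)"
proof -
  have "(\<Sum>m = 0..n i. t ^ m / fact m * kick L n c x i m) =
     (\<Sum>m = 0..n i. t ^ m / fact m * x i m + (if m = n i then t ^ m / fact m * c i else 0))"
    using assms by (intro sum.cong refl) (auto simp: kick_apply algebra_simps)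
  also have "\<dots> = (\<Sum>m = 0..n i. t ^ m / fact m * x i m) + t ^ n i / fact (n i) * c i"
    by (simp add: sum.distrib sum.delta)
  finally show ?thesis by (simp add: flow_def algebra_simps)
qed

lemma flow_sum_kick:
  "flow_sum L n \<alpha> t (kick L n c x) = flow_sum L n \<alpha> t x + erlang_kernel L n \<alpha> c t"
  by (simp add: flow_sum_def flow_kick erlang_kernel_def sum.distrib)

text \<open>
  The term \<open>(\<alpha> t)\<^sup>m / m!\<close> is one term of the series of \<open>exp (\<alpha> t)\<close>.
\<close>

lemma flow_bounded:
  assumes "0 < \<alpha> i"
  shows "\<exists>B. \<forall>t\<ge>0. \<bar>flow n \<alpha> t x i 0\<bar> \<le> B"
proof -
  have pe: "exp (- \<alpha> i * t) * (t ^ m / fact m) \<le> 1 / \<alpha> i ^ m" if "0 \<le> t" for t and m :: nat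
  proof -
    have "(\<alpha> i * t) ^ m / fact m \<le> exp (\<alpha> i * t)"
    proof -
      have "(\<Sum>k\<in>{m}. (\<alpha> i * t) ^ k /\<^sub>R fact k) \<le> (\<Sum>k. (\<alpha> i * t) ^ k /\<^sub>R fact k)"
        using assms that by (intro sum_le_suminf summable_exp_generic) auto
      then show ?thesis by (simp add: exp_def divide_inverse mult.commute)
    qed
    then show ?thesis using assms by (simp add: power_mult_distrib exp_minus field_simps)
  qed
  show ?thesis
  proof (intro exI allI impI)
    fix t :: real assume t: "0 \<le> t"
    have "\<bar>flow n \<alpha> t x i 0\<bar> = \<bar>\<Sum>m = 0..n i. exp (- \<alpha> i * t) * (t ^ m / fact m) * x i m\<bar>"
      by (simp add: flow_def sum_distrib_left mult.assoc)
    also have "\<dots> \<le> (\<Sum>m = 0..n i. \<bar>exp (- \<alpha> i * t) * (t ^ m / fact m) * x i m\<bar>)"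
      by (rule sum_abs)
    also have "\<dots> \<le> (\<Sum>m = 0..n i. 1 / \<alpha> i ^ m * \<bar>x i m\<bar>)"
    proof (rule sum_mono)
      fix m
      show "\<bar>exp (- \<alpha> i * t) * (t ^ m / fact m) * x i m\<bar> \<le> 1 / \<alpha> i ^ m * \<bar>x i m\<bar>"
        using mult_right_mono[OF pe[OF t, of m], of "\<bar>x i m\<bar>"] t by (simp add: abs_mult)
    qed
    finally show "\<bar>flow n \<alpha> t x i 0\<bar> \<le> (\<Sum>m = 0..n i. 1 / \<alpha> i ^ m * \<bar>x i m\<bar>)" .
  qed
qed

lemma flow_nonneg:
  assumes "\<forall>k\<le>n i. 0 \<le> x i k" "0 \<le> t" "k \<le> n i"
  shows "0 \<le> flow n \<alpha> t x i k"
  unfolding flow_def using assms by (intro mult_nonneg_nonneg sum_nonneg) auto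

lemma flow_uminus: "flow n \<alpha> t (\<lambda>i k. - x i k) i k = - flow n \<alpha> t x i k"
  by (simp add: flow_def sum_negf)

locale flow_params =
  fixes L :: nat and n :: "nat \<Rightarrow> nat" and \<alpha> :: "nat \<Rightarrow> real"
  assumes L_pos: "1 \<le> L" and alpha_pos: "\<And>i. i \<in> {1..L} \<Longrightarrow> 0 < \<alpha> i"
begin

lemma bdd_flow: "bdd_above ((\<lambda>(i, t). \<bar>flow n \<alpha> t x i 0\<bar>) ` ({1..L} \<times> {0..}))"
proof -
  have "\<exists>B. \<forall>t\<ge>0. \<bar>flow n \<alpha> t x i 0\<bar> \<le> B" if "i \<in> {1..L}" for i
    by (rule flow_bounded) (rule alpha_pos[OF that])
  then obtain B where B: "\<And>i t. i \<in> {1..L} \<Longrightarrow> 0 \<le> t \<Longrightarrow> \<bar>flow n \<alpha> t x i 0\<bar> \<le> B i"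
    by metis
  show ?thesis
  proof (rule bdd_aboveI2)
    fix p assume "p \<in> {1..L} \<times> {0::real..}"
    then obtain i t where p: "p = (i, t)" "i \<in> {1..L}" "0 \<le> t" by auto
    have "B i \<le> Max (B ` {1..L})" using p by (intro Max_ge) auto
    then show "(case p of (i, t) \<Rightarrow> \<bar>flow n \<alpha> t x i 0\<bar>) \<le> Max (B ` {1..L})"
      using B[OF p(2,3)] p(1) by simp
  qed
qed

lemma abs_flow_le: "i \<in> {1..L} \<Longrightarrow> 0 \<le> t \<Longrightarrow> \<bar>flow n \<alpha> t x i 0\<bar> \<le> flow_max L n \<alpha> x"
  unfolding flow_max_def by (rule cSUP_upper2[OF bdd_flow, of "(i, t)"]) auto

lemma flow_max_nonneg: "0 \<le> flow_max L n \<alpha> x"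
  using abs_flow_le[of 1 0 x] L_pos by simp

lemma flow_max_least:
  assumes "\<And>i t. i \<in> {1..L} \<Longrightarrow> 0 \<le> t \<Longrightarrow> \<bar>flow n \<alpha> t x i 0\<bar> \<le> B"
  shows "flow_max L n \<alpha> x \<le> B"
  unfolding flow_max_def using assms L_pos by (intro cSUP_least) auto

lemma flow_max_flow: "0 \<le> t \<Longrightarrow> flow_max L n \<alpha> (flow n \<alpha> t x) \<le> flow_max L n \<alpha> x"
  by (rule flow_max_least) (simp add: flow_add abs_flow_le)

lemma flow_max_kick: "flow_max L n \<alpha> (kick L n c x) \<le> flow_max L n \<alpha> x + flow_max L n \<alpha> (kick L n c (\<lambda>_ _. 0))"
proof (rule flow_max_least)
  fix i t assume i: "i \<in> {1..L}" and t: "0 \<le> (t :: real)"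
  have "flow n \<alpha> t (kick L n c x) i 0 = flow n \<alpha> t x i 0 + flow n \<alpha> t (kick L n c (\<lambda>_ _. 0)) i 0"
    using i by (simp add: flow_kick) (simp add: flow_def)
  then show "\<bar>flow n \<alpha> t (kick L n c x) i 0\<bar> \<le> flow_max L n \<alpha> x + flow_max L n \<alpha> (kick L n c (\<lambda>_ _. 0))"
    using abs_flow_le[OF i t, of x] abs_flow_le[OF i t, of "kick L n c (\<lambda>_ _. 0)"] by linarith
qed

lemma abs_flow_sum_le:
  assumes "0 \<le> t" shows "\<bar>flow_sum L n \<alpha> t x\<bar> \<le> real L * flow_max L n \<alpha> x"
proof -
  have "\<bar>flow_sum L n \<alpha> t x\<bar> \<le> (\<Sum>i = 1..L. \<bar>flow n \<alpha> t x i 0\<bar>)"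
    unfolding flow_sum_def by (rule sum_abs)
  also have "\<dots> \<le> (\<Sum>i = 1..L. flow_max L n \<alpha> x)"
    using assms by (intro sum_mono abs_flow_le) auto
  finally show ?thesis by simp
qed

end

text \<open>
  Boundedness and Lipschitz continuity of \<open>f\<close> are used only through linear growth: the supremum
  that defines the rate is then finite, and the rate grows at most linearly in the supremum of
  the flow.
\<close>

locale hawkes_params = flow_params +
  fixes f :: "real \<Rightarrow> real" and a b :: real
  assumes f_meas[measurable]: "f \<in> borel_measurable borel" and f_nonneg: "\<And>y. 0 \<le> f y"
    and f_growth: "\<And>y. f y \<le> a + b * \<bar>y\<bar>" and b_nonneg: "0 \<le> b"
begin

lemma a_nonneg: "0 \<le> a"
  using f_growth[of 0] f_nonneg[of 0] by simp

abbreviation "rate \<equiv> rate_bound f L n \<alpha>"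

lemma f_bdd: "bdd_above (f ` {l..u})"
proof (rule bdd_aboveI2)
  fix y assume "y \<in> {l..u}"
  then have "\<bar>y\<bar> \<le> max \<bar>l\<bar> \<bar>u\<bar>" by auto
  then show "f y \<le> a + b * max \<bar>l\<bar> \<bar>u\<bar>"
    using f_growth[of y] mult_left_mono[OF _ b_nonneg] by smt
qed

lemma rate_growth: "rate x \<le> a + b * (real L * flow_max L n \<alpha> x)"
proof -
  have *: "(SUP y\<in>S. f y) \<le> a + b * B" if "S \<noteq> {}" "\<And>y. y \<in> S \<Longrightarrow> \<bar>y\<bar> \<le> B" for S B
    using that(1)
  proof (rule cSUP_least)
    fix y assume "y \<in> S"
    then show "f y \<le> a + b * B"
      using f_growth[of y] mult_left_mono[OF that(2) b_nonneg] by fastforce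
  qed
  have "0 \<le> real L * flow_max L n \<alpha> x" using flow_max_nonneg by simp
  then show ?thesis unfolding rate_bound_def Let_def
    by (auto intro!: *)
qed

lemma rate_nonneg: "0 \<le> rate x"
proof -
  have *: "0 \<le> (SUP y\<in>{l..u}. f y)" if "l \<le> 0" "0 \<le> u" for l u
    using f_nonneg[of 0] that by (intro cSUP_upper2[OF f_bdd, of 0]) auto
  have "0 \<le> real L * flow_max L n \<alpha> x" using flow_max_nonneg by simp
  then show ?thesis unfolding rate_bound_def Let_def
    by (auto intro!: *)
qed

text \<open>
  The three cases of the rate bound are sound because the flow preserves the sign of the
  coordinates.
\<close>

lemma rate_dominates:
  assumes t: "0 \<le> t" shows "f (flow_sum L n \<alpha> t x) \<le> rate x"
proof -
  define B where "B = real L * flow_max L n \<alpha> x"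
  have B: "\<bar>flow_sum L n \<alpha> t x\<bar> \<le> B" using abs_flow_sum_le[OF t] B_def by simp
  have *: "f y \<le> (SUP y\<in>{l..u}. f y)" if "y \<in> {l..u}" for y l u
    by (rule cSUP_upper[OF that f_bdd])
  have pos: "0 \<le> flow_sum L n \<alpha> t x" if "\<forall>i\<in>{1..L}. \<forall>k\<le>n i. 0 \<le> x i k"
    unfolding flow_sum_def using that t by (intro sum_nonneg flow_nonneg) auto
  have neg: "flow_sum L n \<alpha> t x \<le> 0" if "\<forall>i\<in>{1..L}. \<forall>k\<le>n i. x i k \<le> 0"
  proof -
    have "0 \<le> flow_sum L n \<alpha> t (\<lambda>i k. - x i k)"
      unfolding flow_sum_def using that t by (intro sum_nonneg flow_nonneg) auto
    then show ?thesis by (simp add: flow_sum_def flow_uminus sum_negf)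
  qed
  show ?thesis unfolding rate_bound_def Let_def B_def[symmetric]
    using B pos neg by (auto intro!: *)
qed

end

section \<open>Measurability in the state\<close>

lemma vec_measurableI:
  assumes "\<And>i k. (\<lambda>\<omega>. X \<omega> i k) \<in> borel_measurable M"
  shows "X \<in> measurable M (borel :: vec measure)"
  by (intro measurable_coordinatewise_then_product assms)

lemma measurable_coord[measurable]: "(\<lambda>x :: vec. x i k) \<in> borel_measurable borel"
proof -
  have "continuous_on UNIV (\<lambda>x :: vec. x i k)"
    by (intro continuous_on_product_coordinates continuous_on_coordinatewise_then_product
        continuous_on_product_then_coordinatewise) 
       
  then show ?thesis by (rule borel_measurable_continuous_onI)
qed

lemma measurable_flow[measurable (raw)]:
  assumes [measurable]: "t \<in> borel_measurable M" "X \<in> measurable M (borel :: vec measure)"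
  shows "(\<lambda>\<omega>. flow n \<alpha> (t \<omega>) (X \<omega>)) \<in> measurable M borel"
  unfolding flow_def by (rule vec_measurableI) measurable

lemma measurable_kick[measurable]: "kick L n c \<in> measurable borel (borel :: vec measure)"
  unfolding kick_def by (rule vec_measurableI) measurable

lemma measurable_flow_sum[measurable (raw)]:
  assumes [measurable]: "t \<in> borel_measurable M" "X \<in> measurable M (borel :: vec measure)"
  shows "(\<lambda>\<omega>. flow_sum L n \<alpha> (t \<omega>) (X \<omega>)) \<in> borel_measurable M"
  unfolding flow_sum_def by measurable

text \<open>
  By continuity in time, the supremum may be taken over rational times.
\<close>

lemma (in flow_params) measurable_flow_max[measurable]:
  "flow_max L n \<alpha> \<in> borel_measurable borel"
proof -
  define I where "I = {1..L} \<times> (\<rat> \<inter> {0..} :: real set)"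
  have sub: "I \<subseteq> {1..L} \<times> {0..}" and ne: "I \<noteq> {}" 
    using L_pos by (auto simp: I_def)
  have bdd: "bdd_above ((\<lambda>(i, t). \<bar>flow n \<alpha> t x i 0\<bar>) ` I)" for x
    by (rule bdd_above_mono[OF bdd_flow image_mono[OF sub]])
  have "flow_max L n \<alpha> x = (SUP (i, t)\<in>I. \<bar>flow n \<alpha> t x i 0\<bar>)" for x
  proof (rule antisym)
    show "(SUP (i, t)\<in>I. \<bar>flow n \<alpha> t x i 0\<bar>) \<le> flow_max L n \<alpha> x"
      unfolding flow_max_def by (rule cSUP_subset_mono[OF ne bdd_flow sub]) auto
    show "flow_max L n \<alpha> x \<le> (SUP (i, t)\<in>I. \<bar>flow n \<alpha> t x i 0\<bar>)"
    proof (rule flow_max_least)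
      fix i and t :: real assume i: "i \<in> {1..L}" and t: "0 \<le> t"
      have "\<forall>k. \<exists>q\<in>\<rat>. t < q \<and> q < t + 1 / Suc k"
        by (intro allI Rats_dense_in_real) simp
      then obtain q where q: "\<And>k. q k \<in> \<rat>" "\<And>k. t < q k" "\<And>k. q k < t + 1 / Suc k" by metis
      have lim: "q \<longlonglongrightarrow> t"
      proof (rule tendsto_sandwich[of "\<lambda>_. t" q _ "\<lambda>k. t + 1 / Suc k"])
        show "(\<lambda>k. t + 1 / Suc k) \<longlonglongrightarrow> t"
          using tendsto_add[OF tendsto_const LIMSEQ_inverse_real_of_nat, of t]
          by (simp add: inverse_eq_divide)
      qed (use q in \<open>auto intro!: always_eventually less_imp_le\<close>)
      have "(\<lambda>k. \<bar>flow n \<alpha> (q k) x i 0\<bar>) \<longlonglongrightarrow> \<bar>flow n \<alpha> t x i 0\<bar>"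
        unfolding flow_def by (intro tendsto_intros lim) auto
      moreover have "\<bar>flow n \<alpha> (q k) x i 0\<bar> \<le> (SUP (i, t)\<in>I. \<bar>flow n \<alpha> t x i 0\<bar>)" for k
        using q(1,2)[of k] t i by (intro cSUP_upper2[OF bdd, of "(i, q k)"]) (auto simp: I_def)
      ultimately show "\<bar>flow n \<alpha> t x i 0\<bar> \<le> (SUP (i, t)\<in>I. \<bar>flow n \<alpha> t x i 0\<bar>)"
        by (intro LIMSEQ_le_const2) auto
    qed
  qed
  moreover have "(\<lambda>x. SUP (i, t)\<in>I. \<bar>flow n \<alpha> t x i 0\<bar>) \<in> borel_measurable borel"
  proof (rule borel_measurable_cSUP)
    show "countable I" by (auto simp: I_def intro!: countable_Int1 countable_rat)
  qed (use bdd in \<open>auto simp: case_prod_unfold\<close>)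
  ultimately show ?thesis by presburger
qed

text \<open>
  The suprema of \<open>f\<close> are over intervals that grow with their endpoint, hence monotone functions
  of it, and Borel.
\<close>

lemma (in hawkes_params) measurable_rate[measurable]: "rate \<in> borel_measurable borel"
proof -
  have [measurable]: "(\<lambda>r. SUP y\<in>{0..max 0 r}. f y) \<in> borel_measurable borel"
    by (intro borel_measurable_mono monoI cSUP_subset_mono f_bdd) auto
  have [measurable]: "(\<lambda>r. SUP y\<in>{-max 0 r..0}. f y) \<in> borel_measurable borel"
    by (intro borel_measurable_mono monoI cSUP_subset_mono f_bdd) auto
  have [measurable]: "(\<lambda>r. SUP y\<in>{-max 0 r..max 0 r}. f y) \<in> borel_measurable borel"
    by (intro borel_measurable_mono monoI cSUP_subset_mono f_bdd) auto
  have eq: "max 0 (real L * flow_max L n \<alpha> x) = real L * flow_max L n \<alpha> x" for x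
    using flow_max_nonneg[of x] by simp
  have *: "rate = (\<lambda>x.
     if \<forall>i\<in>{1..L}. \<forall>k\<in>{..n i}. 0 \<le> x i k then (\<lambda>r. SUP y\<in>{0..max 0 r}. f y) (real L * flow_max L n \<alpha> x)
     else if \<forall>i\<in>{1..L}. \<forall>k\<in>{..n i}. x i k \<le> 0 then (\<lambda>r. SUP y\<in>{-max 0 r..0}. f y) (real L * flow_max L n \<alpha> x)
     else (\<lambda>r. SUP y\<in>{-max 0 r..max 0 r}. f y) (real L * flow_max L n \<alpha> x))"
    by (rule ext) (simp add: rate_bound_def Let_def eq)
  show ?thesis unfolding * by measurable
qed

section \<open>Configurations and predictable processes\<close>

text \<open>
  The Hawkes process is realized on the space of locally finite sets of positive reals, with
  the identity as its random set of points. The three measurable spaces below do not depend on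
  the probability measure.
\<close>

definition confs :: "real set set" where
  "confs = {\<Phi>. \<Phi> \<subseteq> {0<..} \<and> (\<forall>t. finite (\<Phi> \<inter> {0<..t}))}"

definition conf_space :: "real set measure" where
  "conf_space = sigma confs
    {(\<lambda>\<Phi>. card (\<Phi> \<inter> B)) -` {m} \<inter> confs | B m. B \<in> sets borel \<and> (\<exists>t. B \<subseteq> {0<..t})}"

definition conf_filt :: "real \<Rightarrow> real set measure" where
  "conf_filt t = sigma confs
    {(\<lambda>\<Phi>. card (\<Phi> \<inter> B)) -` {m} \<inter> confs | B m. B \<in> sets borel \<and> B \<subseteq> {0<..t}}"

definition pred_space :: "(real \<times> real set) measure" where
  "pred_space = predictable_sigma conf_space conf_filt"

lemma space_conf_space[simp]: "space conf_space = confs"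
  by (simp add: conf_space_def space_measure_of_conv)

lemma space_conf_filt[simp]: "space (conf_filt t) = confs"
  by (simp add: conf_filt_def space_measure_of_conv)

lemma space_pred_space[simp]: "space pred_space = {0..} \<times> confs"
  by (simp add: pred_space_def predictable_sigma_def space_measure_of_conv)

lemma natural_filtration_eq_conf_filt:
  "space Q = confs \<Longrightarrow> natural_filtration Q (\<lambda>\<Phi>. \<Phi>) = conf_filt"
  by (rule ext) (simp add: natural_filtration_def conf_filt_def)

lemma predictable_sigma_eq_pred_space:
  "space Q = confs \<Longrightarrow> predictable_sigma Q conf_filt = pred_space"
  by (simp add: pred_space_def predictable_sigma_def)

lemma sets_conf_filt: "sets (conf_filt t) = sigma_sets confs
    {(\<lambda>\<Phi>. card (\<Phi> \<inter> B)) -` {m} \<inter> confs | B m. B \<in> sets borel \<and> B \<subseteq> {0<..t}}"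
  unfolding conf_filt_def by (rule sets_measure_of) auto

lemma sets_conf_space: "sets conf_space = sigma_sets confs
    {(\<lambda>\<Phi>. card (\<Phi> \<inter> B)) -` {m} \<inter> confs | B m. B \<in> sets borel \<and> (\<exists>t. B \<subseteq> {0<..t})}"
  unfolding conf_space_def by (rule sets_measure_of) auto

lemma conf_filt_mono: assumes "s \<le> t" shows "sets (conf_filt s) \<subseteq> sets (conf_filt t)"
  unfolding sets_conf_filt
proof (intro sigma_sets_mono' subsetI, elim CollectE exE conjE)
  fix A B m assume "A = (\<lambda>\<Phi>. card (\<Phi> \<inter> B)) -` {m::nat} \<inter> confs" "B \<in> sets borel" "B \<subseteq> {0<..s}"
  moreover have "{0<..s} \<subseteq> {0<..t}" using assms by auto
  ultimately show "A \<in> {(\<lambda>\<Phi>. card (\<Phi> \<inter> B)) -` {m} \<inter> confs | B m. B \<in> sets borel \<and> B \<subseteq> {0<..t}}"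
    by blast
qed

lemma conf_filt_subset: "sets (conf_filt t) \<subseteq> sets conf_space"
  unfolding sets_conf_filt sets_conf_space by (intro sigma_sets_mono') blast

lemma subalgebra_conf_filt: "sets Q = sets conf_space \<Longrightarrow> subalgebra Q (conf_filt t)"
  using conf_filt_subset[of t] sets_eq_imp_space_eq[of Q conf_space] by (simp add: subalgebra_def)

lemma measurable_conf_filt_mono:
  "s \<le> t \<Longrightarrow> X \<in> measurable (conf_filt s) N \<Longrightarrow> X \<in> measurable (conf_filt t) N"
  using conf_filt_mono[of s t] by (auto simp: measurable_def)

lemma measurable_conf_filt_space:
  "X \<in> measurable (conf_filt s) N \<Longrightarrow> X \<in> measurable conf_space N"
  using conf_filt_subset[of s] by (auto simp: measurable_def)

lemma measurable_card_filt:
  assumes "B \<in> sets borel" "B \<subseteq> {0<..t}"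
  shows "(\<lambda>\<Phi>. card (\<Phi> \<inter> B)) \<in> measurable (conf_filt t) (count_space UNIV)"
proof (subst measurable_count_space_eq_countable)
  show "countable (UNIV :: nat set)" by simp
  show "(\<lambda>\<Phi>. card (\<Phi> \<inter> B)) \<in> space (conf_filt t) \<rightarrow> UNIV \<and>
     (\<forall>a\<in>UNIV. (\<lambda>\<Phi>. card (\<Phi> \<inter> B)) -` {a} \<inter> space (conf_filt t) \<in> sets (conf_filt t))"
    using assms unfolding sets_conf_filt space_conf_filt by blast
qed

lemma measurable_into_conf_space:
  assumes "X \<in> space M \<rightarrow> confs"
    and "\<And>B t. B \<in> sets borel \<Longrightarrow> B \<subseteq> {0<..t} \<Longrightarrow> (\<lambda>\<omega>. card (X \<omega> \<inter> B)) \<in> measurable M (count_space UNIV)"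
  shows "X \<in> measurable M conf_space"
  unfolding conf_space_def
proof (rule measurable_measure_of)
  fix A assume "A \<in> {(\<lambda>\<Phi>. card (\<Phi> \<inter> B)) -` {m} \<inter> confs | B m. B \<in> sets borel \<and> (\<exists>t. B \<subseteq> {0<..t})}"
  then obtain B m t where A: "A = (\<lambda>\<Phi>. card (\<Phi> \<inter> B)) -` {m::nat} \<inter> confs" "B \<in> sets borel" "B \<subseteq> {0<..t}"
    by blast
  have "X -` A \<inter> space M = (\<lambda>\<omega>. card (X \<omega> \<inter> B)) -` {m} \<inter> space M"
    using assms(1) by (auto simp: A)
  also have "\<dots> \<in> sets M"
    by (rule measurable_sets[OF assms(2)[OF A(2,3)]]) simp
  finally show "X -` A \<inter> space M \<in> sets M" .
qed (use assms(1) in auto)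

lemma confs_Int: "\<Phi> \<in> confs \<Longrightarrow> \<Phi> \<inter> S \<in> confs"
proof -
  assume *: "\<Phi> \<in> confs"
  have "finite (\<Phi> \<inter> S \<inter> {0<..t})" for t
    using * finite_subset[of "\<Phi> \<inter> S \<inter> {0<..t}" "\<Phi> \<inter> {0<..t}"] by (auto simp: confs_def)
  then show ?thesis using * by (auto simp: confs_def)
qed

lemma confs_finite_open: "\<Phi> \<in> confs \<Longrightarrow> finite (\<Phi> \<inter> {0<..<t})"
  by (rule finite_subset[of _ "\<Phi> \<inter> {0<..t}"]) (auto simp: confs_def)

text \<open>
  Each generator of the history up to \<open>t\<close> looks at the points up to \<open>t\<close> only, and this property
  passes to the generated \<open>\<sigma>\<close>-algebra.
\<close>

lemma conf_filt_determined:
  assumes "A \<in> sets (conf_filt t)" "\<Phi> \<in> confs" "\<Psi> \<in> confs" "\<Phi> \<inter> {0<..t} = \<Psi> \<inter> {0<..t}"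
  shows "\<Phi> \<in> A \<longleftrightarrow> \<Psi> \<in> A"
  using assms(1) unfolding sets_conf_filt
proof (induction rule: sigma_sets.induct)
  case (Basic A)
  then obtain B m where A: "A = (\<lambda>\<Phi>. card (\<Phi> \<inter> B)) -` {m::nat} \<inter> confs" "B \<subseteq> {0<..t}"
    by blast
  have "\<Phi> \<inter> B = \<Psi> \<inter> B" using A(2) assms(4) by blast
  then show ?case using assms(2,3) by (auto simp: A)
qed (use assms in auto)

lemma pred_set_determined:
  assumes "C \<in> sets pred_space" "\<Phi> \<in> confs" "0 \<le> u"
  shows "(u, \<Phi>) \<in> C \<longleftrightarrow> (u, \<Phi> \<inter> {0<..<u}) \<in> C"
proof -
  let ?E = "{{0} \<times> A | A. A \<in> sets (conf_filt 0)} \<union>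
     {{s<..t} \<times> A | s t A. 0 \<le> s \<and> s \<le> t \<and> A \<in> sets (conf_filt s)}"
  have sub: "?E \<subseteq> Pow ({0..} \<times> confs)"
    using sets.sets_into_space[of _ "conf_filt _"] by fastforce
  have "C \<in> sigma_sets ({0..} \<times> confs) ?E"
    using assms(1) unfolding pred_space_def predictable_sigma_def space_conf_space
    using sets_measure_of[OF sub] by simp
  then show ?thesis
  proof (induction rule: sigma_sets.induct)
    case (Basic C)
    then consider A where "C = {0} \<times> A" "A \<in> sets (conf_filt 0)"
      | s t A where "C = {s<..t} \<times> A" "0 \<le> s" "s \<le> t" "A \<in> sets (conf_filt s)" by blast
    then show ?case
    proof cases
      case 1
      have "\<Phi> \<in> A \<longleftrightarrow> \<Phi> \<inter> {0<..<u} \<in> A"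
        by (rule conf_filt_determined[OF 1(2)]) (use assms confs_Int in auto)
      then show ?thesis by (simp add: 1)
    next
      case 2
      have "\<Phi> \<in> A \<longleftrightarrow> \<Phi> \<inter> {0<..<u} \<in> A" if "s < u"
        by (rule conf_filt_determined[OF 2(4)]) (use that assms confs_Int in auto)
      then show ?thesis by (auto simp: 2)
    qed
  qed (use assms confs_Int in auto)
qed

text \<open>
  The value of a predictable process at time \<open>u\<close> is a function of the points strictly before \<open>u\<close>.
  This is what allows, at a candidate time, to replace all accepted points by those already
  accepted.
\<close>

lemma predictable_determined:
  fixes Z :: "real \<times> real set \<Rightarrow> 'a :: t1_space"
  assumes "Z \<in> borel_measurable pred_space" "\<Phi> \<in> confs" "\<Psi> \<in> confs" "0 \<le> u"
    and eq: "\<Phi> \<inter> {0<..<u} = \<Psi> \<inter> {0<..<u}"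
  shows "Z (u, \<Phi>) = Z (u, \<Psi>)"
proof -
  let ?C = "Z -` {Z (u, \<Phi>)} \<inter> space pred_space"
  have C: "?C \<in> sets pred_space"
    by (rule measurable_sets[OF assms(1)]) simp
  have "(u, \<Phi>) \<in> ?C" using assms by simp
  then have "(u, \<Psi>) \<in> ?C"
    using pred_set_determined[OF C assms(2,4)] pred_set_determined[OF C assms(3,4)] eq by simp
  then show ?thesis by simp
qed

lemma sets_pred_space: "sets pred_space = sigma_sets ({0..} \<times> confs)
    ({{0} \<times> A | A. A \<in> sets (conf_filt 0)} \<union>
     {{s<..t} \<times> A | s t A. 0 \<le> s \<and> s \<le> t \<and> A \<in> sets (conf_filt s)})"
  unfolding pred_space_def predictable_sigma_def space_conf_space
  by (rule sets_measure_of) (use sets.sets_into_space[of _ "conf_filt _"] in fastforce)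

lemma rectangle_predictable:
  "0 \<le> s \<Longrightarrow> s \<le> t \<Longrightarrow> A \<in> sets (conf_filt s) \<Longrightarrow> {s<..t} \<times> A \<in> sets pred_space"
  unfolding sets_pred_space by blast

lemma ray_predictable:
  assumes "0 \<le> q" "A \<in> sets (conf_filt q)"
  shows "{q<..} \<times> A \<in> sets pred_space"
proof -
  have "{q<..} = (\<Union>k::nat. {q<..q + real k})"
  proof (intro set_eqI iffI)
    fix u assume "u \<in> {q<..}"
    moreover obtain k :: nat where "u - q \<le> real k" using real_arch_simple by blast
    ultimately show "u \<in> (\<Union>k::nat. {q<..q + real k})" by (auto intro!: exI[of _ k])
  qed auto
  then have "{q<..} \<times> A = (\<Union>k::nat. {q<..q + real k} \<times> A)" by auto
  also have "\<dots> \<in> sets pred_space"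
    using assms by (intro sets.countable_UN) (auto intro: rectangle_predictable)
  finally show ?thesis .
qed

text \<open>
  A process that exceeds a level at time \<open>u\<close> precisely when an adapted process exceeds it at an
  earlier rational time is predictable: its level sets are countable unions of rays. Left
  limits of increasing processes are of this kind, and so are indicators of times after a
  stopping time.
\<close>

lemma predictable_by_rationals:
  fixes X Y :: "real \<Rightarrow> real set \<Rightarrow> real"
  assumes Y: "\<And>q. 0 \<le> q \<Longrightarrow> Y q \<in> borel_measurable (conf_filt q)"
    and X: "\<And>u \<Phi>. 0 \<le> u \<Longrightarrow> \<Phi> \<in> confs \<Longrightarrow> 0 \<le> X u \<Phi>"
    and XY: "\<And>u \<Phi> r. 0 \<le> u \<Longrightarrow> \<Phi> \<in> confs \<Longrightarrow> 0 \<le> r \<Longrightarrow>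
      r < X u \<Phi> \<longleftrightarrow> (\<exists>q\<in>\<rat>. 0 \<le> q \<and> q < u \<and> r < Y q \<Phi>)"
  shows "(\<lambda>(u, \<Phi>). X u \<Phi>) \<in> borel_measurable pred_space"
proof (subst borel_measurable_iff_greater, intro allI)
  fix r
  show "{w \<in> space pred_space. r < (case w of (u, \<Phi>) \<Rightarrow> X u \<Phi>)} \<in> sets pred_space"
  proof (cases "0 \<le> r")
    case True
    have "{w \<in> space pred_space. r < (case w of (u, \<Phi>) \<Rightarrow> X u \<Phi>)} =
       (\<Union>q\<in>\<rat> \<inter> {0..}. {q<..} \<times> {\<Phi> \<in> space (conf_filt q). r < Y q \<Phi>})"
      using XY True by auto
    also have "\<dots> \<in> sets pred_space"
    proof (intro sets.countable_UN'' countable_Int1 countable_rat ray_predictable)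
      fix q assume "q \<in> \<rat> \<inter> {0::real..}"
      then show "0 \<le> q" "{\<Phi> \<in> space (conf_filt q). r < Y q \<Phi>} \<in> sets (conf_filt q)"
        using Y[of q] by (auto simp: borel_measurable_iff_greater)
    qed
    finally show ?thesis .
  next
    case False
    then have "{w \<in> space pred_space. r < (case w of (u, \<Phi>) \<Rightarrow> X u \<Phi>)} = space pred_space"
      using X by fastforce
    then show ?thesis by (simp only: sets.top)
  qed
qed

lemma predictable_time: "fst \<in> borel_measurable pred_space"
proof -
  have "(\<lambda>(u, \<Phi>). u) \<in> borel_measurable pred_space"
  proof (rule predictable_by_rationals[where Y = "\<lambda>q \<Phi>. q"])
    fix u r :: real assume "0 \<le> u" "0 \<le> r"
    show "r < u \<longleftrightarrow> (\<exists>q\<in>\<rat>. 0 \<le> q \<and> q < u \<and> r < q)"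
    proof
      assume "r < u"
      from Rats_dense_in_real[OF this] obtain q where "q \<in> \<rat>" "r < q" "q < u" by blast
      with \<open>0 \<le> r\<close> show "\<exists>q\<in>\<rat>. 0 \<le> q \<and> q < u \<and> r < q" by (intro bexI[of _ q]) auto
    qed auto
  qed auto
  then show ?thesis by (simp add: case_prod_unfold)
qed

text \<open>
  Among finitely many points below \<open>u\<close> there is a last one, and a rational time after it.
\<close>

lemma rational_gap:
  assumes "\<Phi> \<in> confs" "0 < u" "v < u"
  obtains q where "q \<in> \<rat>" "0 \<le> q" "v < q" "q < u" "\<Phi> \<inter> {0<..<u} = \<Phi> \<inter> {0<..q}"
proof -
  let ?S = "insert 0 (insert v (\<Phi> \<inter> {0<..<u}))"
  have fin: "finite ?S" using confs_finite_open[OF assms(1)] by simp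
  have "Max ?S < u" using fin assms by (subst Max_less_iff) auto
  from Rats_dense_in_real[OF this] obtain q where q: "q \<in> \<rat>" "Max ?S < q" "q < u" by blast
  have gt: "s < q" if "s \<in> ?S" for s using Max_ge[OF fin that] q(2) by simp
  show ?thesis
  proof (rule that[of q])
    show "\<Phi> \<inter> {0<..<u} = \<Phi> \<inter> {0<..q}"
      using gt q(3) by (auto intro!: less_imp_le[OF gt])
  qed (use q gt[of 0] gt[of v] in auto)
qed

lemma predictable_count:
  assumes B: "B \<in> sets borel"
  shows "(\<lambda>(u, \<Phi>). real (card (\<Phi> \<inter> B \<inter> {0<..<u}))) \<in> borel_measurable pred_space"
proof (rule predictable_by_rationals[where Y = "\<lambda>q \<Phi>. real (card (\<Phi> \<inter> (B \<inter> {0<..q})))"])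
  show "(\<lambda>\<Phi>. real (card (\<Phi> \<inter> (B \<inter> {0<..q})))) \<in> borel_measurable (conf_filt q)" for q
    using measurable_card_filt[of "B \<inter> {0<..q}" q] B by measurable
next
  fix u r :: real and \<Phi> assume u: "0 \<le> u" and \<Phi>: "\<Phi> \<in> confs" and r: "0 \<le> r"
  show "r < real (card (\<Phi> \<inter> B \<inter> {0<..<u})) \<longleftrightarrow>
     (\<exists>q\<in>\<rat>. 0 \<le> q \<and> q < u \<and> r < real (card (\<Phi> \<inter> (B \<inter> {0<..q}))))"
  proof
    assume *: "r < real (card (\<Phi> \<inter> B \<inter> {0<..<u}))"
    have "0 < u"
    proof (rule ccontr)
      assume "\<not> 0 < u"
      then have "{0<..<u} = {}" by auto
      then show False using * r by simp
    qed
    then obtain q where "q \<in> \<rat>" "0 \<le> q" "q < u" "\<Phi> \<inter> {0<..<u} = \<Phi> \<inter> {0<..q}"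
      using rational_gap[OF \<Phi>] by blast
    moreover from this have "\<Phi> \<inter> B \<inter> {0<..<u} = \<Phi> \<inter> (B \<inter> {0<..q})" by blast
    ultimately show "\<exists>q\<in>\<rat>. 0 \<le> q \<and> q < u \<and> r < real (card (\<Phi> \<inter> (B \<inter> {0<..q})))"
      using * by auto
  next
    assume "\<exists>q\<in>\<rat>. 0 \<le> q \<and> q < u \<and> r < real (card (\<Phi> \<inter> (B \<inter> {0<..q})))"
    then obtain q where q: "q < u" "r < real (card (\<Phi> \<inter> (B \<inter> {0<..q})))" by blast
    have "card (\<Phi> \<inter> (B \<inter> {0<..q})) \<le> card (\<Phi> \<inter> B \<inter> {0<..<u})"
      using q(1) by (intro card_mono finite_subset[OF _ confs_finite_open[OF \<Phi>, of u]]) auto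
    then show "r < real (card (\<Phi> \<inter> B \<inter> {0<..<u}))" using q(2) by linarith
  qed
qed simp

text \<open>
  The integrands whose sum over the points before \<open>u\<close> is predictable form a monotone class; for
  a product of indicators the sum is a count.
\<close>

lemma predictable_sum_indicator:
  assumes "C \<in> sets (borel \<Otimes>\<^sub>M borel)"
  shows "(\<lambda>(u, \<Phi>). ennreal (\<Sum>s\<in>\<Phi> \<inter> {0<..<u}. indicator C (u, s))) \<in> borel_measurable pred_space"
proof -
  let ?E = "{a \<times> b | a b. a \<in> sets (borel :: real measure) \<and> b \<in> sets (borel :: real measure)}"
  have C: "C \<in> sigma_sets (UNIV \<times> UNIV) ?E"
    using assms by (simp add: sets_pair_measure)
  have sub: "?E \<subseteq> Pow (UNIV \<times> UNIV)" by auto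
  have "(\<lambda>(u, \<Phi>). \<Sum>s\<in>\<Phi> \<inter> {0<..<u}. indicator C (u, s) :: real) \<in> borel_measurable pred_space"
    using Int_stable_pair_measure_generator sub C
  proof (induction rule: sigma_sets_induct_disjoint)
    case (basic D)
    then obtain A B where D: "D = A \<times> B" "A \<in> sets borel" "B \<in> sets borel" by auto
    have ind: "(\<lambda>w. indicator A (fst w) :: real) \<in> borel_measurable pred_space"
      by (rule measurable_compose[OF predictable_time borel_measurable_indicator[OF D(2)]])
    have prod: "(\<lambda>w. indicator A (fst w) * (case w of (u, \<Phi>) \<Rightarrow> real (card (\<Phi> \<inter> B \<inter> {0<..<u}))))
        \<in> borel_measurable pred_space"
      by (rule borel_measurable_times[OF ind predictable_count[OF D(3)]])
    have eq: "(\<Sum>s\<in>\<Phi> \<inter> {0<..<u}. indicator D (u, s)) =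
        indicator A u * real (card (\<Phi> \<inter> B \<inter> {0<..<u}))" if "\<Phi> \<in> confs" for u :: real and \<Phi>
    proof -
      have fin: "finite (\<Phi> \<inter> {0<..<u})" by (rule confs_finite_open[OF that])
      have "(\<Sum>s\<in>\<Phi> \<inter> {0<..<u}. indicator D (u, s) :: real) =
          indicator A u * (\<Sum>s\<in>\<Phi> \<inter> {0<..<u}. indicator B s)"
        by (simp add: D indicator_times sum_distrib_left)
      also have "(\<Sum>s\<in>\<Phi> \<inter> {0<..<u}. indicator B s :: real) = real (card (\<Phi> \<inter> {0<..<u} \<inter> B))"
        using sum_indicator_eq_card[OF fin, of B] sum.inter_restrict[OF fin, of "\<lambda>_. 1::real" B]
        by (simp add: indicator_def of_bool_def)
      finally show ?thesis by (simp add: Int_ac)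
    qed
    show ?case
    proof (rule measurable_cong[THEN iffD2, OF _ prod])
      fix w assume "w \<in> space pred_space"
      then obtain u \<Phi> where w: "w = (u, \<Phi>)" "\<Phi> \<in> confs" by auto
      show "(case w of (u, \<Phi>) \<Rightarrow> \<Sum>s\<in>\<Phi> \<inter> {0<..<u}. indicator D (u, s)) =
        indicator A (fst w) * (case w of (u, \<Phi>) \<Rightarrow> real (card (\<Phi> \<inter> B \<inter> {0<..<u})))"
        unfolding w(1) prod.case fst_conv by (rule eq[OF w(2)])
    qed
  next
    case empty
    then show ?case by simp
  next
    case (compl D)
    have eq: "(\<Sum>s\<in>\<Phi> \<inter> {0<..<u}. indicator (UNIV \<times> UNIV - D) (u, s) :: real) =
        real (card (\<Phi> \<inter> UNIV \<inter> {0<..<u})) - (\<Sum>s\<in>\<Phi> \<inter> {0<..<u}. indicator D (u, s))"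
      for u :: real and \<Phi> :: "real set"
    proof -
      have "indicator (UNIV \<times> UNIV - D) (u, s) = (1::real) - indicator D (u, s)" for s
        by (simp add: indicator_def)
      then show ?thesis by (simp add: sum_subtractf)
    qed
    show ?case
      unfolding eq using borel_measurable_diff[OF predictable_count[of UNIV] compl(2)]
      by (simp add: case_prod_unfold)
  next
    case (union D)
    show ?case
    proof (rule borel_measurable_LIMSEQ_real[where u =
        "\<lambda>k w. \<Sum>i<k. case w of (u, \<Phi>) \<Rightarrow> \<Sum>s\<in>\<Phi> \<inter> {0<..<u}. indicat_real (D i) (u, s)"])
      fix w :: "real \<times> real set"
      show "(\<lambda>k. \<Sum>i<k. case w of (u, \<Phi>) \<Rightarrow> \<Sum>s\<in>\<Phi> \<inter> {0<..<u}. indicat_real (D i) (u, s)) \<longlonglongrightarrow>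
         (case w of (u, \<Phi>) \<Rightarrow> \<Sum>s\<in>\<Phi> \<inter> {0<..<u}. indicat_real (\<Union> (range D)) (u, s))"
      proof (cases w)
        case (Pair u \<Phi>)
        have dis: "disjoint_family_on D {..<k}" for k
          using disjoint_family_on_mono[OF _ union(1), of "{..<k}"] by simp
        have swap: "(\<Sum>i<k. \<Sum>s\<in>\<Phi> \<inter> {0<..<u}. indicator (D i) (u, s) :: real) =
           (\<Sum>s\<in>\<Phi> \<inter> {0<..<u}. indicator (\<Union>i<k. D i) (u, s))" for k
        proof -
          have "(\<Sum>i<k. \<Sum>s\<in>\<Phi> \<inter> {0<..<u}. indicator (D i) (u, s) :: real) =
            (\<Sum>s\<in>\<Phi> \<inter> {0<..<u}. \<Sum>i<k. indicator (D i) (u, s))"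
            by (rule sum.swap)
          also have "\<dots> = (\<Sum>s\<in>\<Phi> \<inter> {0<..<u}. indicator (\<Union>i<k. D i) (u, s))"
            by (intro sum.cong refl indicator_UN_disjoint[symmetric] dis) simp
          finally show ?thesis .
        qed
        show ?thesis
          unfolding Pair prod.case swap by (rule tendsto_sum) (rule LIMSEQ_indicator_UN)
      qed
    next
      fix k
      show "(\<lambda>w. \<Sum>i<k. case w of (u, \<Phi>) \<Rightarrow> \<Sum>s\<in>\<Phi> \<inter> {0<..<u}. indicat_real (D i) (u, s)) \<in> borel_measurable pred_space"
        using union(3) by (rule borel_measurable_sum)
    qed
  qed
  then have "(\<lambda>w. ennreal (case w of (u, \<Phi>) \<Rightarrow> \<Sum>s\<in>\<Phi> \<inter> {0<..<u}. indicator C (u, s))) \<in> borel_measurable pred_space"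
    by (rule measurable_compose) (rule measurable_ennreal)
  moreover have "(\<lambda>w. ennreal (case w of (u, \<Phi>) \<Rightarrow> \<Sum>s\<in>\<Phi> \<inter> {0<..<u}. indicator C (u, s))) =
     (\<lambda>(u, \<Phi>). ennreal (\<Sum>s\<in>\<Phi> \<inter> {0<..<u}. indicator C (u, s)))"
    by (rule ext) (simp split: prod.split)
  ultimately show ?thesis by metis
qed

lemma predictable_sum_ennreal:
  fixes G :: "real \<times> real \<Rightarrow> ennreal"
  assumes "G \<in> borel_measurable (borel \<Otimes>\<^sub>M borel)"
  shows "(\<lambda>(u, \<Phi>). \<Sum>s\<in>\<Phi> \<inter> {0<..<u}. G (u, s)) \<in> borel_measurable pred_space"
  using assms
proof (induction rule: borel_measurable_induct)
  case (cong g f)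
  then have "g = f" by (auto simp: space_pair_measure)
  with cong show ?case by simp
next
  case (set A)
  show ?case using predictable_sum_indicator[OF set] by (simp add: sum_ennreal[symmetric] ennreal_indicator)
next
  case (mult g c)
  then have "(\<lambda>w. c * (case w of (u, \<Phi>) \<Rightarrow> \<Sum>s\<in>\<Phi> \<inter> {0<..<u}. g (u, s))) \<in> borel_measurable pred_space"
    by simp
  then show ?case by (simp add: case_prod_unfold sum_distrib_left)
next
  case (add g h)
  then have "(\<lambda>w. (case w of (u, \<Phi>) \<Rightarrow> \<Sum>s\<in>\<Phi> \<inter> {0<..<u}. h (u, s)) +
      (case w of (u, \<Phi>) \<Rightarrow> \<Sum>s\<in>\<Phi> \<inter> {0<..<u}. g (u, s))) \<in> borel_measurable pred_space"
    by simp
  then show ?case by (simp add: case_prod_unfold sum.distrib)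
next
  case (seq V)
  have "(\<lambda>(u, \<Phi>). \<Sum>s\<in>\<Phi> \<inter> {0<..<u}. Sup (range V) (u, s)) =
     (\<lambda>w. SUP i. (case w of (u, \<Phi>) \<Rightarrow> \<Sum>s\<in>\<Phi> \<inter> {0<..<u}. V i (u, s)))"
  proof -
    have e: "(SUP i. \<Sum>s\<in>\<Phi> \<inter> {0<..<u}. V i (u, s)) = (\<Sum>s\<in>\<Phi> \<inter> {0<..<u}. SUP i. V i (u, s))"
      for u :: real and \<Phi>
      using seq(3) by (intro ennreal_SUP_sum) (auto simp: incseq_def le_fun_def)
    show ?thesis by (auto simp: fun_eq_iff e SUP_apply image_image)
  qed
  then show ?case using seq by simp
qed

lemma predictable_sum:
  fixes G :: "real \<times> real \<Rightarrow> real"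
  assumes [measurable]: "G \<in> borel_measurable (borel \<Otimes>\<^sub>M borel)"
  shows "(\<lambda>(u, \<Phi>). \<Sum>s\<in>\<Phi> \<inter> {0<..<u}. G (u, s)) \<in> borel_measurable pred_space"
proof -
  have *: "(\<lambda>w. enn2real (case w of (u, \<Phi>) \<Rightarrow> \<Sum>s\<in>\<Phi> \<inter> {0<..<u}. ennreal (H (u, s)))) \<in> borel_measurable pred_space"
    if "H \<in> borel_measurable (borel \<Otimes>\<^sub>M borel)" for H :: "real \<times> real \<Rightarrow> real"
    using predictable_sum_ennreal[of "\<lambda>x. ennreal (H x)"] that by measurable
  have eq: "(\<lambda>(u, \<Phi>). \<Sum>s\<in>\<Phi> \<inter> {0<..<u}. G (u, s)) =
    (\<lambda>w. enn2real (case w of (u, \<Phi>) \<Rightarrow> \<Sum>s\<in>\<Phi> \<inter> {0<..<u}. ennreal (max 0 (G (u, s)))) -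
         enn2real (case w of (u, \<Phi>) \<Rightarrow> \<Sum>s\<in>\<Phi> \<inter> {0<..<u}. ennreal (max 0 (- G (u, s)))))"
  proof -
    have e: "enn2real (\<Sum>s\<in>S. ennreal (max 0 (H s))) = (\<Sum>s\<in>S. max 0 (H s))" for H :: "real \<Rightarrow> real" and S
      by (subst sum_ennreal) (simp_all add: sum_nonneg del: ennreal_max_0 ennreal_max_0')
    have "(\<Sum>s\<in>S. H s) = (\<Sum>s\<in>S. max 0 (H s)) - (\<Sum>s\<in>S. max 0 (- H s))" for H :: "real \<Rightarrow> real" and S
      unfolding sum_subtractf[symmetric] by (intro sum.cong) auto
    note this[of "\<lambda>s. G (u, s)" for u]
    then show ?thesis unfolding fun_eq_iff by (simp add: e sum_nonneg del: ennreal_max_0 ennreal_max_0')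
  qed
  show ?thesis unfolding eq by (intro borel_measurable_diff *) measurable
qed

text \<open>
  Read along a time change \<open>\<theta>\<close>, a predictable process is jointly measurable in time and the
  history up to the supremum of \<open>\<theta>\<close>: the event \<open>A\<close> of a rectangle \<open>{a<..b} \<times> A\<close> matters only if \<open>\<theta>\<close>
  exceeds \<open>a\<close>.
\<close>

lemma predictable_pullback:
  assumes \<theta>: "\<theta> \<in> borel_measurable borel" "\<And>s. 0 \<le> \<theta> s"
    and K: "space K = confs" "sets (conf_filt 0) \<subseteq> sets K"
      "\<And>a s. 0 \<le> a \<Longrightarrow> a < \<theta> s \<Longrightarrow> sets (conf_filt a) \<subseteq> sets K"
  shows "(\<lambda>(s, \<Phi>). (\<theta> s, \<Phi>)) \<in> measurable (borel \<Otimes>\<^sub>M K) pred_space"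
  unfolding pred_space_def predictable_sigma_def space_conf_space
proof (rule measurable_measure_of)
  show "{{0} \<times> A | A. A \<in> sets (conf_filt 0)} \<union>
     {{s<..t} \<times> A | s t A. 0 \<le> s \<and> s \<le> t \<and> A \<in> sets (conf_filt s)} \<subseteq> Pow ({0..} \<times> confs)"
    using sets.sets_into_space[of _ "conf_filt _"] by fastforce
  show "(\<lambda>(s, \<Phi>). (\<theta> s, \<Phi>)) \<in> space (borel \<Otimes>\<^sub>M K) \<rightarrow> {0..} \<times> confs"
    using \<theta>(2) by (auto simp: space_pair_measure K(1))
  fix C assume "C \<in> {{0} \<times> A | A. A \<in> sets (conf_filt 0)} \<union>
     {{s<..t} \<times> A | s t A. 0 \<le> s \<and> s \<le> t \<and> A \<in> sets (conf_filt s)}"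
  then consider A where "C = {0} \<times> A" "A \<in> sets (conf_filt 0)"
    | a b A where "C = {a<..b} \<times> A" "0 \<le> a" "A \<in> sets (conf_filt a)" by blast
  then obtain S A where C: "C = S \<times> A" "S \<in> sets borel" and A: "\<theta> -` S = {} \<or> A \<in> sets K"
  proof cases
    case 1
    then show ?thesis using K(2) by (intro that[of "{0}" A]) auto
  next
    case 2
    have "A \<in> sets K" if "a < \<theta> s" for s using K(3)[OF 2(2) that] 2(3) by blast
    then have "\<theta> -` {a<..b} = {} \<or> A \<in> sets K" by auto
    then show ?thesis using 2 by (intro that[of "{a<..b}" A]) auto
  qed
  have "\<theta> -` S \<times> A \<in> sets (borel \<Otimes>\<^sub>M K)"
    using A measurable_sets[OF \<theta>(1) C(2)] by (cases "\<theta> -` S = {}") auto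
  moreover have "(\<lambda>(s, \<Phi>). (\<theta> s, \<Phi>)) -` C \<inter> space (borel \<Otimes>\<^sub>M K) = \<theta> -` S \<times> A"
    using A sets.sets_into_space[of A K] by (auto simp: C(1) space_pair_measure)
  ultimately show "(\<lambda>(s, \<Phi>). (\<theta> s, \<Phi>)) -` C \<inter> space (borel \<Otimes>\<^sub>M K) \<in> sets (borel \<Otimes>\<^sub>M K)"
    by simp
qed

lemma progressive:
  assumes "0 \<le> q"
  shows "(\<lambda>(s, \<Phi>). (max 0 (min s q), \<Phi>)) \<in> measurable (borel \<Otimes>\<^sub>M conf_filt q) pred_space"
  by (rule predictable_pullback) (use assms conf_filt_mono in \<open>auto simp: less_max_iff_disj\<close>)

lemma predictable_progressive:
  assumes "Z \<in> measurable pred_space N" "0 \<le> q"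
  shows "(\<lambda>(s, \<Phi>). Z (max 0 (min s q), \<Phi>)) \<in> measurable (borel \<Otimes>\<^sub>M conf_filt q) N"
  using measurable_compose[OF progressive[OF assms(2)] assms(1)] by (simp add: case_prod_unfold)

lemma predictable_jointly_measurable:
  "(\<lambda>(s, \<Phi>). (max 0 s, \<Phi>)) \<in> measurable (borel \<Otimes>\<^sub>M conf_space) pred_space"
  by (rule predictable_pullback) (use conf_filt_subset in auto)

lemma predictable_jointly_measurable':
  assumes "Z \<in> measurable pred_space N"
  shows "(\<lambda>(s, \<Phi>). Z (max 0 s, \<Phi>)) \<in> measurable (borel \<Otimes>\<^sub>M conf_space) N"
  using measurable_compose[OF predictable_jointly_measurable assms] by (simp add: case_prod_unfold)

section \<open>Stopping the counting process\<close>

definition count_to :: "real \<Rightarrow> real set \<Rightarrow> nat" where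
  "count_to t \<Phi> = card (\<Phi> \<inter> {0<..t})"

lemma counting_id: "counting (\<lambda>\<Phi>. \<Phi>) = count_to"
  by (simp add: counting_def count_to_def fun_eq_iff)

lemma count_to_mono: "\<Phi> \<in> confs \<Longrightarrow> s \<le> t \<Longrightarrow> count_to s \<Phi> \<le> count_to t \<Phi>"
  unfolding count_to_def by (rule card_mono) (auto simp: confs_def)

lemma right_gap:
  assumes "\<Phi> \<in> confs"
  obtains e where "0 < e" "\<Phi> \<inter> {t<..t + e} = {}"
proof -
  let ?S = "insert (t + 1) (\<Phi> \<inter> {0<..t + 1} \<inter> {t<..})"
  have fin: "finite ?S" using assms by (auto simp: confs_def)
  have "t < Min ?S" using fin by (subst Min_gr_iff) auto
  then obtain r where r: "t < r" "r < Min ?S" using dense by blast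
  have lt: "r < s" if "s \<in> ?S" for s using Min_le[OF fin that] r(2) by simp
  have "\<Phi> \<inter> {t<..r} = {}"
  proof (rule ccontr)
    assume "\<not> ?thesis"
    then obtain s where s: "s \<in> \<Phi>" "t < s" "s \<le> r" by auto
    moreover have "r < t + 1" using lt by simp
    ultimately have "s \<in> ?S" using assms by (auto simp: confs_def)
    then show False using lt s(3) by fastforce
  qed
  then show ?thesis using r(1) by (intro that[of "r - t"]) auto
qed

lemma count_to_right_constant:
  assumes "\<Phi> \<in> confs"
  obtains e where "0 < e" "\<And>s. t \<le> s \<Longrightarrow> s \<le> t + e \<Longrightarrow> count_to s \<Phi> = count_to t \<Phi>"
proof -
  obtain e where e: "0 < e" "\<Phi> \<inter> {t<..t + e} = {}" by (rule right_gap[OF assms])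
  show ?thesis
  proof (rule that[OF e(1)])
    fix s assume s: "t \<le> s" "s \<le> t + e"
    then have "\<Phi> \<inter> {0<..s} = \<Phi> \<inter> {0<..t}" using e(2) by force
    then show "count_to s \<Phi> = count_to t \<Phi>" by (simp add: count_to_def)
  qed
qed

lemma count_to_measurable: "count_to t \<in> measurable (conf_filt t) (count_space UNIV)"
  unfolding count_to_def by (rule measurable_card_filt) auto

text \<open>
  The count is right-continuous in time, so its level sets can be described with rational
  later times.
\<close>

lemma count_to_progressive:
  "(\<lambda>(s, \<Phi>). real (count_to (min s t) \<Phi>)) \<in> borel_measurable (borel \<Otimes>\<^sub>M conf_filt t)"
proof (subst borel_measurable_iff_less, intro allI)
  fix r
  have "{w \<in> space (borel \<Otimes>\<^sub>M conf_filt t). (case w of (s, \<Phi>) \<Rightarrow> real (count_to (min s t) \<Phi>)) < r} =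
    (\<Union>q\<in>\<rat>. {..<q} \<times> {\<Phi> \<in> space (conf_filt t). real (count_to (min q t) \<Phi>) < r})" (is "?L = ?R")
  proof (intro set_eqI iffI)
    fix w assume "w \<in> ?L"
    then obtain s \<Phi> where w: "w = (s, \<Phi>)" "\<Phi> \<in> confs" "real (count_to (min s t) \<Phi>) < r"
      by (auto simp: space_pair_measure)
    obtain e where e: "0 < e" "\<And>v. s \<le> v \<Longrightarrow> v \<le> s + e \<Longrightarrow> count_to v \<Phi> = count_to s \<Phi>"
      by (rule count_to_right_constant[OF w(2), of s]) blast
    have "s < s + e" using e(1) by simp
    from Rats_dense_in_real[OF this] obtain q where q: "q \<in> \<rat>" "s < q" "q < s + e" by blast
    have "count_to (min q t) \<Phi> = count_to (min s t) \<Phi>"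
      using e(2)[of "min q t"] q by (cases "t \<le> s") auto
    then show "w \<in> ?R" using q w by auto
  next
    fix w assume "w \<in> ?R"
    then obtain q s \<Phi> where w: "w = (s, \<Phi>)" "s < q" "\<Phi> \<in> confs" "real (count_to (min q t) \<Phi>) < r" by auto
    have "count_to (min s t) \<Phi> \<le> count_to (min q t) \<Phi>" using w by (intro count_to_mono) auto
    then show "w \<in> ?L" using w by (auto simp: space_pair_measure)
  qed
  also have "\<dots> \<in> sets (borel \<Otimes>\<^sub>M conf_filt t)"
  proof (intro sets.countable_UN'' countable_rat pair_measureI)
    fix q :: real
    have [measurable]: "count_to (min q t) \<in> measurable (conf_filt t) (count_space UNIV)"
      by (rule measurable_conf_filt_mono[OF _ count_to_measurable]) simp
    show "{\<Phi> \<in> space (conf_filt t). real (count_to (min q t) \<Phi>) < r} \<in> sets (conf_filt t)"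
      by measurable
  qed simp
  finally show "{w \<in> space (borel \<Otimes>\<^sub>M conf_filt t). (case w of (s, \<Phi>) \<Rightarrow> real (count_to (min s t) \<Phi>)) < r}
      \<in> sets (borel \<Otimes>\<^sub>M conf_filt t)" .
qed

text \<open>
  The time at which count plus elapsed time first reaches \<open>k\<close>. Adding the elapsed time makes it
  finite and at most \<open>k\<close> even if there are few points. It tends to infinity with \<open>k\<close>, and the
  count up to it is at most \<open>k + 1\<close>, since a point adds only one to the count.
\<close>

definition stop_time :: "nat \<Rightarrow> real set \<Rightarrow> real" where
  "stop_time k \<Phi> = Inf {t. 0 \<le> t \<and> real k \<le> real (count_to t \<Phi>) + t}"

lemma stop_time_le_iff:
  assumes "\<Phi> \<in> confs" "0 \<le> t"
  shows "stop_time k \<Phi> \<le> t \<longleftrightarrow> real k \<le> real (count_to t \<Phi>) + t"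
proof
  let ?S = "{t. 0 \<le> t \<and> real k \<le> real (count_to t \<Phi>) + t}"
  have bdd: "bdd_below ?S" by (rule bdd_belowI[of _ 0]) simp
  show "stop_time k \<Phi> \<le> t" if "real k \<le> real (count_to t \<Phi>) + t"
    unfolding stop_time_def using that assms by (intro cInf_lower bdd) auto
  show "real k \<le> real (count_to t \<Phi>) + t" if le: "stop_time k \<Phi> \<le> t"
  proof (rule ccontr)
    assume less: "\<not> ?thesis"
    obtain e where e: "0 < e" "\<And>s. t \<le> s \<Longrightarrow> s \<le> t + e \<Longrightarrow> count_to s \<Phi> = count_to t \<Phi>"
      by (rule count_to_right_constant[OF assms(1), of t]) blast
    \<comment> \<open>If the level were not reached at \<open>t\<close>, it would not be reached during a further time \<open>d\<close>.\<close>
    define d where "d = min e ((real k - real (count_to t \<Phi>) - t) / 2)"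
    have d: "0 < d" "d \<le> e" "real (count_to t \<Phi>) + t + d < real k"
      using e(1) less unfolding d_def by (auto simp: min_def field_simps)
    have "t + d \<le> Inf ?S"
    proof (rule cInf_greatest)
      have "real k \<in> ?S" by simp
      then show "?S \<noteq> {}" by blast
      fix s assume s: "s \<in> ?S"
      show "t + d \<le> s"
      proof (rule ccontr)
        assume "\<not> t + d \<le> s"
        then have "count_to s \<Phi> \<le> count_to (t + d) \<Phi>" by (intro count_to_mono[OF assms(1)]) simp
        moreover have "count_to (t + d) \<Phi> = count_to t \<Phi>" using e(2)[of "t + d"] d by simp
        ultimately have "count_to s \<Phi> \<le> count_to t \<Phi>" by simp
        then show False using s d(3) \<open>\<not> t + d \<le> s\<close> by auto
      qed
    qed
    then show False using le d(1) by (simp add: stop_time_def)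
  qed
qed

lemma stop_time_nonneg: "0 \<le> stop_time k \<Phi>"
  unfolding stop_time_def by (rule cInf_greatest) (auto intro: exI[of _ "real k"])

lemma stop_time_mono:
  assumes "\<Phi> \<in> confs" "k \<le> l" shows "stop_time k \<Phi> \<le> stop_time l \<Phi>"
proof -
  have "real l \<le> real (count_to (stop_time l \<Phi>) \<Phi>) + stop_time l \<Phi>"
    using stop_time_le_iff[OF assms(1) stop_time_nonneg, of l l \<Phi>] by simp
  then show ?thesis
    using stop_time_le_iff[OF assms(1) stop_time_nonneg, of k l \<Phi>] assms(2) by simp
qed

lemma stop_time_at_top:
  assumes "\<Phi> \<in> confs" shows "filterlim (\<lambda>k. stop_time k \<Phi>) at_top sequentially"
  unfolding filterlim_at_top_ge[of _ _ 0]
proof (intro allI impI)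
  fix t :: real assume t: "0 \<le> t"
  obtain K :: nat where K: "real (count_to t \<Phi>) + t < real K" using reals_Archimedean2 by blast
  show "eventually (\<lambda>k. t \<le> stop_time k \<Phi>) sequentially"
  proof (rule eventually_sequentiallyI[of K])
    fix k assume "K \<le> k"
    then have "\<not> stop_time k \<Phi> \<le> t" using stop_time_le_iff[OF assms t, of k] K by simp
    then show "t \<le> stop_time k \<Phi>" by simp
  qed
qed

lemma stop_time_is_stopping_time: "stopping_time conf_filt (stop_time k)"
  unfolding stopping_time_def
proof
  fix t
  show "Measurable.pred (conf_filt t) (\<lambda>\<Phi>. stop_time k \<Phi> \<le> t)"
  proof (cases "0 \<le> t")
    case True
    have [measurable]: "count_to t \<in> measurable (conf_filt t) (count_space UNIV)" by (rule count_to_measurable)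
    have "Measurable.pred (conf_filt t) (\<lambda>\<Phi>. real k \<le> real (count_to t \<Phi>) + t)" by measurable
    then show ?thesis by (rule measurable_cong[THEN iffD1, rotated]) (simp add: stop_time_le_iff True)
  next
    case False
    then have "\<not> stop_time k \<Phi> \<le> t" for \<Phi> using stop_time_nonneg[of k \<Phi>] by linarith
    then show ?thesis by simp
  qed
qed

lemma count_to_stop_time_le:
  assumes "\<Phi> \<in> confs" "v \<le> stop_time k \<Phi>"
  shows "count_to v \<Phi> \<le> k + 1"
proof (cases "0 < v")
  case True
  obtain q where q: "0 \<le> q" "q < v" "\<Phi> \<inter> {0<..<v} = \<Phi> \<inter> {0<..q}"
    by (rule rational_gap[OF assms(1) True True])
  have "\<not> stop_time k \<Phi> \<le> q" using q assms(2) by simp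
  then have "count_to q \<Phi> \<le> k" using stop_time_le_iff[OF assms(1) q(1), of k] q(1) by simp
  have "\<Phi> \<inter> {0<..v} \<subseteq> insert v (\<Phi> \<inter> {0<..q})"
    unfolding q(3)[symmetric] by auto
  then have "count_to v \<Phi> \<le> card (insert v (\<Phi> \<inter> {0<..q}))"
    unfolding count_to_def using assms(1) by (intro card_mono) (auto simp: confs_def)
  also have "\<dots> \<le> count_to q \<Phi> + 1" unfolding count_to_def by (simp add: card_insert_le_m1 card_insert_if)
  finally show ?thesis using \<open>count_to q \<Phi> \<le> k\<close> by simp
qed (simp add: count_to_def)

lemma predictable_stopped:
  "(\<lambda>(u, \<Phi>). of_bool (stop_time k \<Phi> < u) :: real) \<in> borel_measurable pred_space"
proof (rule predictable_by_rationals[where Y = "\<lambda>q \<Phi>. of_bool (stop_time k \<Phi> \<le> q)"])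
  show "(\<lambda>\<Phi>. of_bool (stop_time k \<Phi> \<le> q) :: real) \<in> borel_measurable (conf_filt q)" for q
  proof -
    have [measurable]: "Measurable.pred (conf_filt q) (\<lambda>\<Phi>. stop_time k \<Phi> \<le> q)"
      using stop_time_is_stopping_time by (auto simp: stopping_time_def)
    show ?thesis by measurable
  qed
  show "r < of_bool (stop_time k \<Phi> < u) \<longleftrightarrow>
     (\<exists>q\<in>\<rat>. 0 \<le> q \<and> q < u \<and> r < (of_bool (stop_time k \<Phi> \<le> q) :: real))" if "0 \<le> r" for r u \<Phi>
  proof
    assume *: "r < of_bool (stop_time k \<Phi> < u)"
    then have "stop_time k \<Phi> < u" "r < 1" using that by (auto simp: of_bool_def split: if_splits)
    from Rats_dense_in_real[OF this(1)] obtain q where "q \<in> \<rat>" "stop_time k \<Phi> < q" "q < u" by blast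
    then show "\<exists>q\<in>\<rat>. 0 \<le> q \<and> q < u \<and> r < (of_bool (stop_time k \<Phi> \<le> q) :: real)"
      using stop_time_nonneg[of k \<Phi>] \<open>r < 1\<close> by (intro bexI[of _ q]) auto
  next
    assume "\<exists>q\<in>\<rat>. 0 \<le> q \<and> q < u \<and> r < (of_bool (stop_time k \<Phi> \<le> q) :: real)"
    then show "r < of_bool (stop_time k \<Phi> < u)" using that by (auto simp: of_bool_def split: if_splits)
  qed
qed simp

section \<open>The compensator\<close>

text \<open>
  The martingale property of the compensated count, in a form that can be proved candidate by
  candidate. The sum of \<open>Z\<close> over the points is written as an integral for the counting measure
  of the configuration.
\<close>

locale compensation =
  fixes Q :: "real set measure" and intensity :: "real \<Rightarrow> real set \<Rightarrow> real"
  assumes prob_Q: "prob_space Q" and sets_Q: "sets Q = sets conf_space"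
    and intensity_pred: "(\<lambda>(u, \<Phi>). intensity u \<Phi>) \<in> borel_measurable pred_space"
    and intensity_nonneg: "\<And>u \<Phi>. 0 \<le> intensity u \<Phi>"
    and intensity_integrable: "\<And>t \<Phi>. \<Phi> \<in> confs \<Longrightarrow> 0 \<le> t \<Longrightarrow> set_integrable lborel {0..t} (\<lambda>s. intensity s \<Phi>)"
    and compensation_formula: "\<And>Z :: real \<times> real set \<Rightarrow> ennreal. Z \<in> borel_measurable pred_space \<Longrightarrow>
      (\<lambda>\<Phi>. \<integral>\<^sup>+u. Z (u, \<Phi>) \<partial>count_space \<Phi>) \<in> borel_measurable conf_space \<Longrightarrow>
      (\<integral>\<^sup>+\<Phi>. (\<integral>\<^sup>+u. Z (u, \<Phi>) \<partial>count_space \<Phi>) \<partial>Q) =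
      (\<integral>\<^sup>+\<Phi>. (\<integral>\<^sup>+u\<in>{0<..}. Z (u, \<Phi>) * ennreal (intensity u \<Phi>) \<partial>lborel) \<partial>Q)"
begin

interpretation prob_space Q by (rule prob_Q)

lemma space_Q: "space Q = confs"
  using sets_eq_imp_space_eq[OF sets_Q] by simp

definition comp :: "real \<Rightarrow> real set \<Rightarrow> real" where
  "comp t \<Phi> = (LINT s:{0..t}|lborel. intensity s \<Phi>)"

lemma comp_zero: "comp 0 \<Phi> = 0"
proof -
  have "AE s in lborel. indicat_real {0..0} s *\<^sub>R intensity s \<Phi> = 0"
    using AE_lborel_singleton[of 0] by eventually_elim (auto simp: indicator_def)
  then show ?thesis unfolding comp_def set_lebesgue_integral_def
    by (rule integral_eq_zero_AE)
qed

lemma nn_comp: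
  assumes "\<Phi> \<in> confs" "0 \<le> s" "s \<le> t"
  shows "(\<integral>\<^sup>+u\<in>{s<..t}. ennreal (intensity u \<Phi>) \<partial>lborel) = ennreal (comp t \<Phi> - comp s \<Phi>)"
    and "comp s \<Phi> \<le> comp t \<Phi>"
proof -
  have t: "0 \<le> t" using assms by simp
  have int: "set_integrable lborel A (\<lambda>s. intensity s \<Phi>)" if "A \<subseteq> {0..t}" "A \<in> sets borel" for A
    using set_integrable_subset[OF intensity_integrable[OF assms(1) t], of A] that by simp
  have un: "{0..t} = {0..s} \<union> {s<..t}" using assms by auto
  have "comp t \<Phi> = comp s \<Phi> + (LINT u:{s<..t}|lborel. intensity u \<Phi>)"
    unfolding comp_def un by (rule set_integral_Un) (use assms in \<open>auto intro!: int\<close>)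
  moreover have "(\<integral>\<^sup>+u\<in>{s<..t}. ennreal (intensity u \<Phi>) \<partial>lborel) = ennreal (LINT u:{s<..t}|lborel. intensity u \<Phi>)"
  proof -
    have "(\<integral>\<^sup>+u\<in>{s<..t}. ennreal (intensity u \<Phi>) \<partial>lborel) =
        (\<integral>\<^sup>+u. ennreal (indicator {s<..t} u *\<^sub>R intensity u \<Phi>) \<partial>lborel)"
      by (intro nn_integral_cong) (auto simp: indicator_def)
    also have "\<dots> = ennreal (LINT u:{s<..t}|lborel. intensity u \<Phi>)"
      unfolding set_lebesgue_integral_def
    proof (rule nn_integral_eq_integral)
      have "{s<..t} \<subseteq> {0..t}" using assms by auto
      from int[OF this] show "integrable lborel (\<lambda>u. indicat_real {s<..t} u *\<^sub>R intensity u \<Phi>)"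
        by (simp add: set_integrable_def)
    qed (simp add: intensity_nonneg)
    finally show ?thesis .
  qed
  moreover have "0 \<le> (LINT u:{s<..t}|lborel. intensity u \<Phi>)"
    unfolding set_lebesgue_integral_def by (rule Bochner_Integration.integral_nonneg) (simp add: intensity_nonneg)
  ultimately show "(\<integral>\<^sup>+u\<in>{s<..t}. ennreal (intensity u \<Phi>) \<partial>lborel) = ennreal (comp t \<Phi> - comp s \<Phi>)"
    and "comp s \<Phi> \<le> comp t \<Phi>" by simp_all
qed

lemma comp_nonneg: "\<Phi> \<in> confs \<Longrightarrow> 0 \<le> t \<Longrightarrow> 0 \<le> comp t \<Phi>"
  using nn_comp(2)[of \<Phi> 0 t] by (simp add: comp_zero)

lemma comp_continuous: assumes "\<Phi> \<in> confs" shows "continuous_on {0..} (\<lambda>t. comp t \<Phi>)"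
proof -
  have "continuous_on {0..t} (\<lambda>t. comp t \<Phi>)" if "0 \<le> t" for t
  proof -
    have "set_integrable lborel {0..t} (\<lambda>s. intensity s \<Phi>)" by (rule intensity_integrable[OF assms that])
    then have "(\<lambda>s. intensity s \<Phi>) integrable_on {0..t}" by (rule set_borel_integral_eq_integral(1))
    then have "continuous_on {0..t} (\<lambda>x. integral {0..x} (\<lambda>s. intensity s \<Phi>))"
      by (rule indefinite_integral_continuous_1)
    moreover have "comp x \<Phi> = integral {0..x} (\<lambda>s. intensity s \<Phi>)" if "x \<in> {0..t}" for x
      unfolding comp_def using that
      by (intro set_borel_integral_eq_integral(2) intensity_integrable assms) auto
    ultimately show ?thesis
      by (metis (no_types, lifting) continuous_on_cong)
  qed
  note cont = this
  show ?thesis unfolding continuous_on_eq_continuous_within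
  proof
    fix x :: real assume x: "x \<in> {0..}"
    have "continuous (at x within {0..x + 1}) (\<lambda>t. comp t \<Phi>)"
      using cont[of "x + 1"] x by (auto simp: continuous_on_eq_continuous_within)
    moreover have "at x within {0..x + 1} = at x within {0..}"
      by (rule at_within_nhd[of x "{..<x + 1}"]) (use x in auto)
    ultimately show "continuous (at x within {0..}) (\<lambda>t. comp t \<Phi>)" by simp
  qed
qed

lemma comp_progressive:
  assumes "0 \<le> t"
  shows "(\<lambda>(s, \<Phi>). comp (min s t) \<Phi>) \<in> borel_measurable (borel \<Otimes>\<^sub>M conf_filt t)"
proof -
  have "(\<lambda>(u, \<Phi>). intensity (max 0 (min u t)) \<Phi>) \<in> borel_measurable (borel \<Otimes>\<^sub>M conf_filt t)"
    using predictable_progressive[OF intensity_pred assms] by simp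
  then have [measurable]: "(\<lambda>w. intensity (max 0 (min (fst w) t)) (snd w)) \<in> borel_measurable (borel \<Otimes>\<^sub>M conf_filt t)"
    by (simp add: case_prod_unfold)
  have [measurable]: "(\<lambda>w. intensity (max 0 (min (snd w) t)) (snd (fst w)))
      \<in> borel_measurable ((borel \<Otimes>\<^sub>M conf_filt t) \<Otimes>\<^sub>M lborel)"
    using measurable_compose[of "\<lambda>w. (snd w, snd (fst w))" "(borel \<Otimes>\<^sub>M conf_filt t) \<Otimes>\<^sub>M lborel"
      "borel \<Otimes>\<^sub>M conf_filt t" "\<lambda>w. intensity (max 0 (min (fst w) t)) (snd w)" borel]
    by simp
  have "(\<lambda>p. \<integral>u. indicator {u. 0 \<le> u \<and> u \<le> min (fst p) t} u *\<^sub>R intensity (max 0 (min u t)) (snd p) \<partial>lborel)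
      \<in> borel_measurable (borel \<Otimes>\<^sub>M conf_filt t)"
    unfolding indicator_def by measurable
  moreover have "(\<integral>u. indicator {u. 0 \<le> u \<and> u \<le> min s t} u *\<^sub>R intensity (max 0 (min u t)) \<Phi> \<partial>lborel) =
      comp (min s t) \<Phi>" for s \<Phi>
    unfolding comp_def set_lebesgue_integral_def
    by (intro Bochner_Integration.integral_cong) (auto simp: indicator_def)
  ultimately show ?thesis unfolding case_prod_unfold by (simp only:)
qed

lemma comp_measurable: "0 \<le> t \<Longrightarrow> comp t \<in> borel_measurable (conf_filt t)"
  using measurable_compose[OF measurable_Pair1'[of t borel "conf_filt t"] comp_progressive[of t]] by simp

text \<open>
  The integrated intensity is continuous and increasing, so it passes a level at an earlier
  rational time.
\<close>

lemma comp_predictable: "predictable Q conf_filt comp"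
  unfolding predictable_def predictable_sigma_eq_pred_space[OF space_Q]
proof (rule predictable_by_rationals[where Y = comp])
  fix u r :: real and \<Phi> assume u: "0 \<le> u" and \<Phi>: "\<Phi> \<in> confs" and r: "0 \<le> r"
  show "r < comp u \<Phi> \<longleftrightarrow> (\<exists>q\<in>\<rat>. 0 \<le> q \<and> q < u \<and> r < comp q \<Phi>)"
  proof
    assume *: "r < comp u \<Phi>"
    then have u0: "0 < u" using u r comp_zero[of \<Phi>] by (cases "u = 0") auto
    have "continuous (at u within {0..}) (\<lambda>t. comp t \<Phi>)"
      using comp_continuous[OF \<Phi>] u by (simp add: continuous_on_eq_continuous_within)
    then have "eventually (\<lambda>v. r < comp v \<Phi>) (at u within {0..})"
      using * by (auto simp: continuous_within intro: order_tendstoD(1))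
    then obtain d where d: "0 < d" "\<And>v. 0 \<le> v \<Longrightarrow> v \<noteq> u \<Longrightarrow> dist v u < d \<Longrightarrow> r < comp v \<Phi>"
      unfolding eventually_at by auto
    have "max 0 (u - d) < u" using d u0 by simp
    from Rats_dense_in_real[OF this] obtain q where "q \<in> \<rat>" "max 0 (u - d) < q" "q < u" by blast
    then show "\<exists>q\<in>\<rat>. 0 \<le> q \<and> q < u \<and> r < comp q \<Phi>"
      by (intro bexI[of _ q]) (auto intro!: d(2) simp: dist_real_def)
  next
    assume "\<exists>q\<in>\<rat>. 0 \<le> q \<and> q < u \<and> r < comp q \<Phi>"
    then obtain q where q: "0 \<le> q" "q < u" "r < comp q \<Phi>" by blast
    then show "r < comp u \<Phi>" using nn_comp(2)[OF \<Phi> q(1), of u] by simp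
  qed
qed (auto intro: comp_measurable comp_nonneg)

lemma measurable_stopped:
  assumes "0 \<le> t" "(\<lambda>(s, \<Phi>). X (min s t) \<Phi>) \<in> borel_measurable (borel \<Otimes>\<^sub>M conf_filt t)"
  shows "(\<lambda>\<Phi>. X (min t (stop_time k \<Phi>)) \<Phi> :: real) \<in> borel_measurable (conf_filt t)"
proof -
  have "(\<lambda>\<Phi>. min t (stop_time k \<Phi>)) \<in> borel_measurable (conf_filt t)"
  proof (subst borel_measurable_iff_le, intro allI)
    fix r
    show "{\<Phi> \<in> space (conf_filt t). min t (stop_time k \<Phi>) \<le> r} \<in> sets (conf_filt t)"
    proof (cases "t \<le> r")
      case True
      then have "{\<Phi> \<in> space (conf_filt t). min t (stop_time k \<Phi>) \<le> r} = space (conf_filt t)" by auto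
      then show ?thesis by (simp only: sets.top)
    next
      case False
      then have "{\<Phi> \<in> space (conf_filt t). min t (stop_time k \<Phi>) \<le> r} = {\<Phi> \<in> space (conf_filt r). stop_time k \<Phi> \<le> r}"
        by (auto simp: min_le_iff_disj)
      also have "\<dots> \<in> sets (conf_filt r)"
        using stop_time_is_stopping_time[of k] by (auto simp: stopping_time_def pred_def)
      finally show ?thesis using conf_filt_mono[of r t] False by auto
    qed
  qed
  then have "(\<lambda>\<Phi>. (min t (stop_time k \<Phi>), \<Phi>)) \<in> measurable (conf_filt t) (borel \<Otimes>\<^sub>M conf_filt t)"
    by measurable
  from measurable_compose[OF this assms(2)] show ?thesis by (simp add: min.commute min.left_commute)
qed

text \<open>
  The compensation formula for the indicator of \<open>{s<..t} \<times> B\<close> up to the stopping time: its sum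
  over the points and its integral against the intensity are the two increments.
\<close>

lemma stopped_compensation:
  assumes s: "0 \<le> s" "s \<le> t" and B: "B \<in> sets (conf_filt s)"
  shows "(\<integral>\<^sup>+\<Phi>\<in>B. ennreal (real (count_to (min t (stop_time k \<Phi>)) \<Phi>) - real (count_to (min s (stop_time k \<Phi>)) \<Phi>)) \<partial>Q) =
    (\<integral>\<^sup>+\<Phi>\<in>B. ennreal (comp (min t (stop_time k \<Phi>)) \<Phi> - comp (min s (stop_time k \<Phi>)) \<Phi>) \<partial>Q)"
proof -
  define Z :: "real \<times> real set \<Rightarrow> ennreal" where
    "Z = (\<lambda>w. indicator ({s<..t} \<times> B) w * ennreal (1 - of_bool (stop_time k (snd w) < fst w)))"
  have Z: "Z \<in> borel_measurable pred_space"
  proof -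
    have [measurable]: "{s<..t} \<times> B \<in> sets pred_space" using s B by (rule rectangle_predictable)
    have [measurable]: "(\<lambda>w. of_bool (stop_time k (snd w) < fst w) :: real) \<in> borel_measurable pred_space"
      using predictable_stopped[of k] by (simp add: case_prod_unfold)
    show ?thesis unfolding Z_def by measurable
  qed
  have Z_eq: "Z (u, \<Phi>) = indicator B \<Phi> * indicator {min s (stop_time k \<Phi>)<..min t (stop_time k \<Phi>)} u" for u \<Phi>
    using s by (auto simp: Z_def indicator_def not_less)
  have L: "(\<integral>\<^sup>+u. Z (u, \<Phi>) \<partial>count_space \<Phi>) = ennreal (real (count_to (min t (stop_time k \<Phi>)) \<Phi>) - real (count_to (min s (stop_time k \<Phi>)) \<Phi>)) * indicator B \<Phi>"
    if \<Phi>: "\<Phi> \<in> confs" for \<Phi>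
  proof -
    define a b where "a = min s (stop_time k \<Phi>)" and "b = min t (stop_time k \<Phi>)"
    have ab: "0 \<le> a" "a \<le> b" using s stop_time_nonneg[of k \<Phi>] by (auto simp: a_def b_def)
    have fin: "finite (\<Phi> \<inter> {0<..b})" using \<Phi> by (simp add: confs_def)
    have sub: "\<Phi> \<inter> {0<..a} \<subseteq> \<Phi> \<inter> {0<..b}" using ab by auto
    have "\<Phi> \<inter> {a<..b} = (\<Phi> \<inter> {0<..b}) - (\<Phi> \<inter> {0<..a})" using ab by auto
    then have card: "card (\<Phi> \<inter> {a<..b}) = count_to b \<Phi> - count_to a \<Phi>" "count_to a \<Phi> \<le> count_to b \<Phi>"
      using card_Diff_subset[OF finite_subset[OF sub fin] sub] card_mono[OF fin sub] by (simp_all add: count_to_def)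
    have fin': "finite (\<Phi> \<inter> {a<..b})"
      by (rule finite_subset[OF _ fin]) (use ab in auto)
    have "(\<integral>\<^sup>+u. indicator {a<..b} u \<partial>count_space \<Phi>) = (\<integral>\<^sup>+u. indicator ({a<..b} \<inter> \<Phi>) u \<partial>count_space \<Phi>)"
      by (intro nn_integral_cong) (auto simp: indicator_def)
    also have "\<dots> = emeasure (count_space \<Phi>) ({a<..b} \<inter> \<Phi>)"
      by (rule nn_integral_indicator) simp
    also have "\<dots> = ennreal (real (count_to b \<Phi>) - real (count_to a \<Phi>))"
      using fin' card by (subst emeasure_count_space_finite) (auto simp: Int_commute of_nat_diff ennreal_of_nat_eq_real_of_nat)
    finally show ?thesis unfolding Z_eq a_def[symmetric] b_def[symmetric]
      by (simp add: nn_integral_cmult mult.commute)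
  qed
  have R: "(\<integral>\<^sup>+u\<in>{0<..}. Z (u, \<Phi>) * ennreal (intensity u \<Phi>) \<partial>lborel) =
      ennreal (comp (min t (stop_time k \<Phi>)) \<Phi> - comp (min s (stop_time k \<Phi>)) \<Phi>) * indicator B \<Phi>"
    if \<Phi>: "\<Phi> \<in> confs" for \<Phi>
  proof -
    define a b where "a = min s (stop_time k \<Phi>)" and "b = min t (stop_time k \<Phi>)"
    have ab: "0 \<le> a" "a \<le> b" using s stop_time_nonneg[of k \<Phi>] by (auto simp: a_def b_def)
    have "(\<integral>\<^sup>+u\<in>{0<..}. Z (u, \<Phi>) * ennreal (intensity u \<Phi>) \<partial>lborel) =
      (\<integral>\<^sup>+u\<in>{a<..b}. ennreal (intensity u \<Phi>) \<partial>lborel) * indicator B \<Phi>"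
      unfolding Z_eq a_def[symmetric] b_def[symmetric]
      by (cases "\<Phi> \<in> B") (use ab in \<open>auto intro!: nn_integral_cong simp: indicator_def\<close>)
    then show ?thesis using nn_comp(1)[OF \<Phi> ab] by (simp add: a_def b_def)
  qed
  have "(\<integral>\<^sup>+\<Phi>. (\<integral>\<^sup>+u. Z (u, \<Phi>) \<partial>count_space \<Phi>) \<partial>Q) =
      (\<integral>\<^sup>+\<Phi>. (\<integral>\<^sup>+u\<in>{0<..}. Z (u, \<Phi>) * ennreal (intensity u \<Phi>) \<partial>lborel) \<partial>Q)"
  proof (rule compensation_formula[OF Z])
    have [measurable]: "(\<lambda>\<Phi>. real (count_to (min t (stop_time k \<Phi>)) \<Phi>)) \<in> borel_measurable conf_space"
      "(\<lambda>\<Phi>. real (count_to (min s (stop_time k \<Phi>)) \<Phi>)) \<in> borel_measurable conf_space" "B \<in> sets conf_space"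
      using s B conf_filt_subset[of s]
      by (auto intro: measurable_conf_filt_space[OF measurable_stopped[OF _ count_to_progressive]])
    have "(\<lambda>\<Phi>. ennreal (real (count_to (min t (stop_time k \<Phi>)) \<Phi>) - real (count_to (min s (stop_time k \<Phi>)) \<Phi>)) * indicator B \<Phi>)
        \<in> borel_measurable conf_space" by measurable
    then show "(\<lambda>\<Phi>. \<integral>\<^sup>+u. Z (u, \<Phi>) \<partial>count_space \<Phi>) \<in> borel_measurable conf_space"
      by (rule measurable_cong[THEN iffD1, rotated]) (simp add: L)
  qed
  moreover have "(\<integral>\<^sup>+\<Phi>. (\<integral>\<^sup>+u. Z (u, \<Phi>) \<partial>count_space \<Phi>) \<partial>Q) =
    (\<integral>\<^sup>+\<Phi>\<in>B. ennreal (real (count_to (min t (stop_time k \<Phi>)) \<Phi>) - real (count_to (min s (stop_time k \<Phi>)) \<Phi>)) \<partial>Q)"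
    by (intro nn_integral_cong L) (simp add: space_Q)
  moreover have "(\<integral>\<^sup>+\<Phi>. (\<integral>\<^sup>+u\<in>{0<..}. Z (u, \<Phi>) * ennreal (intensity u \<Phi>) \<partial>lborel) \<partial>Q) =
    (\<integral>\<^sup>+\<Phi>\<in>B. ennreal (comp (min t (stop_time k \<Phi>)) \<Phi> - comp (min s (stop_time k \<Phi>)) \<Phi>) \<partial>Q)"
    by (intro nn_integral_cong R) (simp add: space_Q)
  ultimately show ?thesis by simp
qed

text \<open>
  Stopped counts are bounded; by the compensation formula on the whole space, the stopped
  compensator has the same finite expectation. The increments of both processes then have
  equal integrals over every event of the earlier history.
\<close>

lemma is_compensator_comp: "is_compensator Q conf_filt (\<lambda>t \<Phi>. real (count_to t \<Phi>)) comp"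
proof -
  have sub: "subalgebra Q (conf_filt t)" for t
    by (rule subalgebra_conf_filt[OF sets_Q])
  have N_meas: "(\<lambda>\<Phi>. real (count_to (min t (stop_time k \<Phi>)) \<Phi>)) \<in> borel_measurable (conf_filt t)" if "0 \<le> t" for t k
    using measurable_stopped[OF that count_to_progressive] .
  have A_meas: "(\<lambda>\<Phi>. comp (min t (stop_time k \<Phi>)) \<Phi>) \<in> borel_measurable (conf_filt t)" if "0 \<le> t" for t k
    using measurable_stopped[OF that comp_progressive[OF that]] .
  have N_int: "integrable Q (\<lambda>\<Phi>. real (count_to (min t (stop_time k \<Phi>)) \<Phi>))" if "0 \<le> t" for t k
  proof (rule integrable_const_bound[where B = "real (k + 1)"])
    show "AE \<Phi> in Q. norm (real (count_to (min t (stop_time k \<Phi>)) \<Phi>)) \<le> real (k + 1)"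
    proof (rule AE_I2)
      fix \<Phi> assume "\<Phi> \<in> space Q"
      then have "count_to (min t (stop_time k \<Phi>)) \<Phi> \<le> k + 1"
        by (intro count_to_stop_time_le) (auto simp: space_Q)
      then show "norm (real (count_to (min t (stop_time k \<Phi>)) \<Phi>)) \<le> real (k + 1)" by simp
    qed
  qed (rule measurable_from_subalg[OF sub N_meas[OF that]])
  have A_int: "integrable Q (\<lambda>\<Phi>. comp (min t (stop_time k \<Phi>)) \<Phi>)" if t: "0 \<le> t" for t k
  proof (rule integrableI_nonneg)
    show "(\<lambda>\<Phi>. comp (min t (stop_time k \<Phi>)) \<Phi>) \<in> borel_measurable Q"
      by (rule measurable_from_subalg[OF sub A_meas[OF t]])
    show "AE \<Phi> in Q. 0 \<le> comp (min t (stop_time k \<Phi>)) \<Phi>"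
      using t stop_time_nonneg by (intro AE_I2 comp_nonneg) (auto simp: space_Q)
    have "(\<integral>\<^sup>+\<Phi>. ennreal (comp (min t (stop_time k \<Phi>)) \<Phi>) \<partial>Q) =
        (\<integral>\<^sup>+\<Phi>. ennreal (real (count_to (min t (stop_time k \<Phi>)) \<Phi>)) \<partial>Q)"
    proof -
      have "confs \<in> sets (conf_filt 0)" using sets.top[of "conf_filt 0"] by simp
      from stopped_compensation[OF order_refl t this, of k]
      have "(\<integral>\<^sup>+\<Phi>\<in>confs. ennreal (real (count_to (min t (stop_time k \<Phi>)) \<Phi>)) \<partial>Q) =
        (\<integral>\<^sup>+\<Phi>\<in>confs. ennreal (comp (min t (stop_time k \<Phi>)) \<Phi>) \<partial>Q)"
        by (simp add: min_absorb1 stop_time_nonneg comp_zero count_to_def[of 0])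
      moreover have "(\<integral>\<^sup>+\<Phi>\<in>confs. g \<Phi> \<partial>Q) = (\<integral>\<^sup>+\<Phi>. g \<Phi> \<partial>Q)" for g
        by (intro nn_integral_cong) (simp add: space_Q)
      ultimately show ?thesis by simp
    qed
    also have "\<dots> < \<infinity>"
      using N_int[OF t, of k] by (simp add: integrable_iff_bounded)
    finally show "(\<integral>\<^sup>+\<Phi>. ennreal (comp (min t (stop_time k \<Phi>)) \<Phi>) \<partial>Q) < \<infinity>" .
  qed
  have mart: "is_martingale Q conf_filt (\<lambda>t \<Phi>. real (count_to (min t (stop_time k \<Phi>)) \<Phi>) - comp (min t (stop_time k \<Phi>)) \<Phi>)" (is "is_martingale Q conf_filt ?X") for k
    unfolding is_martingale_def
  proof (intro conjI allI impI)
    fix t :: real assume t: "0 \<le> t"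
    show "?X t \<in> borel_measurable (conf_filt t)" using N_meas[OF t] A_meas[OF t] by measurable
    show "integrable Q (?X t)" using N_int[OF t] A_int[OF t] by simp
  next
    fix s t :: real assume st: "0 \<le> s \<and> s \<le> t"
    then have s: "0 \<le> s" and t: "0 \<le> t" and le: "s \<le> t" by auto
    interpret sigma_finite_subalgebra Q "conf_filt s"
      by (rule finite_measure_subalgebra_is_sigma_finite) (unfold_locales, rule sub)
    show "AE \<Phi> in Q. real_cond_exp Q (conf_filt s) (?X t) \<Phi> = ?X s \<Phi>"
    proof (rule real_cond_exp_charact)
      show "integrable Q (?X t)" using N_int[OF t] A_int[OF t] by simp
      show "integrable Q (?X s)" using N_int[OF s] A_int[OF s] by simp
      show "?X s \<in> borel_measurable (conf_filt s)" using N_meas[OF s] A_meas[OF s] by measurable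
      fix B assume B: "B \<in> sets (conf_filt s)"
      have BQ[measurable]: "B \<in> sets Q" using B sub[of s] by (auto simp: subalgebra_def)
      define DN DA where "DN \<Phi> = real (count_to (min t (stop_time k \<Phi>)) \<Phi>) - real (count_to (min s (stop_time k \<Phi>)) \<Phi>)"
        and "DA \<Phi> = comp (min t (stop_time k \<Phi>)) \<Phi> - comp (min s (stop_time k \<Phi>)) \<Phi>" for \<Phi>
      have DN: "integrable Q DN" "\<And>\<Phi>. \<Phi> \<in> space Q \<Longrightarrow> 0 \<le> DN \<Phi>"
        unfolding DN_def using N_int[OF t] N_int[OF s] le count_to_mono by (auto simp: space_Q intro!: count_to_mono)
      have DA: "integrable Q DA" "\<And>\<Phi>. \<Phi> \<in> space Q \<Longrightarrow> 0 \<le> DA \<Phi>"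
        unfolding DA_def using A_int[OF t] A_int[OF s] le s stop_time_nonneg
        by (auto simp: space_Q intro!: nn_comp(2))
      have "ennreal (\<integral>\<Phi>\<in>B. D \<Phi> \<partial>Q) = (\<integral>\<^sup>+\<Phi>\<in>B. ennreal (D \<Phi>) \<partial>Q)"
        if D: "integrable Q D" "\<And>\<Phi>. \<Phi> \<in> space Q \<Longrightarrow> 0 \<le> D \<Phi>" for D
      proof -
        have "(\<integral>\<^sup>+\<Phi>\<in>B. ennreal (D \<Phi>) \<partial>Q) = (\<integral>\<^sup>+\<Phi>. ennreal (indicator B \<Phi> *\<^sub>R D \<Phi>) \<partial>Q)"
          by (intro nn_integral_cong) (auto simp: indicator_def)
        also have "\<dots> = ennreal (\<integral>\<Phi>\<in>B. D \<Phi> \<partial>Q)"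
          unfolding set_lebesgue_integral_def using D
          by (intro nn_integral_eq_integral integrable_mult_indicator) (auto intro!: AE_I2)
        finally show ?thesis by simp
      qed
      from this[OF DN] this[OF DA] have "ennreal (\<integral>\<Phi>\<in>B. DN \<Phi> \<partial>Q) = ennreal (\<integral>\<Phi>\<in>B. DA \<Phi> \<partial>Q)"
        using stopped_compensation[OF s le B, of k] by (simp add: DN_def DA_def)
      moreover have "0 \<le> (\<integral>\<Phi>\<in>B. DN \<Phi> \<partial>Q)" "0 \<le> (\<integral>\<Phi>\<in>B. DA \<Phi> \<partial>Q)"
        unfolding set_lebesgue_integral_def using DN(2) DA(2) by (auto intro!: integral_nonneg_AE AE_I2)
      ultimately have eq: "(\<integral>\<Phi>\<in>B. DN \<Phi> \<partial>Q) = (\<integral>\<Phi>\<in>B. DA \<Phi> \<partial>Q)" by simp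
      have Xeq: "?X t \<Phi> = ?X s \<Phi> + (DN \<Phi> - DA \<Phi>)" for \<Phi> by (simp add: DN_def DA_def)
      have si: "set_integrable Q B g" if "integrable Q g" for g :: "real set \<Rightarrow> real"
        unfolding set_integrable_def by (rule integrable_mult_indicator[OF BQ that])
      have "(\<integral>\<Phi>\<in>B. ?X t \<Phi> \<partial>Q) = (\<integral>\<Phi>\<in>B. ?X s \<Phi> \<partial>Q) + ((\<integral>\<Phi>\<in>B. DN \<Phi> \<partial>Q) - (\<integral>\<Phi>\<in>B. DA \<Phi> \<partial>Q))"
        unfolding Xeq using N_int[OF s] A_int[OF s] DN(1) DA(1)
        by (simp add: set_integral_add set_integral_diff si)
      then show "(\<integral>\<Phi>\<in>B. ?X t \<Phi> \<partial>Q) = (\<integral>\<Phi>\<in>B. ?X s \<Phi> \<partial>Q)" using eq by simp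
    qed
  qed
  have "is_local_martingale Q conf_filt (\<lambda>t \<Phi>. real (count_to t \<Phi>) - comp t \<Phi>)"
    unfolding is_local_martingale_def
  proof (intro exI[of _ stop_time] conjI allI ballI mart stop_time_is_stopping_time stop_time_nonneg)
    show "AE \<Phi> in Q. incseq (\<lambda>k. stop_time k \<Phi>) \<and> filterlim (\<lambda>k. stop_time k \<Phi>) at_top sequentially"
      by (rule AE_I2) (auto simp: space_Q incseq_def intro: stop_time_mono stop_time_at_top)
  qed
  moreover have "continuous (at_right t) (\<lambda>s. comp s \<Phi>)" if "\<Phi> \<in> space Q" "0 \<le> t" for t \<Phi>
  proof -
    have "continuous (at t within {0..}) (\<lambda>s. comp s \<Phi>)"
      using comp_continuous that by (simp add: space_Q continuous_on_eq_continuous_within)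
    then show ?thesis by (rule continuous_within_subset) (use that in auto)
  qed
  ultimately show ?thesis unfolding is_compensator_def
    using comp_predictable comp_zero nn_comp(2) by (auto simp: space_Q mono_on_def)
qed

end

section \<open>Conditional laws with densities\<close>

text \<open>
  A conditional law given on events \<open>A \<inter> X -` B\<close> determines the expectation of every function of
  the past and \<open>X\<close>, because two finite measures on the product agree if they agree on
  rectangles.
\<close>

lemma cond_law_nn_integral:
  fixes X :: "'w \<Rightarrow> real" and k :: "'w \<Rightarrow> real \<Rightarrow> ennreal"
  assumes "finite_measure M" and sub: "subalgebra M G" and X[measurable]: "X \<in> borel_measurable M"
    and H: "H \<in> sets G"
    and k: "(\<lambda>(\<omega>, y). k \<omega> y) \<in> borel_measurable (G \<Otimes>\<^sub>M borel)"
    and rect: "\<And>A B. A \<in> sets G \<Longrightarrow> A \<subseteq> H \<Longrightarrow> B \<in> sets borel \<Longrightarrow>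
      emeasure M (A \<inter> X -` B) = (\<integral>\<^sup>+\<omega>\<in>A. (\<integral>\<^sup>+y\<in>B. k \<omega> y \<partial>lborel) \<partial>M)"
    and \<psi>: "\<psi> \<in> borel_measurable (G \<Otimes>\<^sub>M borel)"
  shows "(\<integral>\<^sup>+\<omega>\<in>H. \<psi> (\<omega>, X \<omega>) \<partial>M) = (\<integral>\<^sup>+\<omega>\<in>H. (\<integral>\<^sup>+y. \<psi> (\<omega>, y) * k \<omega> y \<partial>lborel) \<partial>M)"
proof -
  interpret finite_measure M by fact
  define MG where "MG = restr_to_subalg M G"
  have sets_MG[measurable_cong]: "sets MG = sets G"
    unfolding MG_def by (rule sets_restr_to_subalg[OF sub])
  have space_G: "space G = space M" using sub by (simp add: subalgebra_def)
  have [measurable]: "H \<in> sets M" "H \<in> sets MG"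
    using H sub sets_MG by (auto simp: subalgebra_def)
  have kMG[measurable]: "(\<lambda>w. k (fst w) (snd w)) \<in> borel_measurable (MG \<Otimes>\<^sub>M lborel)"
    using k by (simp add: case_prod_unfold cong: measurable_cong_sets)
  have \<psi>MG[measurable]: "\<psi> \<in> borel_measurable (MG \<Otimes>\<^sub>M lborel)"
    using \<psi> by (simp cong: measurable_cong_sets)
  have XG[measurable]: "(\<lambda>\<omega>. (\<omega>, X \<omega>)) \<in> measurable M (MG \<Otimes>\<^sub>M lborel)"
  proof (rule measurable_Pair)
    show "(\<lambda>\<omega>. \<omega>) \<in> measurable M MG"
      using sub by (auto simp: measurable_def subalgebra_def sets_MG sets_eq_imp_space_eq[OF sets_MG])
  qed simp
  define \<mu> \<nu> where "\<mu> = distr (density M (indicator H)) (MG \<Otimes>\<^sub>M lborel) (\<lambda>\<omega>. (\<omega>, X \<omega>))"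
    and "\<nu> = density (MG \<Otimes>\<^sub>M lborel) (\<lambda>w. indicator H (fst w) * k (fst w) (snd w))"
  have XGd[measurable]: "(\<lambda>\<omega>. (\<omega>, X \<omega>)) \<in> measurable (density M (indicator H)) (MG \<Otimes>\<^sub>M lborel)"
    using XG by simp
  have inner: "(\<lambda>\<omega>. \<integral>\<^sup>+y. g \<omega> y \<partial>lborel) \<in> borel_measurable G"
    if "(\<lambda>w. g (fst w) (snd w)) \<in> borel_measurable (MG \<Otimes>\<^sub>M lborel)" for g
    using lborel.borel_measurable_nn_integral[of g MG] that
    by (simp add: case_prod_unfold measurable_cong_sets[OF sets_MG refl])
  have mu_rect: "emeasure \<mu> (A \<times> B) = emeasure M ((H \<inter> A) \<inter> X -` B)"
    if A: "A \<in> sets G" and B: "B \<in> sets borel" for A B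
  proof -
    have AM: "A \<in> sets M" "A \<in> sets MG" using A sub sets_MG by (auto simp: subalgebra_def)
    have "emeasure \<mu> (A \<times> B) = emeasure (density M (indicator H)) ((\<lambda>\<omega>. (\<omega>, X \<omega>)) -` (A \<times> B) \<inter> space M)"
      unfolding \<mu>_def using AM B by (subst emeasure_distr) auto
    also have "(\<lambda>\<omega>. (\<omega>, X \<omega>)) -` (A \<times> B) \<inter> space M = A \<inter> (X -` B \<inter> space M)"
      using sets.sets_into_space[OF AM(1)] by auto
    also have "emeasure (density M (indicator H)) (A \<inter> (X -` B \<inter> space M)) =
        (\<integral>\<^sup>+\<omega>. indicator H \<omega> * indicator (A \<inter> (X -` B \<inter> space M)) \<omega> \<partial>M)"
      using AM B by (subst emeasure_density) auto
    also have "\<dots> = (\<integral>\<^sup>+\<omega>. indicator (H \<inter> (A \<inter> (X -` B \<inter> space M))) \<omega> \<partial>M)"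
      by (intro nn_integral_cong) (auto simp: indicator_def)
    also have "\<dots> = emeasure M (H \<inter> (A \<inter> (X -` B \<inter> space M)))"
      using AM B by (subst nn_integral_indicator) auto
    also have "H \<inter> (A \<inter> (X -` B \<inter> space M)) = (H \<inter> A) \<inter> X -` B"
      using sets.sets_into_space[OF AM(1)] by auto
    finally show ?thesis .
  qed
  have nu_int: "(\<integral>\<^sup>+w. \<phi> w \<partial>\<nu>) = (\<integral>\<^sup>+\<omega>\<in>H. (\<integral>\<^sup>+y. \<phi> (\<omega>, y) * k \<omega> y \<partial>lborel) \<partial>M)"
    if [measurable]: "\<phi> \<in> borel_measurable (MG \<Otimes>\<^sub>M lborel)" for \<phi>
  proof -
    have "(\<integral>\<^sup>+w. \<phi> w \<partial>\<nu>) = (\<integral>\<^sup>+w. indicator H (fst w) * k (fst w) (snd w) * \<phi> w \<partial>(MG \<Otimes>\<^sub>M lborel))"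
      unfolding \<nu>_def by (subst nn_integral_density) auto
    also have "\<dots> = (\<integral>\<^sup>+\<omega>. \<integral>\<^sup>+y. indicator H \<omega> * k \<omega> y * \<phi> (\<omega>, y) \<partial>lborel \<partial>MG)"
      by (subst lborel.nn_integral_fst[symmetric]) auto
    also have "\<dots> = (\<integral>\<^sup>+\<omega>. \<integral>\<^sup>+y. indicator H \<omega> * k \<omega> y * \<phi> (\<omega>, y) \<partial>lborel \<partial>M)"
      unfolding MG_def by (rule nn_integral_subalgebra2[OF sub], rule inner) measurable
    also have "\<dots> = (\<integral>\<^sup>+\<omega>\<in>H. (\<integral>\<^sup>+y. \<phi> (\<omega>, y) * k \<omega> y \<partial>lborel) \<partial>M)"
      by (intro nn_integral_cong) (auto simp: indicator_def mult.commute)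
    finally show ?thesis .
  qed
  have nu_rect: "emeasure \<nu> (A \<times> B) = emeasure M ((H \<inter> A) \<inter> X -` B)"
    if A: "A \<in> sets G" and B: "B \<in> sets borel" for A B
  proof -
    have AB[measurable]: "A \<times> B \<in> sets (MG \<Otimes>\<^sub>M lborel)"
      using A B sets_MG by (intro pair_measureI) auto
    have "emeasure \<nu> (A \<times> B) = (\<integral>\<^sup>+w. indicator (A \<times> B) w \<partial>\<nu>)"
      using AB by (simp add: \<nu>_def)
    also have "\<dots> = (\<integral>\<^sup>+\<omega>\<in>H. (\<integral>\<^sup>+y. indicator (A \<times> B) (\<omega>, y) * k \<omega> y \<partial>lborel) \<partial>M)"
      by (rule nu_int) measurable
    also have "\<dots> = (\<integral>\<^sup>+\<omega>\<in>H \<inter> A. (\<integral>\<^sup>+y\<in>B. k \<omega> y \<partial>lborel) \<partial>M)"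
      by (intro nn_integral_cong) (auto simp: indicator_def mult.commute)
    also have "\<dots> = emeasure M ((H \<inter> A) \<inter> X -` B)"
      by (rule rect[symmetric]) (use A B H in auto)
    finally show ?thesis .
  qed
  have eq: "\<mu> = \<nu>"
  proof (rule measure_eqI_generator_eq[OF Int_stable_pair_measure_generator[of MG lborel]])
    show "{a \<times> b | a b. a \<in> sets MG \<and> b \<in> sets lborel} \<subseteq> Pow (space MG \<times> space lborel)"
      using sets.sets_into_space by fastforce
    show "sets \<mu> = sigma_sets (space MG \<times> space lborel) {a \<times> b | a b. a \<in> sets MG \<and> b \<in> sets lborel}"
      "sets \<nu> = sigma_sets (space MG \<times> space lborel) {a \<times> b | a b. a \<in> sets MG \<and> b \<in> sets lborel}"
      by (simp_all add: \<mu>_def \<nu>_def sets_pair_measure)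
    show "emeasure \<mu> Y = emeasure \<nu> Y" if "Y \<in> {a \<times> b | a b. a \<in> sets MG \<and> b \<in> sets lborel}" for Y
      using that mu_rect nu_rect sets_MG by auto
    show "range (\<lambda>_::nat. space MG \<times> space lborel) \<subseteq> {a \<times> b | a b. a \<in> sets MG \<and> b \<in> sets lborel}"
      by blast
    show "(\<Union>i::nat. space MG \<times> space lborel) = space MG \<times> space lborel" by simp
    have "emeasure \<mu> (space G \<times> UNIV) = emeasure M ((H \<inter> space G) \<inter> X -` UNIV)"
      by (rule mu_rect) auto
    then show "emeasure \<mu> (space MG \<times> space lborel) \<noteq> \<infinity>"
      by (simp add: sets_eq_imp_space_eq[OF sets_MG])
  qed
  have "(\<integral>\<^sup>+\<omega>\<in>H. \<psi> (\<omega>, X \<omega>) \<partial>M) = (\<integral>\<^sup>+w. \<psi> w \<partial>\<mu>)"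
  proof -
    have "(\<integral>\<^sup>+w. \<psi> w \<partial>\<mu>) = (\<integral>\<^sup>+\<omega>. \<psi> (\<omega>, X \<omega>) \<partial>density M (indicator H))"
      unfolding \<mu>_def by (subst nn_integral_distr) auto
    also have "\<dots> = (\<integral>\<^sup>+\<omega>. indicator H \<omega> * \<psi> (\<omega>, X \<omega>) \<partial>M)"
      by (subst nn_integral_density) auto
    finally show ?thesis by (simp add: mult.commute)
  qed
  also have "\<dots> = (\<integral>\<^sup>+\<omega>\<in>H. (\<integral>\<^sup>+y. \<psi> (\<omega>, y) * k \<omega> y \<partial>lborel) \<partial>M)"
    unfolding eq by (rule nu_int) measurable
  finally show ?thesis .
qed

section \<open>Sequences of independent draws\<close>

definition coord_alg :: "nat \<Rightarrow> (nat \<Rightarrow> real) measure" where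
  "coord_alg a = vimage_algebra UNIV (\<lambda>e. restrict e {..<a}) (PiM {..<a} (\<lambda>_. borel))"

lemma space_coord_alg[simp]: "space (coord_alg a) = UNIV"
  by (simp add: coord_alg_def)

lemma measurable_coord_alg: assumes "i < a" shows "(\<lambda>e. e i) \<in> borel_measurable (coord_alg a)"
proof -
  have "(\<lambda>e. restrict e {..<a}) \<in> measurable (coord_alg a) (PiM {..<a} (\<lambda>_. borel :: real measure))"
    unfolding coord_alg_def by (rule measurable_vimage_algebra1) (auto simp: space_PiM)
  moreover have "(\<lambda>e. e i) \<in> borel_measurable (PiM {..<a} (\<lambda>_. borel :: real measure))"
    using assms by simp
  ultimately have "(\<lambda>e. restrict e {..<a} i) \<in> borel_measurable (coord_alg a)"
    by (rule measurable_compose)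
  then show ?thesis using assms by simp
qed

lemma subalgebra_coord_alg:
  assumes "sets P = sets (PiM UNIV (\<lambda>_::nat. borel :: real measure))"
  shows "subalgebra P (coord_alg a)"
proof -
  have space: "space P = UNIV" using sets_eq_imp_space_eq[OF assms] by (simp add: space_PiM)
  have "(\<lambda>e. restrict e {..<a}) \<in> measurable P (PiM {..<a} (\<lambda>_. borel :: real measure))"
    unfolding measurable_cong_sets[OF assms refl] by (rule measurable_restrict_subset) simp
  then have "sets (coord_alg a) \<subseteq> sets P"
    unfolding coord_alg_def by (auto simp: sets_vimage_algebra2 space_PiM measurable_def space)
  then show ?thesis by (simp add: subalgebra_def space)
qed

lemma coord_alg_mono: assumes "a \<le> b" shows "subalgebra (coord_alg b) (coord_alg a)"
proof -
  have "(\<lambda>e. restrict e {..<a}) \<in> measurable (coord_alg b) (PiM {..<a} (\<lambda>_. borel :: real measure))"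
    by (rule measurable_restrict) (use assms in \<open>auto intro: measurable_coord_alg\<close>)
  then have "sets (coord_alg a) \<subseteq> sets (coord_alg b)"
    by (auto simp: coord_alg_def[of a] sets_vimage_algebra2 space_PiM measurable_def)
  then show ?thesis by (simp add: subalgebra_def)
qed

text \<open>
  The coordinate \<open>a\<close> is independent of the coordinates before it, so it may be integrated out
  first in a function of these coordinates and itself.
\<close>

lemma iid_draw:
  fixes k :: "real \<Rightarrow> ennreal"
  assumes k[measurable]: "k \<in> borel_measurable borel" and "prob_space (density lborel k)"
    and \<psi>: "\<psi> \<in> borel_measurable (coord_alg a \<Otimes>\<^sub>M borel)"
  defines "P \<equiv> PiM UNIV (\<lambda>_::nat. density lborel k)"
  shows "(\<integral>\<^sup>+e. \<psi> (e, e a) \<partial>P) = (\<integral>\<^sup>+e. (\<integral>\<^sup>+y. \<psi> (e, y) * k y \<partial>lborel) \<partial>P)"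
proof -
  interpret K: prob_space "density lborel k" by fact
  interpret P: product_prob_space "\<lambda>_::nat. density lborel k" UNIV by unfold_locales
  interpret PP: prob_space P unfolding P_def by (rule P.P.prob_space_axioms)
  have sets_P: "sets P = sets (PiM UNIV (\<lambda>_::nat. borel :: real measure))"
    unfolding P_def by (intro sets_PiM_cong) auto
  have space_P: "space P = UNIV" using sets_eq_imp_space_eq[OF sets_P] by (simp add: space_PiM)
  have coord[measurable]: "(\<lambda>e. e i) \<in> borel_measurable P" for i
    unfolding measurable_cong_sets[OF sets_P refl] by simp
  have "PP.indep_vars (\<lambda>_. density lborel k) (\<lambda>i e. e i) UNIV"
  proof (subst PP.indep_vars_iff_distr_eq_PiM)
    show "PP.random_variable (density lborel k) (\<lambda>e. e i)" for i
      using coord by (simp cong: measurable_cong_sets)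
    have "distr P (PiM UNIV (\<lambda>_. density lborel k)) (\<lambda>x. \<lambda>i\<in>UNIV. x i) = P"
      unfolding P_def by (simp add: restrict_UNIV distr_id)
    moreover have "distr P (density lborel k) (\<lambda>e. e i) = density lborel k" for i
      unfolding P_def by (rule P.PiM_component) simp
    ultimately show "distr P (PiM UNIV (\<lambda>_. density lborel k)) (\<lambda>x. \<lambda>i\<in>UNIV. x i) =
      PiM UNIV (\<lambda>i. distr P (density lborel k) (\<lambda>e. e i))"
      by (simp add: P_def)
  qed simp
  then have ind: "PP.indep_var (PiM {..<a} (\<lambda>_. density lborel k)) (\<lambda>e. restrict (\<lambda>i. e i) {..<a})
      (PiM {a} (\<lambda>_. density lborel k)) (\<lambda>e. restrict (\<lambda>i. e i) {a})"
    by (rule PP.indep_var_restrict) auto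
  have law: "emeasure P ((\<lambda>e. e a) -` B) = (\<integral>\<^sup>+y\<in>B. k y \<partial>lborel)" if B: "B \<in> sets borel" for B
  proof -
    have "emeasure P ((\<lambda>e. e a) -` B) = emeasure (distr P (density lborel k) (\<lambda>e. e a)) B"
      using B coord by (subst emeasure_distr) (auto simp: space_P cong: measurable_cong_sets)
    also have "distr P (density lborel k) (\<lambda>e. e a) = density lborel k"
      unfolding P_def by (rule P.PiM_component) simp
    finally show ?thesis using B by (simp add: emeasure_density)
  qed
  have "(\<integral>\<^sup>+e\<in>UNIV. \<psi> (e, e a) \<partial>P) = (\<integral>\<^sup>+e\<in>UNIV. (\<integral>\<^sup>+y. \<psi> (e, y) * k y \<partial>lborel) \<partial>P)"
  proof (rule cond_law_nn_integral[OF _ subalgebra_coord_alg[OF sets_P] coord])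
    show "finite_measure P" by unfold_locales
    show "UNIV \<in> sets (coord_alg a)" using sets.top[of "coord_alg a"] by simp
    show "(\<lambda>(e, y). k y) \<in> borel_measurable (coord_alg a \<Otimes>\<^sub>M borel)" by measurable
    fix A B assume A: "A \<in> sets (coord_alg a)" and B: "B \<in> sets (borel :: real measure)"
    have "sets (PiM {..<a} (\<lambda>_. density lborel k)) = sets (PiM {..<a} (\<lambda>_. borel :: real measure))"
      by (intro sets_PiM_cong) auto
    moreover obtain A' where A': "A' \<in> sets (PiM {..<a} (\<lambda>_. borel :: real measure))" "A = (\<lambda>e. restrict e {..<a}) -` A'"
      using A unfolding coord_alg_def by (subst (asm) sets_vimage_algebra2) (auto simp: space_PiM)
    ultimately have A'': "A' \<in> sets (PiM {..<a} (\<lambda>_. density lborel k))" by simp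
    define B' where "B' = PiE {a} (\<lambda>_. B)"
    have B': "B' \<in> sets (PiM {a} (\<lambda>_. density lborel k))"
      unfolding B'_def using B by (intro sets_PiM_I_finite) auto
    have B'_eq: "(\<lambda>e. restrict (\<lambda>i. e i) {a}) -` B' = (\<lambda>e. e a) -` B"
      by (auto simp: B'_def PiE_def)
    have BP: "(\<lambda>e. e a) -` B \<in> sets P"
      using measurable_sets[OF coord B] by (simp add: space_P)
    have AP: "A \<in> sets P" using A subalgebra_coord_alg[OF sets_P] by (auto simp: subalgebra_def)
    have "PP.prob (A \<inter> (\<lambda>e. e a) -` B) = PP.prob A * PP.prob ((\<lambda>e. e a) -` B)"
      using PP.indep_varD[OF ind A'' B'] unfolding A'(2) B'_eq[symmetric]
      by (simp add: space_P vimage_def Collect_conj_eq)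
    then have "emeasure P (A \<inter> (\<lambda>e. e a) -` B) = emeasure P A * emeasure P ((\<lambda>e. e a) -` B)"
      by (simp add: PP.emeasure_eq_measure ennreal_mult')
    also have "\<dots> = (\<integral>\<^sup>+e\<in>A. (\<integral>\<^sup>+y\<in>B. k y \<partial>lborel) \<partial>P)"
      using AP by (simp add: law[OF B] nn_integral_cmult_indicator mult.commute[of _ "set_nn_integral lborel B k"])
    finally show "emeasure P (A \<inter> (\<lambda>e. e a) -` B) = (\<integral>\<^sup>+e\<in>A. (\<integral>\<^sup>+y\<in>B. k y \<partial>lborel) \<partial>P)" .
  qed (rule \<psi>)
  then show ?thesis by simp
qed

section \<open>Candidates and accepted points\<close>

lemma nn_integral_shift:
  fixes g :: "real \<Rightarrow> ennreal"
  assumes [measurable]: "g \<in> borel_measurable borel"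
  shows "(\<integral>\<^sup>+u. g u \<partial>lborel) = (\<integral>\<^sup>+y. g (d + y) \<partial>lborel)"
  using nn_integral_real_affine[OF assms, of 1 d] by simp

lemma nn_integral_exponential:
  assumes "0 < r" shows "(\<integral>\<^sup>+y. ennreal (exponential_density r y) \<partial>lborel) = 1"
proof -
  interpret prob_space "density lborel (exponential_density r)"
    by (rule prob_space_exponential_density[OF assms])
  show ?thesis using emeasure_space_1 by (simp add: emeasure_density)
qed

lemma nn_integral_exponential_tail:
  assumes r: "0 < r" and y: "0 \<le> y"
  shows "(\<integral>\<^sup>+w. indicator {y..} w * ennreal (exponential_density r w) \<partial>lborel) = ennreal (exp (- r * y))"
proof -
  have "(\<integral>\<^sup>+w. indicator {y..} w * ennreal (exponential_density r w) \<partial>lborel) =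
     (\<integral>\<^sup>+w. indicator {y..} (y + w) * ennreal (exponential_density r (y + w)) \<partial>lborel)"
    by (rule nn_integral_shift) measurable
  also have "\<dots> = (\<integral>\<^sup>+w. ennreal (exp (- r * y)) * ennreal (exponential_density r w) \<partial>lborel)"
    using y r by (intro nn_integral_cong)
      (auto simp: exponential_density_def indicator_def ennreal_mult[symmetric] exp_add[symmetric] algebra_simps)
  also have "\<dots> = ennreal (exp (- r * y))"
    by (simp add: nn_integral_cmult nn_integral_exponential[OF r])
  finally show ?thesis .
qed

lemma nn_integral_exponential_laplace:
  assumes r: "0 < r" and B: "0 < B"
  shows "(\<integral>\<^sup>+y. ennreal (exp (- B * y)) * ennreal (exponential_density r y) \<partial>lborel) = ennreal (r / (r + B))"
proof -
  have "(\<integral>\<^sup>+y. ennreal (exp (- B * y)) * ennreal (exponential_density r y) \<partial>lborel) =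
     (\<integral>\<^sup>+y. ennreal (r / (r + B)) * ennreal (exponential_density (r + B) y) \<partial>lborel)"
  proof (rule nn_integral_cong)
    fix y
    have "exp (- B * y) * exponential_density r y = r / (r + B) * exponential_density (r + B) y"
    proof (cases "y < 0")
      case False
      have "exp (- B * y) * exp (- y * r) = exp (- y * (r + B))"
        by (simp add: exp_add[symmetric] algebra_simps)
      then show ?thesis using False r B by (simp add: exponential_density_def mult.left_commute)
    qed (simp add: exponential_density_def)
    then show "ennreal (exp (- B * y)) * ennreal (exponential_density r y) =
        ennreal (r / (r + B)) * ennreal (exponential_density (r + B) y)"
      using r B by (simp add: ennreal_mult[symmetric] exponential_density_nonneg)
  qed
  also have "\<dots> = ennreal (r / (r + B))"
    using r B by (simp add: nn_integral_cmult nn_integral_exponential)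
  finally show ?thesis .
qed

text \<open>
  The candidate process with infinite horizon, with \<open>G j\<close> the past before the wait \<open>W j\<close> and \<open>G' j\<close>
  the past before the mark \<open>V j\<close>. If the rate vanishes, then so does the intensity until the
  next candidate, and both sides of the compensation formula for this step are 0; the lower
  bound on the wait prevents explosion.
\<close>

locale thinning = hawkes_params L n \<alpha> f a b + prob_space P
  for L n \<alpha> f a b and P :: "'w measure" +
  fixes c :: "nat \<Rightarrow> real" and x0 :: vec
    and X :: "nat \<Rightarrow> 'w \<Rightarrow> vec" and W V :: "nat \<Rightarrow> 'w \<Rightarrow> real" and G G' :: "nat \<Rightarrow> 'w measure"
  assumes X_0: "\<And>\<omega>. X 0 \<omega> = x0"
    and X_Suc: "\<And>j \<omega>. X (Suc j) \<omega> =
      (if V j \<omega> \<le> f (flow_sum L n \<alpha> (W j \<omega>) (X j \<omega>)) / rate (X j \<omega>)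
       then kick L n c (flow n \<alpha> (W j \<omega>) (X j \<omega>)) else flow n \<alpha> (W j \<omega>) (X j \<omega>))"
    and W_pos: "\<And>j \<omega>. 0 < W j \<omega>"
    and W_rate_0: "\<And>j \<omega>. rate (X j \<omega>) = 0 \<Longrightarrow> 1 \<le> W j \<omega>"
    and sub_P: "\<And>j. subalgebra P (G' j)"
    and sub_G: "\<And>j. subalgebra (G' j) (G j)" "\<And>j. subalgebra (G (Suc j)) (G' j)"
    and W_meas: "\<And>j. W j \<in> borel_measurable (G' j)"
    and V_meas: "\<And>j. V j \<in> borel_measurable (G (Suc j))"
    and X_meas: "\<And>j. X j \<in> measurable (G j) borel"
    and law_W: "\<And>j (\<psi> :: 'w \<times> real \<Rightarrow> ennreal). \<psi> \<in> borel_measurable (G j \<Otimes>\<^sub>M borel) \<Longrightarrow>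
      (\<integral>\<^sup>+\<omega>\<in>{\<omega>. 0 < rate (X j \<omega>)}. \<psi> (\<omega>, W j \<omega>) \<partial>P) =
      (\<integral>\<^sup>+\<omega>\<in>{\<omega>. 0 < rate (X j \<omega>)}. (\<integral>\<^sup>+y. \<psi> (\<omega>, y) * ennreal (exponential_density (rate (X j \<omega>)) y) \<partial>lborel) \<partial>P)"
    and law_V: "\<And>j (\<psi> :: 'w \<times> real \<Rightarrow> ennreal). \<psi> \<in> borel_measurable (G' j \<Otimes>\<^sub>M borel) \<Longrightarrow>
      (\<integral>\<^sup>+\<omega>. \<psi> (\<omega>, V j \<omega>) \<partial>P) = (\<integral>\<^sup>+\<omega>. (\<integral>\<^sup>+v. \<psi> (\<omega>, v) * indicator {0..1} v \<partial>lborel) \<partial>P)"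
begin

definition time :: "nat \<Rightarrow> 'w \<Rightarrow> real" where
  "time j \<omega> = (\<Sum>i<j. W i \<omega>)"

definition acc :: "nat \<Rightarrow> 'w \<Rightarrow> bool" where
  "acc j \<omega> \<longleftrightarrow> V j \<omega> \<le> f (flow_sum L n \<alpha> (W j \<omega>) (X j \<omega>)) / rate (X j \<omega>)"

definition pts :: "nat \<Rightarrow> 'w \<Rightarrow> real set" where
  "pts j \<omega> = {time (Suc i) \<omega> | i. i < j \<and> acc i \<omega>}"

definition unbounded :: "'w \<Rightarrow> bool" where
  "unbounded \<omega> \<longleftrightarrow> (\<forall>K::nat. \<exists>j. real K < time j \<omega>)"

text \<open>
  On the null set where candidate times accumulate, the points are set to \<open>{}\<close>, so that the
  result is always a locally finite configuration.
\<close>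

definition points :: "'w \<Rightarrow> real set" where
  "points \<omega> = (if unbounded \<omega> then {time (Suc i) \<omega> | i. acc i \<omega>} else {})"

lemma time_0[simp]: "time 0 \<omega> = 0" by (simp add: time_def)

lemma time_Suc: "time (Suc j) \<omega> = time j \<omega> + W j \<omega>" by (simp add: time_def)

lemma time_strict_mono: "strict_mono (\<lambda>j. time j \<omega>)"
  by (rule strict_monoI_Suc) (simp add: time_Suc W_pos)

lemma time_less_iff: "time i \<omega> < time j \<omega> \<longleftrightarrow> i < j"
  using strict_mono_less[OF time_strict_mono] .

lemma time_le_iff: "time i \<omega> \<le> time j \<omega> \<longleftrightarrow> i \<le> j"
  using strict_mono_less_eq[OF time_strict_mono] .

lemma time_eq_iff: "time i \<omega> = time j \<omega> \<longleftrightarrow> i = j"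
  using strict_mono_eq[OF time_strict_mono] .

lemma time_nonneg: "0 \<le> time j \<omega>"
  using time_le_iff[of 0 \<omega> j] by simp

lemma finite_pts: "finite (pts j \<omega>)"
proof -
  have "pts j \<omega> \<subseteq> (\<lambda>i. time (Suc i) \<omega>) ` {..<j}" by (auto simp: pts_def)
  then show ?thesis by (rule finite_subset) simp
qed

lemma pts_Suc: "pts (Suc j) \<omega> = (if acc j \<omega> then insert (time (Suc j) \<omega>) (pts j \<omega>) else pts j \<omega>)"
  by (auto simp: pts_def less_Suc_eq)

lemma pts_le: "s \<in> pts j \<omega> \<Longrightarrow> 0 < s \<and> s \<le> time j \<omega>"
proof -
  assume "s \<in> pts j \<omega>"
  then obtain i where i: "s = time (Suc i) \<omega>" "i < j" unfolding pts_def by blast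
  show ?thesis unfolding i(1) using time_less_iff[of 0 \<omega> "Suc i"] time_le_iff[of "Suc i" \<omega> j] i(2) by simp
qed

lemma pts_confs: "pts j \<omega> \<in> confs"
  using finite_pts pts_le by (auto simp: confs_def)

lemma points_before:
  assumes "unbounded \<omega>" "u \<le> time (Suc j) \<omega>"
  shows "points \<omega> \<inter> {0<..<u} = pts j \<omega> \<inter> {0<..<u}"
proof -
  have points: "points \<omega> = {time (Suc i) \<omega> | i. acc i \<omega>}"
    by (simp add: points_def assms(1))
  have "s \<in> pts j \<omega>" if "s \<in> points \<omega>" "s < u" for s
  proof -
    obtain i where i: "s = time (Suc i) \<omega>" "acc i \<omega>" using \<open>s \<in> points \<omega>\<close> unfolding points by blast
    have "i < j" using \<open>s < u\<close> assms(2) time_less_iff[of "Suc i" \<omega> "Suc j"] unfolding i(1) by simp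
    then show ?thesis using i unfolding pts_def by blast
  qed
  moreover have "pts j \<omega> \<subseteq> points \<omega>" unfolding points pts_def by blast
  ultimately show ?thesis by auto
qed

lemma points_upto:
  assumes "unbounded \<omega>" "t < time (Suc j) \<omega>"
  shows "points \<omega> \<inter> {0<..t} = pts j \<omega> \<inter> {0<..t}"
proof -
  have "{0<..t} = {0<..<time (Suc j) \<omega>} \<inter> {..t}" using assms(2) by auto
  then show ?thesis using points_before[OF assms(1) order_refl, of j] by (simp add: Int_assoc[symmetric])
qed

lemma points_confs: "points \<omega> \<in> confs"
proof (cases "unbounded \<omega>")
  case True
  have "finite (points \<omega> \<inter> {0<..t})" for t
  proof -
    obtain K :: nat where "t < real K" using reals_Archimedean2 by blast
    moreover obtain j where "real K < time j \<omega>" using True by (auto simp: unbounded_def)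
    moreover have "time j \<omega> < time (Suc j) \<omega>" by (simp add: time_less_iff)
    ultimately have "points \<omega> \<inter> {0<..t} = pts j \<omega> \<inter> {0<..t}" by (intro points_upto[OF True]) simp
    then show ?thesis using finite_pts by simp
  qed
  moreover have "0 < time (Suc i) \<omega>" for i using time_less_iff[of 0 \<omega> "Suc i"] by simp
  ultimately show ?thesis using True by (auto simp: confs_def points_def)
qed (simp add: points_def confs_def)

text \<open>
  Between two candidate times the state carries the whole memory of the process. By the
  semigroup property a move of the state only shifts time; an acceptance adds the kernel,
  started at the new point.
\<close>

lemma flow_sum_state:
  assumes "0 \<le> v"
  shows "flow_sum L n \<alpha> v (X j \<omega>) = flow_sum L n \<alpha> (time j \<omega> + v) x0 +
    (\<Sum>s\<in>pts j \<omega>. erlang_kernel L n \<alpha> c (time j \<omega> + v - s))"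
  using assms
proof (induction j arbitrary: v)
  case 0
  then show ?case by (simp add: X_0 pts_def)
next
  case (Suc j)
  have notin: "time (Suc j) \<omega> \<notin> pts j \<omega>"
    using pts_le[of "time (Suc j) \<omega>" j \<omega>] time_less_iff[of j \<omega> "Suc j"] by auto
  have W: "0 \<le> v + W j \<omega>" using Suc.prems W_pos[of j \<omega>] by simp
  have "flow_sum L n \<alpha> v (X (Suc j) \<omega>) =
    flow_sum L n \<alpha> (v + W j \<omega>) (X j \<omega>) + (if acc j \<omega> then erlang_kernel L n \<alpha> c v else 0)"
    by (simp add: X_Suc acc_def flow_sum_kick flow_sum_flow)
  also have "\<dots> = flow_sum L n \<alpha> (time (Suc j) \<omega> + v) x0 +
     (\<Sum>s\<in>pts j \<omega>. erlang_kernel L n \<alpha> c (time (Suc j) \<omega> + v - s)) + (if acc j \<omega> then erlang_kernel L n \<alpha> c v else 0)"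
    unfolding Suc.IH[OF W] by (simp add: time_Suc add_ac)
  finally show ?case using notin by (simp add: pts_Suc finite_pts)
qed

definition intensity :: "real \<Rightarrow> real set \<Rightarrow> real" where
  "intensity u \<Phi> = f (flow_sum L n \<alpha> u x0 + (\<Sum>s\<in>\<Phi> \<inter> {0<..<u}. erlang_kernel L n \<alpha> c (u - s)))"

lemma intensity_predictable: "(\<lambda>(u, \<Phi>). intensity u \<Phi>) \<in> borel_measurable pred_space"
proof -
  have [measurable]: "fst \<in> borel_measurable pred_space" by (rule predictable_time)
  have "(\<lambda>(u, s). erlang_kernel L n \<alpha> c (u - s)) \<in> borel_measurable (borel \<Otimes>\<^sub>M borel)"
    unfolding erlang_kernel_def by measurable
  from predictable_sum[OF this] have [measurable]:
    "(\<lambda>w. \<Sum>s\<in>snd w \<inter> {0<..<fst w}. erlang_kernel L n \<alpha> c (fst w - s)) \<in> borel_measurable pred_space"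
    by (simp add: case_prod_unfold)
  have [measurable]: "(\<lambda>w. flow_sum L n \<alpha> (fst w) x0) \<in> borel_measurable pred_space"
    by measurable
  show ?thesis unfolding intensity_def case_prod_unfold by measurable
qed

lemma intensity_between:
  assumes "unbounded \<omega>" "time j \<omega> < u" "u \<le> time (Suc j) \<omega>"
  shows "intensity u (points \<omega>) = f (flow_sum L n \<alpha> (u - time j \<omega>) (X j \<omega>))"
proof -
  have "pts j \<omega> \<inter> {0<..<u} = pts j \<omega>" using pts_le[of _ j \<omega>] assms(2) by force
  then show ?thesis
    using flow_sum_state[of "u - time j \<omega>" j \<omega>] assms(2)
    by (simp add: intensity_def points_before[OF assms(1,3)])
qed

section \<open>Measurability of the points\<close>

lemma sub_PG: "subalgebra P (G j)"
  using sub_P[of j] sub_G(1)[of j] by (auto simp: subalgebra_def)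

lemma space_G: "space (G j) = space P" "space (G' j) = space P"
  using sub_PG[of j] sub_P[of j] by (auto simp: subalgebra_def)

lemma G_mono:
  assumes "i \<le> j" shows "subalgebra (G j) (G i)"
  using assms
proof (induction j)
  case 0 then show ?case by (simp add: subalgebra_def)
next
  case (Suc j)
  show ?case
  proof (cases "i = Suc j")
    case True then show ?thesis by (simp add: subalgebra_def)
  next
    case False
    then have "subalgebra (G j) (G i)" using Suc by simp
    then show ?thesis using sub_G(1)[of j] sub_G(2)[of j] by (auto simp: subalgebra_def)
  qed
qed

lemma W_meas_G: "i < j \<Longrightarrow> W i \<in> borel_measurable (G j)"
  using measurable_from_subalg[OF G_mono[of "Suc i" j] measurable_from_subalg[OF sub_G(2) W_meas]] by simp

lemma time_meas: "time j \<in> borel_measurable (G j)"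
  unfolding time_def[abs_def] by (intro borel_measurable_sum W_meas_G) simp

lemma acc_meas: "i < j \<Longrightarrow> Measurable.pred (G j) (acc i)"
proof -
  assume ij: "i < j"
  have m: "W i \<in> borel_measurable (G j)" "V i \<in> borel_measurable (G j)" "X i \<in> measurable (G j) borel"
    using W_meas_G[OF ij] measurable_from_subalg[OF G_mono[of "Suc i" j] V_meas] ij
      measurable_from_subalg[OF G_mono[of i j] X_meas] by auto
  show ?thesis unfolding acc_def[abs_def] pred_def
    by (rule borel_measurable_le[OF m(2) borel_measurable_divide[OF
        measurable_compose[OF measurable_flow_sum[OF m(1,3)] f_meas] measurable_compose[OF m(3) measurable_rate]]])
qed

lemma pts_meas: "pts j \<in> measurable (G j) conf_space"
proof (rule measurable_into_conf_space)
  show "pts j \<in> space (G j) \<rightarrow> confs" using pts_confs by auto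
  fix B :: "real set" and t :: real assume B[measurable]: "B \<in> sets borel"
  have card: "card (pts j \<omega> \<inter> B) = (\<Sum>i<j. if acc i \<omega> \<and> time (Suc i) \<omega> \<in> B then 1 else 0)" for \<omega>
  proof -
    have "pts j \<omega> \<inter> B = (\<lambda>i. time (Suc i) \<omega>) ` {i. i < j \<and> acc i \<omega> \<and> time (Suc i) \<omega> \<in> B}"
      by (auto simp: pts_def)
    moreover have "inj_on (\<lambda>i. time (Suc i) \<omega>) S" for S
      by (rule inj_onI) (simp add: time_eq_iff)
    ultimately have "card (pts j \<omega> \<inter> B) = card {i. i < j \<and> acc i \<omega> \<and> time (Suc i) \<omega> \<in> B}"
      by (simp add: card_image)
    also have "{i. i < j \<and> acc i \<omega> \<and> time (Suc i) \<omega> \<in> B} = {i \<in> {..<j}. acc i \<omega> \<and> time (Suc i) \<omega> \<in> B}" by auto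
    also have "card \<dots> = (\<Sum>i<j. if acc i \<omega> \<and> time (Suc i) \<omega> \<in> B then 1 else 0)"
      by (simp add: sum.inter_filter[symmetric])
    finally show ?thesis .
  qed
  show "(\<lambda>\<omega>. card (pts j \<omega> \<inter> B)) \<in> measurable (G j) (count_space UNIV)"
    unfolding card
  proof (rule measurable_sum_nat)
    fix i assume "i \<in> {..<j}"
    then have ij: "i < j" by simp
    have [measurable]: "Measurable.pred (G j) (acc i)" "time (Suc i) \<in> borel_measurable (G j)"
      using acc_meas[OF ij] measurable_from_subalg[OF G_mono[of "Suc i" j] time_meas] ij by auto
    show "(\<lambda>\<omega>. if acc i \<omega> \<and> time (Suc i) \<omega> \<in> B then 1 else (0::nat)) \<in> measurable (G j) (count_space UNIV)"
      by measurable
  qed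
qed

lemma unbounded_meas: "Measurable.pred P unbounded"
proof -
  have [measurable]: "time j \<in> borel_measurable P" for j
    by (rule measurable_from_subalg[OF sub_PG time_meas])
  show ?thesis unfolding unbounded_def[abs_def] by measurable
qed

lemma unbounded_eventually:
  assumes "unbounded \<omega>" shows "\<exists>J. \<forall>j\<ge>J. t < time j \<omega>"
proof -
  obtain K :: nat where K: "t < real K" using reals_Archimedean2 by blast
  obtain J where "real K < time J \<omega>" using assms by (auto simp: unbounded_def)
  then have "t < time j \<omega>" if "J \<le> j" for j
    using that time_le_iff[of J \<omega> j] K by simp
  then show ?thesis by blast
qed

text \<open>
  A count of points up to \<open>t\<close> is the limit of the counts among the first \<open>j\<close> candidates, which are
  eventually constant.
\<close>

lemma points_meas: "points \<in> measurable P conf_space"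
proof (rule measurable_into_conf_space)
  show "points \<in> space P \<rightarrow> confs" using points_confs by auto
  fix B :: "real set" and t :: real assume B: "B \<in> sets borel" "B \<subseteq> {0<..t}"
  have [measurable]: "Measurable.pred P unbounded" by (rule unbounded_meas)
  have [measurable]: "(\<lambda>\<omega>. card (pts j \<omega> \<inter> B)) \<in> measurable P (count_space UNIV)" for j
    using measurable_compose[OF measurable_from_subalg[OF sub_PG pts_meas]
      measurable_conf_filt_space[OF measurable_card_filt[OF B]]] .
  have "(\<lambda>\<omega>. real (card (points \<omega> \<inter> B))) \<in> borel_measurable P"
  proof (rule borel_measurable_LIMSEQ_real)
    fix \<omega>
    show "(\<lambda>j. if unbounded \<omega> then real (card (pts j \<omega> \<inter> B)) else 0) \<longlonglongrightarrow> real (card (points \<omega> \<inter> B))"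
    proof (cases "unbounded \<omega>")
      case True
      obtain J where J: "\<And>j. J \<le> j \<Longrightarrow> t < time j \<omega>" using unbounded_eventually[OF True] by blast
      have "pts j \<omega> \<inter> B = points \<omega> \<inter> B" if "J \<le> j" for j
      proof -
        have "points \<omega> \<inter> {0<..t} = pts j \<omega> \<inter> {0<..t}"
          using J[of "Suc j"] that by (intro points_upto[OF True]) simp
        then show ?thesis using B(2) by blast
      qed
      then have "eventually (\<lambda>j. (if unbounded \<omega> then real (card (pts j \<omega> \<inter> B)) else 0) = real (card (points \<omega> \<inter> B))) sequentially"
        using True by (intro eventually_sequentiallyI[of J]) simp
      then show ?thesis by (rule tendsto_eventually)
    qed (simp add: points_def)
  qed measurable
  then have "(\<lambda>\<omega>. nat \<lfloor>real (card (points \<omega> \<inter> B))\<rfloor>) \<in> measurable P (count_space UNIV)" by measurable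
  then show "(\<lambda>\<omega>. card (points \<omega> \<inter> B)) \<in> measurable P (count_space UNIV)" by simp
qed

section \<open>No explosion\<close>

text \<open>
  A constant \<open>B \<ge> 1\<close> such that the rate after \<open>j\<close> candidates is at most \<open>B (j + 1)\<close>.
\<close>

definition growth :: real where
  "growth = 1 + a + b * real L * (flow_max L n \<alpha> x0 + flow_max L n \<alpha> (kick L n c (\<lambda>_ _. 0)))"

lemma growth_ge_1: "1 \<le> growth"
  unfolding growth_def using a_nonneg b_nonneg flow_max_nonneg by simp

lemma flow_max_state: "flow_max L n \<alpha> (X j \<omega>) \<le>
    flow_max L n \<alpha> x0 + real j * flow_max L n \<alpha> (kick L n c (\<lambda>_ _. 0))"
proof (induction j)
  case 0 then show ?case by (simp add: X_0)
next
  case (Suc j)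
  have "flow_max L n \<alpha> (X (Suc j) \<omega>) \<le>
      flow_max L n \<alpha> (flow n \<alpha> (W j \<omega>) (X j \<omega>)) + flow_max L n \<alpha> (kick L n c (\<lambda>_ _. 0))"
    using flow_max_kick flow_max_nonneg by (auto simp: X_Suc)
  also have "flow_max L n \<alpha> (flow n \<alpha> (W j \<omega>) (X j \<omega>)) \<le> flow_max L n \<alpha> (X j \<omega>)"
    by (rule flow_max_flow) (simp add: W_pos less_imp_le)
  finally show ?case using Suc by (simp add: algebra_simps)
qed

lemma rate_state: "rate (X j \<omega>) \<le> growth * (real j + 1)"
proof -
  let ?m = "flow_max L n \<alpha> x0" and ?K = "flow_max L n \<alpha> (kick L n c (\<lambda>_ _. 0))"
  have nn: "0 \<le> ?m" "0 \<le> ?K" by (rule flow_max_nonneg)+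
  have "flow_max L n \<alpha> (X j \<omega>) \<le> (?m + ?K) * (real j + 1)"
    using flow_max_state[of j \<omega>] nn by (simp add: algebra_simps) (smt (verit) mult_nonneg_nonneg of_nat_0_le_iff)
  then have "b * real L * flow_max L n \<alpha> (X j \<omega>) \<le> b * real L * ((?m + ?K) * (real j + 1))"
    using b_nonneg by (intro mult_left_mono) auto
  moreover have "a \<le> (1 + a) * (real j + 1)" using a_nonneg by (simp add: algebra_simps)
  ultimately show ?thesis using rate_growth[of "X j \<omega>"] by (simp add: growth_def algebra_simps)
qed

text \<open>
  With \<open>B\<close> the growth constant and rate \<open>r \<le> B (j + 1)\<close>, a wait contributes the factor
  \<open>r / (r + B) \<le> (j + 1) / (j + 2)\<close>, and the product telescopes. Taking the same constant for
  the argument of the Laplace transform and for the growth of the rate is what makes it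
  telescope. If the rate vanishes, the wait is at least 1 and \<open>exp (- B) \<le> 1 / 2\<close> is a small
  enough factor.
\<close>

lemma laplace_time: "(\<integral>\<^sup>+\<omega>. ennreal (exp (- growth * time j \<omega>)) \<partial>P) \<le> ennreal (1 / (real j + 1))"
proof (induction j)
  case 0 then show ?case by (simp add: emeasure_space_1)
next
  case (Suc j)
  let ?R = "{\<omega>. 0 < rate (X j \<omega>)}"
  define D where "D \<omega> = ennreal (exp (- growth * time j \<omega>))" for \<omega>
  define q where "q = ennreal ((real j + 1) / (real j + 2))"
  have g: "0 < growth" using growth_ge_1 by simp
  have timeG[measurable]: "time j \<in> borel_measurable (G j)" by (rule time_meas)
  have [measurable]: "time i \<in> borel_measurable P" "W i \<in> borel_measurable P" for i
    using measurable_from_subalg[OF sub_PG time_meas] measurable_from_subalg[OF sub_P W_meas] by auto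
  have [measurable]: "X j \<in> measurable P borel" by (rule measurable_from_subalg[OF sub_PG X_meas])
  have [measurable]: "D \<in> borel_measurable P" unfolding D_def[abs_def] by measurable
  have exp_Suc: "ennreal (exp (- growth * time (Suc j) \<omega>)) = D \<omega> * ennreal (exp (- growth * W j \<omega>))" for \<omega>
    by (simp add: D_def time_Suc ennreal_mult[symmetric] exp_add[symmetric] algebra_simps)
  have "(\<integral>\<^sup>+\<omega>\<in>?R. D \<omega> * ennreal (exp (- growth * W j \<omega>)) \<partial>P) =
    (\<integral>\<^sup>+\<omega>\<in>?R. (\<integral>\<^sup>+y. D \<omega> * ennreal (exp (- growth * y)) * ennreal (exponential_density (rate (X j \<omega>)) y) \<partial>lborel) \<partial>P)"
  proof -
    have "(\<lambda>w. D (fst w) * ennreal (exp (- growth * snd w))) \<in> borel_measurable (G j \<Otimes>\<^sub>M borel)"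
      unfolding D_def by measurable
    from law_W[OF this] show ?thesis by simp
  qed
  also have "\<dots> \<le> (\<integral>\<^sup>+\<omega>\<in>?R. q * D \<omega> \<partial>P)"
  proof (rule nn_integral_mono)
    fix \<omega>
    show "(\<integral>\<^sup>+y. D \<omega> * ennreal (exp (- growth * y)) * ennreal (exponential_density (rate (X j \<omega>)) y) \<partial>lborel) * indicator ?R \<omega>
       \<le> q * D \<omega> * indicator ?R \<omega>"
    proof (cases "0 < rate (X j \<omega>)")
      case True
      have "(\<integral>\<^sup>+y. D \<omega> * ennreal (exp (- growth * y)) * ennreal (exponential_density (rate (X j \<omega>)) y) \<partial>lborel)
         = D \<omega> * ennreal (rate (X j \<omega>) / (rate (X j \<omega>) + growth))"
        using nn_integral_exponential_laplace[OF True g] by (simp add: mult.assoc nn_integral_cmult)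
      moreover have "rate (X j \<omega>) / (rate (X j \<omega>) + growth) \<le> (real j + 1) / (real j + 2)"
        using rate_state[of j \<omega>] True g by (simp add: divide_simps) (simp add: algebra_simps)
      ultimately show ?thesis
        by (simp add: q_def mult.commute mult_left_mono ennreal_leI)
    qed simp
  qed
  finally have R: "(\<integral>\<^sup>+\<omega>\<in>?R. D \<omega> * ennreal (exp (- growth * W j \<omega>)) \<partial>P) \<le> (\<integral>\<^sup>+\<omega>\<in>?R. q * D \<omega> \<partial>P)" .
  have nR: "(\<integral>\<^sup>+\<omega>\<in>-?R. D \<omega> * ennreal (exp (- growth * W j \<omega>)) \<partial>P) \<le> (\<integral>\<^sup>+\<omega>\<in>-?R. q * D \<omega> \<partial>P)"
  proof (rule nn_integral_mono)
    fix \<omega>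
    show "D \<omega> * ennreal (exp (- growth * W j \<omega>)) * indicator (- ?R) \<omega> \<le> q * D \<omega> * indicator (- ?R) \<omega>"
    proof (cases "0 < rate (X j \<omega>)")
      case False
      then have "1 \<le> W j \<omega>" using rate_nonneg[of "X j \<omega>"] by (intro W_rate_0) simp
      then have "1 \<le> growth * W j \<omega>" using growth_ge_1 mult_mono[of 1 growth 1 "W j \<omega>"] by simp
      then have "2 \<le> exp (growth * W j \<omega>)" using exp_ge_add_one_self[of "growth * W j \<omega>"] by linarith
      then have "exp (- growth * W j \<omega>) \<le> 1 / 2" by (simp add: exp_minus field_simps)
      also have "\<dots> \<le> (real j + 1) / (real j + 2)" by (simp add: field_simps)
      finally have "D \<omega> * ennreal (exp (- growth * W j \<omega>)) \<le> q * D \<omega>"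
        unfolding q_def mult.commute[of "D \<omega>"] by (intro mult_right_mono ennreal_leI) auto
      then show ?thesis by (rule mult_right_mono) simp
    qed simp
  qed
  have split: "(\<integral>\<^sup>+\<omega>. g \<omega> \<partial>P) = (\<integral>\<^sup>+\<omega>\<in>?R. g \<omega> \<partial>P) + (\<integral>\<^sup>+\<omega>\<in>-?R. g \<omega> \<partial>P)"
    if [measurable]: "g \<in> borel_measurable P" for g :: "'w \<Rightarrow> ennreal"
  proof -
    have [measurable]: "(\<lambda>\<omega>. indicator ?R \<omega> :: ennreal) \<in> borel_measurable P"
      "(\<lambda>\<omega>. indicator (- ?R) \<omega> :: ennreal) \<in> borel_measurable P"
      unfolding indicator_def by measurable
    show ?thesis
      by (subst nn_integral_add[symmetric]) (auto intro!: nn_integral_cong simp: indicator_def)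
  qed
  have "(\<integral>\<^sup>+\<omega>. D \<omega> * ennreal (exp (- growth * W j \<omega>)) \<partial>P) \<le> (\<integral>\<^sup>+\<omega>. q * D \<omega> \<partial>P)"
  proof -
    have 1: "(\<integral>\<^sup>+\<omega>. D \<omega> * ennreal (exp (- growth * W j \<omega>)) \<partial>P) =
      (\<integral>\<^sup>+\<omega>\<in>?R. D \<omega> * ennreal (exp (- growth * W j \<omega>)) \<partial>P) + (\<integral>\<^sup>+\<omega>\<in>-?R. D \<omega> * ennreal (exp (- growth * W j \<omega>)) \<partial>P)"
      by (rule split) measurable
    have 2: "(\<integral>\<^sup>+\<omega>. q * D \<omega> \<partial>P) = (\<integral>\<^sup>+\<omega>\<in>?R. q * D \<omega> \<partial>P) + (\<integral>\<^sup>+\<omega>\<in>-?R. q * D \<omega> \<partial>P)"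
      by (rule split) measurable
    show ?thesis unfolding 1 2 by (rule add_mono[OF R nR])
  qed
  also have "\<dots> = q * (\<integral>\<^sup>+\<omega>. D \<omega> \<partial>P)" by (rule nn_integral_cmult) measurable
  also have "\<dots> \<le> q * ennreal (1 / (real j + 1))"
    using Suc by (intro mult_left_mono) (auto simp: D_def)
  also have "\<dots> = ennreal (1 / (real (Suc j) + 1))"
    by (simp add: q_def ennreal_mult[symmetric] field_simps)
  finally show ?case unfolding exp_Suc .
qed

text \<open>
  On the event that all candidate times are at most \<open>K\<close>, the integrands of the Laplace
  transforms are at least a positive constant; as the transforms tend to 0, the event is null.
\<close>

lemma AE_unbounded: "AE \<omega> in P. unbounded \<omega>"
  unfolding unbounded_def AE_all_countable
proof
  fix K :: nat
  have [measurable]: "time j \<in> borel_measurable P" for j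
    by (rule measurable_from_subalg[OF sub_PG time_meas])
  define A where "A = {\<omega> \<in> space P. \<forall>j. time j \<omega> \<le> real K}"
  have A[measurable]: "A \<in> sets P" unfolding A_def by measurable
  have le: "ennreal (exp (- growth * real K)) * emeasure P A \<le> ennreal (1 / (real j + 1))" for j
  proof -
    have "ennreal (exp (- growth * real K)) * emeasure P A = (\<integral>\<^sup>+\<omega>. ennreal (exp (- growth * real K)) * indicator A \<omega> \<partial>P)"
      by (simp add: nn_integral_cmult_indicator)
    also have "\<dots> \<le> (\<integral>\<^sup>+\<omega>. ennreal (exp (- growth * time j \<omega>)) \<partial>P)"
    proof (rule nn_integral_mono)
      fix \<omega>
      show "ennreal (exp (- growth * real K)) * indicator A \<omega> \<le> ennreal (exp (- growth * time j \<omega>))"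
      proof (cases "\<omega> \<in> A")
        case True
        then have "growth * time j \<omega> \<le> growth * real K"
          using growth_ge_1 by (intro mult_left_mono) (auto simp: A_def)
        then show ?thesis using True by (simp add: ennreal_leI)
      qed simp
    qed
    also have "\<dots> \<le> ennreal (1 / (real j + 1))" by (rule laplace_time)
    finally show ?thesis .
  qed
  have "exp (- growth * real K) * prob A \<le> 1 / (real j + 1)" for j
    using le[of j] by (simp add: emeasure_eq_measure ennreal_mult[symmetric])
  then have "exp (- growth * real K) * prob A \<le> 0"
    by (intro LIMSEQ_le_const[OF LIMSEQ_inverse_real_of_nat]) (auto simp: inverse_eq_divide add_ac)
  then have "prob A \<le> 0" by (simp add: mult_le_0_iff)
  then have "prob A = 0" using measure_nonneg[of P A] by linarith
  then have "emeasure P A = 0" by (simp add: emeasure_eq_measure)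
  then show "AE \<omega> in P. \<exists>j. real K < time j \<omega>"
    by (intro AE_I[OF _ _ A]) (auto simp: A_def not_less)
qed

end

context thinning begin

section \<open>The compensation formula\<close>

lemma meas_P:
  shows "time j \<in> borel_measurable P" "W j \<in> borel_measurable P" "V j \<in> borel_measurable P"
    "X j \<in> measurable P borel" "pts j \<in> measurable P conf_space" "Measurable.pred P (acc j)"
  using measurable_from_subalg[OF sub_PG time_meas] measurable_from_subalg[OF sub_P W_meas]
    measurable_from_subalg[OF sub_PG V_meas] measurable_from_subalg[OF sub_PG X_meas]
    measurable_from_subalg[OF sub_PG pts_meas] measurable_from_subalg[OF sub_PG acc_meas[of j "Suc j"]]
  by auto

text \<open>
  The intensity that the state at the \<open>j\<close>-th candidate time predicts after a further time \<open>y\<close>.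
\<close>

definition local_intensity :: "nat \<Rightarrow> 'w \<Rightarrow> real \<Rightarrow> real" where
  "local_intensity j \<omega> y = f (flow_sum L n \<alpha> y (X j \<omega>))"

lemma local_intensity_meas:
  "(\<lambda>w. local_intensity j (fst w) (snd w)) \<in> borel_measurable (G j \<Otimes>\<^sub>M borel)"
  unfolding local_intensity_def
  by (rule measurable_compose[OF measurable_flow_sum[OF measurable_snd measurable_compose[OF measurable_fst X_meas]] f_meas])

text \<open>
  The uniform mark is integrated out first: it accepts with probability intensity over rate.
  The rate then cancels against the density of the wait. A vanishing rate makes the quotient
  0, hence the restriction to positive rates.
\<close>

lemma accepted_candidate:
  fixes \<zeta> :: "'w \<times> real \<Rightarrow> ennreal"
  assumes \<zeta>: "\<zeta> \<in> borel_measurable (G j \<Otimes>\<^sub>M borel)"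
  shows "(\<integral>\<^sup>+\<omega>. \<zeta> (\<omega>, W j \<omega>) * indicator {\<omega>. acc j \<omega>} \<omega> \<partial>P) =
    (\<integral>\<^sup>+\<omega>\<in>{\<omega>. 0 < rate (X j \<omega>)}. (\<integral>\<^sup>+y\<in>{0..}. \<zeta> (\<omega>, y) *
      ennreal (local_intensity j \<omega> y * exp (- rate (X j \<omega>) * y)) \<partial>lborel) \<partial>P)"
proof -
  define p where "p \<omega> y = local_intensity j \<omega> y / rate (X j \<omega>)" for \<omega> y
  have p01: "0 \<le> p \<omega> y" "p \<omega> y \<le> 1" if "0 \<le> y" for \<omega> y
    using rate_dominates[OF that, of "X j \<omega>"] rate_nonneg[of "X j \<omega>"] f_nonneg
    unfolding p_def local_intensity_def by (auto simp: divide_le_eq_1)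
  have XG: "X j \<in> measurable (G j) borel" by (rule X_meas)
  have pG: "(\<lambda>w. p (fst w) (snd w)) \<in> borel_measurable (G j \<Otimes>\<^sub>M borel)"
    unfolding p_def
    by (rule borel_measurable_divide[OF local_intensity_meas
        measurable_compose[OF measurable_compose[OF measurable_fst XG] measurable_rate]])
  have GW: "(\<lambda>\<omega>. (\<omega>, W j \<omega>)) \<in> measurable (G' j) (G j \<Otimes>\<^sub>M borel)"
    by (intro measurable_Pair W_meas measurable_from_subalg[OF sub_G(1)] measurable_ident_sets refl)
  have \<zeta>W: "(\<lambda>\<omega>. \<zeta> (\<omega>, W j \<omega>)) \<in> borel_measurable (G' j)"
    by (rule measurable_compose[OF GW \<zeta>])
  have pW: "(\<lambda>\<omega>. p \<omega> (W j \<omega>)) \<in> borel_measurable (G' j)"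
    using measurable_compose[OF GW pG] by simp
  have acc_p: "acc j \<omega> \<longleftrightarrow> V j \<omega> \<le> p \<omega> (W j \<omega>)" for \<omega>
    by (simp add: acc_def p_def local_intensity_def)
  have "(\<integral>\<^sup>+\<omega>. \<zeta> (\<omega>, W j \<omega>) * indicator {\<omega>. acc j \<omega>} \<omega> \<partial>P) =
      (\<integral>\<^sup>+\<omega>. \<zeta> (\<omega>, W j \<omega>) * indicator {v. v \<le> p \<omega> (W j \<omega>)} (V j \<omega>) \<partial>P)"
    by (intro nn_integral_cong) (simp add: acc_p indicator_def)
  also have "\<dots> = (\<integral>\<^sup>+\<omega>. (\<integral>\<^sup>+v. \<zeta> (\<omega>, W j \<omega>) * indicator {v. v \<le> p \<omega> (W j \<omega>)} v * indicator {0..1} v \<partial>lborel) \<partial>P)"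
  proof -
    have [measurable]: "(\<lambda>w. \<zeta> (fst w, W j (fst w))) \<in> borel_measurable (G' j \<Otimes>\<^sub>M borel)"
      "(\<lambda>w. p (fst w) (W j (fst w))) \<in> borel_measurable (G' j \<Otimes>\<^sub>M borel)"
      using measurable_compose[OF measurable_fst \<zeta>W] measurable_compose[OF measurable_fst pW] by auto
    have "(\<lambda>w. \<zeta> (fst w, W j (fst w)) * indicator {v. v \<le> p (fst w) (W j (fst w))} (snd w)) \<in> borel_measurable (G' j \<Otimes>\<^sub>M borel)"
      unfolding indicator_def mem_Collect_eq by measurable
    from law_V[OF this] show ?thesis by simp
  qed
  also have "\<dots> = (\<integral>\<^sup>+\<omega>. \<zeta> (\<omega>, W j \<omega>) * ennreal (p \<omega> (W j \<omega>)) \<partial>P)"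
  proof (rule nn_integral_cong)
    fix \<omega>
    have W: "0 \<le> W j \<omega>" using W_pos[of j \<omega>] by simp
    have "(\<integral>\<^sup>+v. \<zeta> (\<omega>, W j \<omega>) * indicator {v. v \<le> p \<omega> (W j \<omega>)} v * indicator {0..1} v \<partial>lborel) =
      (\<integral>\<^sup>+v. \<zeta> (\<omega>, W j \<omega>) * indicator {0..p \<omega> (W j \<omega>)} v \<partial>lborel)"
      using p01[OF W, of \<omega>] by (intro nn_integral_cong) (auto simp: indicator_def)
    also have "\<dots> = \<zeta> (\<omega>, W j \<omega>) * ennreal (p \<omega> (W j \<omega>))"
      using p01[OF W, of \<omega>] by (simp add: nn_integral_cmult_indicator)
    finally show "(\<integral>\<^sup>+v. \<zeta> (\<omega>, W j \<omega>) * indicator {v. v \<le> p \<omega> (W j \<omega>)} v * indicator {0..1} v \<partial>lborel) =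
      \<zeta> (\<omega>, W j \<omega>) * ennreal (p \<omega> (W j \<omega>))" .
  qed
  also have "\<dots> = (\<integral>\<^sup>+\<omega>\<in>{\<omega>. 0 < rate (X j \<omega>)}. \<zeta> (\<omega>, W j \<omega>) * ennreal (p \<omega> (W j \<omega>)) \<partial>P)"
  proof (rule nn_integral_cong)
    fix \<omega>
    show "\<zeta> (\<omega>, W j \<omega>) * ennreal (p \<omega> (W j \<omega>)) =
        \<zeta> (\<omega>, W j \<omega>) * ennreal (p \<omega> (W j \<omega>)) * indicator {\<omega>. 0 < rate (X j \<omega>)} \<omega>"
      using rate_nonneg[of "X j \<omega>"] by (cases "rate (X j \<omega>) = 0") (auto simp: p_def)
  qed
  also have "\<dots> = (\<integral>\<^sup>+\<omega>\<in>{\<omega>. 0 < rate (X j \<omega>)}. (\<integral>\<^sup>+y. \<zeta> (\<omega>, y) * ennreal (p \<omega> y) *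
      ennreal (exponential_density (rate (X j \<omega>)) y) \<partial>lborel) \<partial>P)"
  proof -
    have "(\<lambda>w. \<zeta> w * ennreal (p (fst w) (snd w))) \<in> borel_measurable (G j \<Otimes>\<^sub>M borel)"
      using \<zeta> pG by measurable
    from law_W[OF this] show ?thesis by simp
  qed
  also have "\<dots> = (\<integral>\<^sup>+\<omega>\<in>{\<omega>. 0 < rate (X j \<omega>)}. (\<integral>\<^sup>+y\<in>{0..}. \<zeta> (\<omega>, y) *
      ennreal (local_intensity j \<omega> y * exp (- rate (X j \<omega>) * y)) \<partial>lborel) \<partial>P)"
  proof (rule nn_integral_cong)
    fix \<omega>
    have eq: "\<zeta> (\<omega>, y) * ennreal (p \<omega> y) * ennreal (exponential_density (rate (X j \<omega>)) y) =
        \<zeta> (\<omega>, y) * ennreal (local_intensity j \<omega> y * exp (- rate (X j \<omega>) * y)) * indicator {0..} y"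
      if r: "0 < rate (X j \<omega>)" for y
    proof (cases "y < 0")
      case False
      then have "ennreal (p \<omega> y) * ennreal (exponential_density (rate (X j \<omega>)) y) =
          ennreal (p \<omega> y * exponential_density (rate (X j \<omega>)) y)"
        using p01 by (intro ennreal_mult[symmetric] exponential_density_nonneg r) auto
      also have "p \<omega> y * exponential_density (rate (X j \<omega>)) y = local_intensity j \<omega> y * exp (- rate (X j \<omega>) * y)"
        using r False by (simp add: p_def exponential_density_def mult.commute)
      finally show ?thesis using False by (simp add: mult.assoc)
    qed (simp add: exponential_density_def)
    show "(\<integral>\<^sup>+y. \<zeta> (\<omega>, y) * ennreal (p \<omega> y) * ennreal (exponential_density (rate (X j \<omega>)) y) \<partial>lborel)
        * indicator {\<omega>. 0 < rate (X j \<omega>)} \<omega> =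
      (\<integral>\<^sup>+y\<in>{0..}. \<zeta> (\<omega>, y) * ennreal (local_intensity j \<omega> y * exp (- rate (X j \<omega>) * y)) \<partial>lborel)
        * indicator {\<omega>. 0 < rate (X j \<omega>)} \<omega>"
      by (cases "0 < rate (X j \<omega>)") (simp_all only: eq, simp_all)
  qed
  finally show ?thesis .
qed

text \<open>
  By Fubini, the intensity at time \<open>y\<close> counts with the probability \<open>exp (- r y)\<close> that no candidate
  has come before. The result is the right-hand side of \<open>accepted_candidate\<close>.
\<close>

lemma integrated_intensity:
  fixes \<zeta> :: "'w \<times> real \<Rightarrow> ennreal"
  assumes \<zeta>: "\<zeta> \<in> borel_measurable (G j \<Otimes>\<^sub>M borel)"
  shows "(\<integral>\<^sup>+\<omega>. (\<integral>\<^sup>+y\<in>{0<..W j \<omega>}. \<zeta> (\<omega>, y) * ennreal (local_intensity j \<omega> y) \<partial>lborel) \<partial>P) =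
    (\<integral>\<^sup>+\<omega>\<in>{\<omega>. 0 < rate (X j \<omega>)}. (\<integral>\<^sup>+y\<in>{0..}. \<zeta> (\<omega>, y) *
      ennreal (local_intensity j \<omega> y * exp (- rate (X j \<omega>) * y)) \<partial>lborel) \<partial>P)"
proof -
  define \<xi> where "\<xi> w = \<zeta> w * ennreal (local_intensity j (fst w) (snd w))" for w
  have \<xi>[measurable]: "\<xi> \<in> borel_measurable (G j \<Otimes>\<^sub>M borel)"
    unfolding \<xi>_def[abs_def] using \<zeta> local_intensity_meas[of j] by measurable
  define \<Psi> where "\<Psi> w = (\<integral>\<^sup>+y. indicator {0<..snd w} y * \<xi> (fst w, y) \<partial>lborel)" for w
  have \<Psi>: "\<Psi> \<in> borel_measurable (G j \<Otimes>\<^sub>M borel)"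
  proof -
    have [measurable]: "(\<lambda>w. \<xi> (fst (fst w), snd w)) \<in> borel_measurable ((G j \<Otimes>\<^sub>M borel) \<Otimes>\<^sub>M lborel)"
      by (rule measurable_compose[OF _ \<xi>]) measurable
    have "(\<lambda>(w, y). indicator {0<..snd w} y * \<xi> (fst w, y)) \<in> borel_measurable ((G j \<Otimes>\<^sub>M borel) \<Otimes>\<^sub>M lborel)"
      unfolding case_prod_unfold indicator_def greaterThanAtMost_iff by measurable
    then show ?thesis unfolding \<Psi>_def[abs_def] by (rule lborel.borel_measurable_nn_integral)
  qed
  have slice: "(\<lambda>y. \<xi> (\<omega>, y)) \<in> borel_measurable borel" if "\<omega> \<in> space P" for \<omega>
    by (rule measurable_compose[OF measurable_Pair1' \<xi>]) (simp add: space_G that)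
  have "(\<integral>\<^sup>+\<omega>. (\<integral>\<^sup>+y\<in>{0<..W j \<omega>}. \<zeta> (\<omega>, y) * ennreal (local_intensity j \<omega> y) \<partial>lborel) \<partial>P) =
      (\<integral>\<^sup>+\<omega>\<in>{\<omega>. 0 < rate (X j \<omega>)}. \<Psi> (\<omega>, W j \<omega>) \<partial>P)"
  proof (rule nn_integral_cong)
    fix \<omega>
    show "(\<integral>\<^sup>+y\<in>{0<..W j \<omega>}. \<zeta> (\<omega>, y) * ennreal (local_intensity j \<omega> y) \<partial>lborel) =
        \<Psi> (\<omega>, W j \<omega>) * indicator {\<omega>. 0 < rate (X j \<omega>)} \<omega>"
    proof (cases "0 < rate (X j \<omega>)")
      case True
      then show ?thesis by (simp add: \<Psi>_def \<xi>_def mult.commute)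
    next
      case False
      then have r: "rate (X j \<omega>) = 0" using rate_nonneg[of "X j \<omega>"] by simp
      have "local_intensity j \<omega> y = 0" if "0 < y" for y
        using rate_dominates[of y "X j \<omega>"] f_nonneg[of "flow_sum L n \<alpha> y (X j \<omega>)"] that r
        by (simp add: local_intensity_def)
      then have "(\<integral>\<^sup>+y\<in>{0<..W j \<omega>}. \<zeta> (\<omega>, y) * ennreal (local_intensity j \<omega> y) \<partial>lborel) = (\<integral>\<^sup>+y. 0 \<partial>(lborel :: real measure))"
        by (intro nn_integral_cong) (auto simp: indicator_def)
      then show ?thesis using False by simp
    qed
  qed
  also have "\<dots> = (\<integral>\<^sup>+\<omega>\<in>{\<omega>. 0 < rate (X j \<omega>)}. (\<integral>\<^sup>+w. \<Psi> (\<omega>, w) *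
      ennreal (exponential_density (rate (X j \<omega>)) w) \<partial>lborel) \<partial>P)"
    by (rule law_W[OF \<Psi>])
  also have "\<dots> = (\<integral>\<^sup>+\<omega>\<in>{\<omega>. 0 < rate (X j \<omega>)}. (\<integral>\<^sup>+y\<in>{0..}. \<zeta> (\<omega>, y) *
      ennreal (local_intensity j \<omega> y * exp (- rate (X j \<omega>) * y)) \<partial>lborel) \<partial>P)"
  proof (rule nn_integral_cong)
    fix \<omega> assume \<omega>: "\<omega> \<in> space P"
    define r where "r = rate (X j \<omega>)"
    have [measurable]: "(\<lambda>y. \<xi> (\<omega>, y)) \<in> borel_measurable borel" by (rule slice[OF \<omega>])
    then have slice': "(\<lambda>y. \<xi> (\<omega>, y)) \<in> borel_measurable lborel" by simp
    have "(\<integral>\<^sup>+w. \<Psi> (\<omega>, w) * ennreal (exponential_density r w) \<partial>lborel) =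
       (\<integral>\<^sup>+y\<in>{0..}. \<zeta> (\<omega>, y) * ennreal (local_intensity j \<omega> y * exp (- r * y)) \<partial>lborel)"
      if r: "0 < r"
    proof -
      have "(\<integral>\<^sup>+w. \<Psi> (\<omega>, w) * ennreal (exponential_density r w) \<partial>lborel) =
        (\<integral>\<^sup>+w. (\<integral>\<^sup>+y. indicator {0<..w} y * \<xi> (\<omega>, y) * ennreal (exponential_density r w) \<partial>lborel) \<partial>lborel)"
      proof (rule nn_integral_cong)
        fix w
        show "\<Psi> (\<omega>, w) * ennreal (exponential_density r w) =
            (\<integral>\<^sup>+y. indicator {0<..w} y * \<xi> (\<omega>, y) * ennreal (exponential_density r w) \<partial>lborel)"
          unfolding \<Psi>_def fst_conv snd_conv
          by (rule nn_integral_multc[symmetric])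
             (rule borel_measurable_times_ennreal[OF borel_measurable_indicator slice'], simp)
      qed
      also have "\<dots> = (\<integral>\<^sup>+y. (\<integral>\<^sup>+w. indicator {0<..w} y * \<xi> (\<omega>, y) * ennreal (exponential_density r w) \<partial>lborel) \<partial>lborel)"
      proof (rule lborel_pair.Fubini')
        show "(\<lambda>(y, w). indicator {0<..w} y * \<xi> (\<omega>, y) * ennreal (exponential_density r w))
            \<in> borel_measurable (lborel \<Otimes>\<^sub>M lborel)"
          unfolding case_prod_unfold indicator_def greaterThanAtMost_iff by measurable
      qed
      also have "\<dots> = (\<integral>\<^sup>+y. \<xi> (\<omega>, y) * indicator {0<..} y * ennreal (exp (- r * y)) \<partial>lborel)"
      proof (rule nn_integral_cong)
        fix y :: real
        show "(\<integral>\<^sup>+w. indicator {0<..w} y * \<xi> (\<omega>, y) * ennreal (exponential_density r w) \<partial>lborel) =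
           \<xi> (\<omega>, y) * indicator {0<..} y * ennreal (exp (- r * y))"
        proof (cases "0 < y")
          case True
          have "(\<integral>\<^sup>+w. indicator {0<..w} y * \<xi> (\<omega>, y) * ennreal (exponential_density r w) \<partial>lborel) =
             (\<integral>\<^sup>+w. \<xi> (\<omega>, y) * (indicator {y..} w * ennreal (exponential_density r w)) \<partial>lborel)"
            using True by (intro nn_integral_cong) (auto simp: indicator_def)
          also have "\<dots> = \<xi> (\<omega>, y) * ennreal (exp (- r * y))"
            using nn_integral_exponential_tail[OF r, of y] True by (subst nn_integral_cmult) auto
          finally show ?thesis using True by simp
        qed simp
      qed
      also have "\<dots> = (\<integral>\<^sup>+y\<in>{0..}. \<zeta> (\<omega>, y) * ennreal (local_intensity j \<omega> y * exp (- r * y)) \<partial>lborel)"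
      proof (rule nn_integral_cong_AE)
        show "AE y in lborel. \<xi> (\<omega>, y) * indicator {0<..} y * ennreal (exp (- r * y)) =
            \<zeta> (\<omega>, y) * ennreal (local_intensity j \<omega> y * exp (- r * y)) * indicator {0..} y"
          using AE_lborel_singleton[of 0]
          by eventually_elim (auto simp: \<xi>_def indicator_def ennreal_mult local_intensity_def f_nonneg mult.assoc)
      qed
      finally show ?thesis .
    qed
    then show "(\<integral>\<^sup>+w. \<Psi> (\<omega>, w) * ennreal (exponential_density (rate (X j \<omega>)) w) \<partial>lborel) * indicator {\<omega>. 0 < rate (X j \<omega>)} \<omega> =
      (\<integral>\<^sup>+y\<in>{0..}. \<zeta> (\<omega>, y) * ennreal (local_intensity j \<omega> y * exp (- rate (X j \<omega>) * y)) \<partial>lborel) * indicator {\<omega>. 0 < rate (X j \<omega>)} \<omega>"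
      by (simp add: r_def indicator_def)
  qed
  finally show ?thesis .
qed

lemma compensation_step:
  fixes Z :: "real \<times> real set \<Rightarrow> ennreal"
  assumes Z: "Z \<in> borel_measurable pred_space"
  shows "(\<integral>\<^sup>+\<omega>. Z (time (Suc j) \<omega>, pts j \<omega>) * indicator {\<omega>. acc j \<omega>} \<omega> \<partial>P) =
    (\<integral>\<^sup>+\<omega>. (\<integral>\<^sup>+u\<in>{time j \<omega><..time (Suc j) \<omega>}. Z (u, pts j \<omega>) *
      ennreal (local_intensity j \<omega> (u - time j \<omega>)) \<partial>lborel) \<partial>P)"
proof -
  \<comment> \<open>The maximum with 0 only serves to define the integrand at negative times, where \<open>Z\<close> need not be measurable.\<close>
  define \<zeta> where "\<zeta> w = Z (max 0 (time j (fst w) + snd w), pts j (fst w))" for w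
  have m: "(\<lambda>w. (time j (fst w) + snd w, pts j (fst w))) \<in> measurable (G j \<Otimes>\<^sub>M borel) (borel \<Otimes>\<^sub>M conf_space)"
    by (intro measurable_Pair borel_measurable_add measurable_snd measurable_compose[OF measurable_fst time_meas]
        measurable_compose[OF measurable_fst pts_meas])
  have \<zeta>: "\<zeta> \<in> borel_measurable (G j \<Otimes>\<^sub>M borel)"
    using measurable_compose[OF m predictable_jointly_measurable'[OF Z]] by (simp add: \<zeta>_def[abs_def])
  have \<zeta>_eq: "\<zeta> (\<omega>, y) = Z (time j \<omega> + y, pts j \<omega>)" if "0 \<le> y" for \<omega> y
    using time_nonneg[of j \<omega>] that by (simp add: \<zeta>_def)
  have "(\<integral>\<^sup>+\<omega>. Z (time (Suc j) \<omega>, pts j \<omega>) * indicator {\<omega>. acc j \<omega>} \<omega> \<partial>P) =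
      (\<integral>\<^sup>+\<omega>. \<zeta> (\<omega>, W j \<omega>) * indicator {\<omega>. acc j \<omega>} \<omega> \<partial>P)"
    using W_pos by (simp add: \<zeta>_eq time_Suc less_imp_le)
  also have "\<dots> = (\<integral>\<^sup>+\<omega>. (\<integral>\<^sup>+y\<in>{0<..W j \<omega>}. \<zeta> (\<omega>, y) * ennreal (local_intensity j \<omega> y) \<partial>lborel) \<partial>P)"
    unfolding accepted_candidate[OF \<zeta>] integrated_intensity[OF \<zeta>] ..
  also have "\<dots> = (\<integral>\<^sup>+\<omega>. (\<integral>\<^sup>+u\<in>{time j \<omega><..time (Suc j) \<omega>}. Z (u, pts j \<omega>) *
      ennreal (local_intensity j \<omega> (u - time j \<omega>)) \<partial>lborel) \<partial>P)"
  proof (rule nn_integral_cong)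
    fix \<omega> assume \<omega>: "\<omega> \<in> space P"
    define g where "g u = Z (max 0 u, pts j \<omega>) * ennreal (local_intensity j \<omega> (u - time j \<omega>)) *
        indicator {time j \<omega><..time (Suc j) \<omega>} u" for u
    have g: "g \<in> borel_measurable borel"
    proof -
      have [measurable]: "(\<lambda>u. Z (max 0 u, pts j \<omega>)) \<in> borel_measurable borel"
        using measurable_compose[OF measurable_Pair2'[of "pts j \<omega>" conf_space borel] predictable_jointly_measurable'[OF Z]]
        by (simp add: pts_confs)
      have [measurable]: "(\<lambda>u. local_intensity j \<omega> (u - time j \<omega>)) \<in> borel_measurable borel"
        unfolding local_intensity_def by measurable
      show ?thesis unfolding g_def[abs_def] by measurable
    qed
    have "(\<integral>\<^sup>+u\<in>{time j \<omega><..time (Suc j) \<omega>}. Z (u, pts j \<omega>) * ennreal (local_intensity j \<omega> (u - time j \<omega>)) \<partial>lborel) =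
        (\<integral>\<^sup>+u. g u \<partial>lborel)"
      unfolding g_def using time_nonneg[of j \<omega>] by (intro nn_integral_cong) (auto simp: indicator_def)
    also have "\<dots> = (\<integral>\<^sup>+y. g (time j \<omega> + y) \<partial>lborel)" by (rule nn_integral_shift[OF g])
    also have "\<dots> = (\<integral>\<^sup>+y\<in>{0<..W j \<omega>}. \<zeta> (\<omega>, y) * ennreal (local_intensity j \<omega> y) \<partial>lborel)"
      unfolding g_def \<zeta>_def by (intro nn_integral_cong) (auto simp: indicator_def time_Suc)
    finally show "(\<integral>\<^sup>+y\<in>{0<..W j \<omega>}. \<zeta> (\<omega>, y) * ennreal (local_intensity j \<omega> y) \<partial>lborel) =
      (\<integral>\<^sup>+u\<in>{time j \<omega><..time (Suc j) \<omega>}. Z (u, pts j \<omega>) * ennreal (local_intensity j \<omega> (u - time j \<omega>)) \<partial>lborel)"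
      by simp
  qed
  finally show ?thesis .
qed

lemma next_candidate:
  assumes "unbounded \<omega>" "0 < u"
  shows "\<exists>j. time j \<omega> < u \<and> u \<le> time (Suc j) \<omega>"
proof -
  obtain J where "\<forall>j\<ge>J. u < time j \<omega>" using unbounded_eventually[OF assms(1)] by blast
  then have "u < time J \<omega>" by blast
  then have ex: "\<exists>j. u \<le> time j \<omega>" by (intro exI[of _ J] less_imp_le)
  define k where "k = (LEAST j. u \<le> time j \<omega>)"
  have k: "u \<le> time k \<omega>" unfolding k_def by (rule LeastI_ex[OF ex])
  then obtain j where j: "k = Suc j" using assms(2) by (cases k) auto
  have "\<not> u \<le> time j \<omega>" using not_less_Least[of j "\<lambda>j. u \<le> time j \<omega>"] by (simp add: k_def[symmetric] j)
  then show ?thesis using k j by (intro exI[of _ j]) simp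
qed

text \<open>
  On a locally finite realization the time axis is the disjoint union of the intervals between
  candidates. On each of them the configuration may be replaced by the points accepted so far,
  both in the predictable \<open>Z\<close> and in the intensity, and the formula for one step applies.
\<close>

lemma compensation_formula_points:
  fixes Z :: "real \<times> real set \<Rightarrow> ennreal"
  assumes Z: "Z \<in> borel_measurable pred_space"
  shows "(\<integral>\<^sup>+\<omega>. (\<integral>\<^sup>+u. Z (u, points \<omega>) \<partial>count_space (points \<omega>)) \<partial>P) =
    (\<integral>\<^sup>+\<omega>. (\<integral>\<^sup>+u\<in>{0<..}. Z (u, points \<omega>) * ennreal (intensity u (points \<omega>)) \<partial>lborel) \<partial>P)"
proof -
  have Zdet: "Z (u, points \<omega>) = Z (u, pts j \<omega>)" if "unbounded \<omega>" "0 \<le> u" "u \<le> time (Suc j) \<omega>" for u \<omega> j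
    by (rule predictable_determined[OF Z points_confs pts_confs that(2) points_before[OF that(1,3)]])
  have L: "(\<integral>\<^sup>+u. Z (u, points \<omega>) \<partial>count_space (points \<omega>)) =
      (\<Sum>j. Z (time (Suc j) \<omega>, pts j \<omega>) * indicator {\<omega>. acc j \<omega>} \<omega>)" if \<omega>: "unbounded \<omega>" for \<omega>
  proof -
    have bij: "bij_betw (\<lambda>j. time (Suc j) \<omega>) {j. acc j \<omega>} (points \<omega>)"
    proof (rule bij_betw_imageI)
      show "inj_on (\<lambda>j. time (Suc j) \<omega>) {j. acc j \<omega>}" by (rule inj_onI) (simp add: time_eq_iff)
      show "(\<lambda>j. time (Suc j) \<omega>) ` {j. acc j \<omega>} = points \<omega>"
        unfolding points_def if_P[OF \<omega>] by blast
    qed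
    have "(\<integral>\<^sup>+u. Z (u, points \<omega>) \<partial>count_space (points \<omega>)) =
        (\<integral>\<^sup>+j. Z (time (Suc j) \<omega>, points \<omega>) \<partial>count_space {j. acc j \<omega>})"
      by (rule nn_integral_bij_count_space[OF bij, symmetric])
    also have "\<dots> = (\<integral>\<^sup>+j. Z (time (Suc j) \<omega>, points \<omega>) * indicator {j. acc j \<omega>} j \<partial>count_space UNIV)"
      by (rule nn_integral_count_space_indicator) simp
    also have "\<dots> = (\<Sum>j. Z (time (Suc j) \<omega>, points \<omega>) * indicator {j. acc j \<omega>} j)"
      by (rule nn_integral_count_space_nat)
    also have "\<dots> = (\<Sum>j. Z (time (Suc j) \<omega>, pts j \<omega>) * indicator {\<omega>. acc j \<omega>} \<omega>)"
      by (intro suminf_cong) (simp add: Zdet[OF \<omega> time_nonneg order_refl] indicator_def)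
    finally show ?thesis .
  qed
  have R: "(\<integral>\<^sup>+u\<in>{0<..}. Z (u, points \<omega>) * ennreal (intensity u (points \<omega>)) \<partial>lborel) =
      (\<Sum>j. \<integral>\<^sup>+u\<in>{time j \<omega><..time (Suc j) \<omega>}. Z (u, pts j \<omega>) * ennreal (local_intensity j \<omega> (u - time j \<omega>)) \<partial>lborel)"
    if \<omega>: "unbounded \<omega>" for \<omega>
  proof -
    define I where "I j = {time j \<omega><..time (Suc j) \<omega>}" for j
    have dis: "disjoint_family I"
      unfolding disjoint_family_on_def
    proof (intro ballI impI)
      fix i j :: nat assume "i \<noteq> j"
      then consider "Suc i \<le> j" | "Suc j \<le> i" by linarith
      then show "I i \<inter> I j = {}"
      proof cases
        case 1 then show ?thesis using time_le_iff[of "Suc i" \<omega> j] by (auto simp: I_def)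
      next
        case 2 then show ?thesis using time_le_iff[of "Suc j" \<omega> i] by (auto simp: I_def)
      qed
    qed
    have un: "(\<Union>j. I j) = {0<..}"
    proof (intro set_eqI iffI)
      fix u assume "u \<in> (\<Union>j. I j)"
      then obtain j where "time j \<omega> < u" unfolding I_def by auto
      then show "u \<in> {0<..}" using time_nonneg[of j \<omega>] by simp
    next
      fix u :: real assume "u \<in> {0<..}"
      then have "0 < u" by simp
      from next_candidate[OF \<omega> this] obtain j where "time j \<omega> < u" "u \<le> time (Suc j) \<omega>" by blast
      then have "u \<in> I j" unfolding I_def by simp
      then show "u \<in> (\<Union>j. I j)" by blast
    qed
    define F where "F u = Z (max 0 u, points \<omega>) * ennreal (intensity (max 0 u) (points \<omega>))" for u
    have [measurable]: "F \<in> borel_measurable borel"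
    proof -
      have 1: "(\<lambda>u. Z (max 0 u, points \<omega>)) \<in> borel_measurable borel"
        using measurable_compose[OF measurable_Pair2'[of "points \<omega>" conf_space borel] predictable_jointly_measurable'[OF Z]]
        by (simp add: points_confs)
      have 2: "(\<lambda>u. intensity (max 0 u) (points \<omega>)) \<in> borel_measurable borel"
      proof -
        have "points \<omega> \<in> space conf_space" by (simp only: space_conf_space points_confs)
        from measurable_compose[OF measurable_Pair2'[OF this] predictable_jointly_measurable'[OF intensity_predictable]]
        show ?thesis by (simp only: prod.case)
      qed
      show ?thesis unfolding F_def[abs_def]
        by (rule borel_measurable_times_ennreal[OF 1 measurable_compose[OF 2 measurable_ennreal]])
    qed
    have "(\<integral>\<^sup>+u\<in>{0<..}. Z (u, points \<omega>) * ennreal (intensity u (points \<omega>)) \<partial>lborel) = (\<integral>\<^sup>+u. F u * indicator {0<..} u \<partial>lborel)"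
      by (intro nn_integral_cong) (simp add: F_def indicator_def)
    also have "\<dots> = (\<integral>\<^sup>+u. (\<Sum>j. F u * indicator (I j) u) \<partial>lborel)"
      by (intro nn_integral_cong) (simp add: suminf_indicator[OF dis] un)
    also have "\<dots> = (\<Sum>j. \<integral>\<^sup>+u. F u * indicator (I j) u \<partial>lborel)"
      by (rule nn_integral_suminf) (simp add: I_def)
    also have "\<dots> = (\<Sum>j. \<integral>\<^sup>+u\<in>{time j \<omega><..time (Suc j) \<omega>}. Z (u, pts j \<omega>) * ennreal (local_intensity j \<omega> (u - time j \<omega>)) \<partial>lborel)"
    proof (intro suminf_cong nn_integral_cong)
      fix j and u :: real
      show "F u * indicator (I j) u = Z (u, pts j \<omega>) * ennreal (local_intensity j \<omega> (u - time j \<omega>)) * indicator {time j \<omega><..time (Suc j) \<omega>} u"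
      proof (cases "u \<in> I j")
        case True
        then have u: "time j \<omega> < u" "u \<le> time (Suc j) \<omega>" "0 \<le> u"
          using time_nonneg[of j \<omega>] by (auto simp: I_def)
        show ?thesis using True
          by (simp add: F_def I_def Zdet[OF \<omega> u(3,2)] intensity_between[OF \<omega> u(1,2)] local_intensity_def u(3))
      qed (simp add: I_def)
    qed
    finally show ?thesis .
  qed
  have mL: "(\<lambda>\<omega>. Z (time (Suc j) \<omega>, pts j \<omega>) * indicator {\<omega>. acc j \<omega>} \<omega>) \<in> borel_measurable P" for j
  proof -
    have "(\<lambda>\<omega>. Z (max 0 (time (Suc j) \<omega>), pts j \<omega>)) \<in> borel_measurable P"
      using measurable_compose[OF measurable_Pair[OF meas_P(1)[of "Suc j"] meas_P(5)[of j]] predictable_jointly_measurable'[OF Z]] by simp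
    then have [measurable]: "(\<lambda>\<omega>. Z (time (Suc j) \<omega>, pts j \<omega>)) \<in> borel_measurable P"
      by (simp add: time_nonneg)
    have [measurable]: "Measurable.pred P (acc j)" by (rule meas_P)
    show ?thesis unfolding indicator_def mem_Collect_eq by measurable
  qed
  have mR: "(\<lambda>\<omega>. \<integral>\<^sup>+u\<in>{time j \<omega><..time (Suc j) \<omega>}. Z (u, pts j \<omega>) * ennreal (local_intensity j \<omega> (u - time j \<omega>)) \<partial>lborel)
      \<in> borel_measurable P" for j
  proof -
    note [measurable] = meas_P
    have pair: "(\<lambda>w. (snd w, pts j (fst w))) \<in> measurable (P \<Otimes>\<^sub>M lborel) (borel \<Otimes>\<^sub>M conf_space)"
      by (rule measurable_Pair[OF _ measurable_compose[OF measurable_fst meas_P(5)]]) measurable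
    have "(\<lambda>w. Z (max 0 (snd w), pts j (fst w))) \<in> borel_measurable (P \<Otimes>\<^sub>M lborel)"
      using measurable_compose[OF pair predictable_jointly_measurable'[OF Z]] by (simp only: prod.case)
    note [measurable] = this
    have X: "(\<lambda>w. X j (fst w)) \<in> measurable (P \<Otimes>\<^sub>M lborel) borel"
      by (rule measurable_compose[OF measurable_fst meas_P(4)])
    have d: "(\<lambda>w. snd w - time j (fst w)) \<in> borel_measurable (P \<Otimes>\<^sub>M lborel)" by measurable
    have [measurable]: "(\<lambda>w. local_intensity j (fst w) (snd w - time j (fst w))) \<in> borel_measurable (P \<Otimes>\<^sub>M lborel)"
      unfolding local_intensity_def by (rule measurable_compose[OF measurable_flow_sum[OF d X] f_meas])
    have "(\<lambda>(\<omega>, u). Z (max 0 u, pts j \<omega>) * ennreal (local_intensity j \<omega> (u - time j \<omega>)) * indicator {time j \<omega><..time (Suc j) \<omega>} u)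
       \<in> borel_measurable (P \<Otimes>\<^sub>M lborel)"
      unfolding case_prod_unfold indicator_def greaterThanAtMost_iff by measurable
    then have "(\<lambda>\<omega>. \<integral>\<^sup>+u. Z (max 0 u, pts j \<omega>) * ennreal (local_intensity j \<omega> (u - time j \<omega>)) * indicator {time j \<omega><..time (Suc j) \<omega>} u \<partial>lborel)
      \<in> borel_measurable P" by (rule lborel.borel_measurable_nn_integral)
    moreover have "(\<integral>\<^sup>+u. Z (max 0 u, pts j \<omega>) * ennreal (local_intensity j \<omega> (u - time j \<omega>)) * indicator {time j \<omega><..time (Suc j) \<omega>} u \<partial>lborel) =
      (\<integral>\<^sup>+u\<in>{time j \<omega><..time (Suc j) \<omega>}. Z (u, pts j \<omega>) * ennreal (local_intensity j \<omega> (u - time j \<omega>)) \<partial>lborel)" for \<omega>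
      using time_nonneg[of j \<omega>] by (intro nn_integral_cong) (auto simp: indicator_def)
    ultimately show ?thesis by simp
  qed
  have "(\<integral>\<^sup>+\<omega>. (\<integral>\<^sup>+u. Z (u, points \<omega>) \<partial>count_space (points \<omega>)) \<partial>P) =
      (\<integral>\<^sup>+\<omega>. (\<Sum>j. Z (time (Suc j) \<omega>, pts j \<omega>) * indicator {\<omega>. acc j \<omega>} \<omega>) \<partial>P)"
    by (rule nn_integral_cong_AE, rule AE_mp[OF AE_unbounded], rule AE_I2, rule impI, rule L)
  also have "\<dots> = (\<Sum>j. \<integral>\<^sup>+\<omega>. Z (time (Suc j) \<omega>, pts j \<omega>) * indicator {\<omega>. acc j \<omega>} \<omega> \<partial>P)"
    by (rule nn_integral_suminf[OF mL])
  also have "\<dots> = (\<Sum>j. \<integral>\<^sup>+\<omega>. (\<integral>\<^sup>+u\<in>{time j \<omega><..time (Suc j) \<omega>}. Z (u, pts j \<omega>) * ennreal (local_intensity j \<omega> (u - time j \<omega>)) \<partial>lborel) \<partial>P)"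
    by (rule suminf_cong) (rule compensation_step[OF Z])
  also have "\<dots> = (\<integral>\<^sup>+\<omega>. (\<Sum>j. \<integral>\<^sup>+u\<in>{time j \<omega><..time (Suc j) \<omega>}. Z (u, pts j \<omega>) * ennreal (local_intensity j \<omega> (u - time j \<omega>)) \<partial>lborel) \<partial>P)"
    by (rule nn_integral_suminf[OF mR, symmetric])
  also have "\<dots> = (\<integral>\<^sup>+\<omega>. (\<integral>\<^sup>+u\<in>{0<..}. Z (u, points \<omega>) * ennreal (intensity u (points \<omega>)) \<partial>lborel) \<partial>P)"
    by (rule nn_integral_cong_AE, rule AE_mp[OF AE_unbounded], rule AE_I2, rule impI, rule R[symmetric])
  finally show ?thesis .
qed

end

section \<open>The accepted candidates form a Hawkes process\<close>

lemma erlang_kernel_eq_flow_sum: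
  "erlang_kernel L n \<alpha> c t = flow_sum L n \<alpha> t (kick L n c (\<lambda>_ _. 0))"
  unfolding flow_sum_kick by (simp add: flow_sum_def flow_def)

context thinning begin

lemma intensity_bounded:
  assumes "\<Phi> \<in> confs" shows "\<exists>B. \<forall>s\<in>{0..t}. intensity s \<Phi> \<le> B"
proof (intro exI ballI)
  let ?m = "flow_max L n \<alpha>" and ?k = "kick L n c (\<lambda>_ _. 0)"
  fix s assume s: "s \<in> {0..t}"
  have "\<bar>\<Sum>v\<in>\<Phi> \<inter> {0<..<s}. erlang_kernel L n \<alpha> c (s - v)\<bar> \<le> (\<Sum>v\<in>\<Phi> \<inter> {0<..<s}. \<bar>erlang_kernel L n \<alpha> c (s - v)\<bar>)"
    by (rule sum_abs)
  also have "\<dots> \<le> (\<Sum>v\<in>\<Phi> \<inter> {0<..<s}. real L * ?m ?k)"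
    by (intro sum_mono) (auto simp: erlang_kernel_eq_flow_sum intro!: abs_flow_sum_le)
  also have "\<dots> = real (card (\<Phi> \<inter> {0<..<s})) * (real L * ?m ?k)" by simp
  also have "\<dots> \<le> real (card (\<Phi> \<inter> {0<..t})) * (real L * ?m ?k)"
  proof (intro mult_right_mono of_nat_mono card_mono)
    show "finite (\<Phi> \<inter> {0<..t})" using assms by (simp add: confs_def)
  qed (use s flow_max_nonneg in auto)
  finally have sum: "\<bar>\<Sum>v\<in>\<Phi> \<inter> {0<..<s}. erlang_kernel L n \<alpha> c (s - v)\<bar> \<le> real (card (\<Phi> \<inter> {0<..t})) * (real L * ?m ?k)" .
  have "\<bar>flow_sum L n \<alpha> s x0\<bar> \<le> real L * ?m x0" using s by (intro abs_flow_sum_le) simp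
  with sum have "\<bar>flow_sum L n \<alpha> s x0 + (\<Sum>v\<in>\<Phi> \<inter> {0<..<s}. erlang_kernel L n \<alpha> c (s - v))\<bar>
      \<le> real L * ?m x0 + real (card (\<Phi> \<inter> {0<..t})) * (real L * ?m ?k)"
    by linarith
  then have "b * \<bar>flow_sum L n \<alpha> s x0 + (\<Sum>v\<in>\<Phi> \<inter> {0<..<s}. erlang_kernel L n \<alpha> c (s - v))\<bar>
      \<le> b * (real L * ?m x0 + real (card (\<Phi> \<inter> {0<..t})) * (real L * ?m ?k))"
    by (rule mult_left_mono[OF _ b_nonneg])
  then show "intensity s \<Phi> \<le> a + b * (real L * ?m x0 + real (card (\<Phi> \<inter> {0<..t})) * (real L * ?m ?k))"
    unfolding intensity_def using f_growth by (meson add_left_mono order_trans)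
qed

lemma intensity_set_integrable:
  assumes "\<Phi> \<in> confs" "0 \<le> t"
  shows "set_integrable lborel {0..t} (\<lambda>s. intensity s \<Phi>)"
proof -
  obtain B where B: "\<forall>s\<in>{0..t}. intensity s \<Phi> \<le> B" using intensity_bounded[OF assms(1)] by blast
  have m: "(\<lambda>s. intensity (max 0 s) \<Phi>) \<in> borel_measurable borel"
  proof -
    have "\<Phi> \<in> space conf_space" using assms(1) by (simp only: space_conf_space)
    from measurable_compose[OF measurable_Pair2'[OF this] predictable_jointly_measurable'[OF intensity_predictable]]
    show ?thesis by (simp only: prod.case)
  qed
  have "set_integrable lborel {0..t} (\<lambda>s. intensity (max 0 s) \<Phi>)"
    unfolding set_integrable_def
  proof (rule integrableI_bounded_set[where A = "{0..t}" and B = B])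
    show "(\<lambda>s. indicat_real {0..t} s *\<^sub>R intensity (max 0 s) \<Phi>) \<in> borel_measurable lborel"
      using m by simp
    show "AE s in lborel. s \<in> {0..t} \<longrightarrow> norm (indicat_real {0..t} s *\<^sub>R intensity (max 0 s) \<Phi>) \<le> B"
      using B f_nonneg by (intro AE_I2) (auto simp: intensity_def)
  qed (use assms(2) in auto)
  moreover have "indicat_real {0..t} s *\<^sub>R intensity (max 0 s) \<Phi> = indicat_real {0..t} s *\<^sub>R intensity s \<Phi>" for s
    by (simp add: indicator_def)
  ultimately show ?thesis unfolding set_integrable_def by (simp only:)
qed

definition point_law :: "real set measure" where
  "point_law = distr P conf_space points"

lemma sets_point_law: "sets point_law = sets conf_space"
  by (simp add: point_law_def)

lemma space_point_law: "space point_law = confs"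
  by (simp add: point_law_def)

lemma compensation_point_law: "compensation point_law intensity"
proof (rule compensation.intro)
  show "prob_space point_law" unfolding point_law_def by (rule prob_space_distr[OF points_meas])
  show "sets point_law = sets conf_space" by (rule sets_point_law)
  show "(\<lambda>(u, \<Phi>). intensity u \<Phi>) \<in> borel_measurable pred_space" by (rule intensity_predictable)
  show "0 \<le> intensity u \<Phi>" for u \<Phi> by (simp add: intensity_def f_nonneg)
  show "set_integrable lborel {0..t} (\<lambda>s. intensity s \<Phi>)" if "\<Phi> \<in> confs" "0 \<le> t" for t \<Phi>
    by (rule intensity_set_integrable[OF that])
  fix Z :: "real \<times> real set \<Rightarrow> ennreal"
  assume Z: "Z \<in> borel_measurable pred_space"
    and mZ: "(\<lambda>\<Phi>. \<integral>\<^sup>+u. Z (u, \<Phi>) \<partial>count_space \<Phi>) \<in> borel_measurable conf_space"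
  have "(\<lambda>(u, \<Phi>). Z (max 0 u, \<Phi>) * ennreal (intensity (max 0 u) \<Phi>) * indicator {0<..} u) \<in> borel_measurable (borel \<Otimes>\<^sub>M conf_space)"
  proof -
    have [measurable]: "(\<lambda>w. Z (max 0 (fst w), snd w)) \<in> borel_measurable (borel \<Otimes>\<^sub>M conf_space)"
      "(\<lambda>w. intensity (max 0 (fst w)) (snd w)) \<in> borel_measurable (borel \<Otimes>\<^sub>M conf_space)"
      using predictable_jointly_measurable'[OF Z] predictable_jointly_measurable'[OF intensity_predictable]
      by (simp_all add: case_prod_unfold)
    show ?thesis unfolding case_prod_unfold by measurable
  qed
  then have "(\<lambda>(\<Phi>, u). Z (max 0 u, \<Phi>) * ennreal (intensity (max 0 u) \<Phi>) * indicator {0<..} u) \<in> borel_measurable (conf_space \<Otimes>\<^sub>M lborel)"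
    by (subst (asm) measurable_pair_swap_iff) (simp add: case_prod_unfold cong: measurable_cong_sets)
  then have "(\<lambda>\<Phi>. \<integral>\<^sup>+u. Z (max 0 u, \<Phi>) * ennreal (intensity (max 0 u) \<Phi>) * indicator {0<..} u \<partial>lborel) \<in> borel_measurable conf_space"
    by (rule lborel.borel_measurable_nn_integral)
  moreover have "(\<integral>\<^sup>+u. Z (max 0 u, \<Phi>) * ennreal (intensity (max 0 u) \<Phi>) * indicator {0<..} u \<partial>lborel) =
      (\<integral>\<^sup>+u\<in>{0<..}. Z (u, \<Phi>) * ennreal (intensity u \<Phi>) \<partial>lborel)" for \<Phi>
    by (intro nn_integral_cong) (auto simp: indicator_def)
  ultimately have mR: "(\<lambda>\<Phi>. \<integral>\<^sup>+u\<in>{0<..}. Z (u, \<Phi>) * ennreal (intensity u \<Phi>) \<partial>lborel) \<in> borel_measurable conf_space"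
    by simp
  show "(\<integral>\<^sup>+\<Phi>. (\<integral>\<^sup>+u. Z (u, \<Phi>) \<partial>count_space \<Phi>) \<partial>point_law) =
      (\<integral>\<^sup>+\<Phi>. (\<integral>\<^sup>+u\<in>{0<..}. Z (u, \<Phi>) * ennreal (intensity u \<Phi>) \<partial>lborel) \<partial>point_law)"
    unfolding point_law_def using compensation_formula_points[OF Z] mZ mR
    by (simp add: nn_integral_distr[OF points_meas])
qed

text \<open>
  The assumption on \<open>\<eta>\<close> turns the Hawkes intensity into the function \<open>intensity\<close> of the
  compensation formula.
\<close>

lemma hawkes_process_point_law:
  assumes init: "\<And>u. 0 \<le> u \<Longrightarrow> (LINT s:{..0}|\<eta>. erlang_kernel L n \<alpha> c (u - s)) = flow_sum L n \<alpha> u x0"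
  shows "hawkes_process f (erlang_kernel L n \<alpha> c) \<eta> point_law (\<lambda>\<Phi>. \<Phi>)"
proof -
  interpret C: compensation point_law intensity by (rule compensation_point_law)
  define intens where "intens = hawkes_intensity f (erlang_kernel L n \<alpha> c) \<eta> (\<lambda>\<Phi>. \<Phi>)"
  have intens: "intens u \<Phi> = intensity u \<Phi>" if "0 \<le> u" for u \<Phi>
    using init[OF that] by (simp add: intens_def hawkes_intensity_def intensity_def)
  have F: "natural_filtration point_law (\<lambda>\<Phi>. \<Phi>) = conf_filt"
    by (rule natural_filtration_eq_conf_filt[OF space_point_law])
  have A: "(\<lambda>t \<Phi>. LINT s:{0..t}|lborel. intens s \<Phi>) = C.comp"
    unfolding fun_eq_iff C.comp_def
    by (intro allI set_lebesgue_integral_cong) (auto simp: intens)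
  have "simple_point_process point_law (\<lambda>\<Phi>. \<Phi>)"
    unfolding simple_point_process_def
  proof (intro conjI allI ballI impI)
    show "prob_space point_law" by (rule C.prob_Q)
  next
    fix \<Phi> t assume "\<Phi> \<in> space point_law"
    then show "\<Phi> \<subseteq> {0<..}" "finite (\<Phi> \<inter> {0<..t})" by (auto simp: space_point_law confs_def)
  next
    fix t and B :: "real set" assume "B \<in> sets borel" "B \<subseteq> {0<..t}"
    from measurable_conf_filt_space[OF measurable_card_filt[OF this]]
    show "(\<lambda>\<Phi>. card (\<Phi> \<inter> B)) \<in> measurable point_law (count_space UNIV)"
      by (simp only: measurable_cong_sets[OF sets_point_law refl])
  qed
  moreover have "predictable point_law conf_filt intens"
    unfolding predictable_def predictable_sigma_eq_pred_space[OF space_point_law]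
    by (rule measurable_cong[THEN iffD2, OF _ intensity_predictable]) (auto simp: intens)
  moreover have "set_integrable lborel {0..t} (\<lambda>s. intens s \<Phi>)" if "\<Phi> \<in> space point_law" "0 \<le> t" for \<Phi> t
  proof -
    have "indicat_real {0..t} s *\<^sub>R intens s \<Phi> = indicat_real {0..t} s *\<^sub>R intensity s \<Phi>" for s
      by (simp add: indicator_def intens)
    with intensity_set_integrable[of \<Phi> t] that show ?thesis
      unfolding set_integrable_def space_point_law by (simp only:)
  qed
  moreover have "is_compensator point_law conf_filt (\<lambda>t \<Phi>. real (counting (\<lambda>\<Phi>. \<Phi>) t \<Phi>))
      (\<lambda>t \<Phi>. LINT s:{0..t}|lborel. intens s \<Phi>)"
    unfolding A counting_id by (rule C.is_compensator_comp)
  ultimately show ?thesis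
    unfolding hawkes_process_def Let_def F intens_def[symmetric] by blast
qed

end

text \<open>
  Splitting \<open>(u - s)\<^sup>n\<close> by the binomial theorem separates the time \<open>u\<close> from the initial points \<open>s\<close>;
  the integrals over the latter are the coordinates of \<open>x0\<close>.
\<close>

lemma initial_intensity:
  assumes int: "\<And>i k. i \<in> {1..L} \<Longrightarrow> k \<le> n i \<Longrightarrow>
      set_integrable \<eta> {..0} (\<lambda>s. c i * exp (\<alpha> i * s) * (- s) ^ (n i - k) / fact (n i - k))"
    and x0: "\<And>i k. i \<in> {1..L} \<Longrightarrow> k \<le> n i \<Longrightarrow>
      x0 i k = (LINT s:{..0}|\<eta>. c i * exp (\<alpha> i * s) * (- s) ^ (n i - k) / fact (n i - k))"
  shows "(LINT s:{..0}|\<eta>. erlang_kernel L n \<alpha> c (u - s)) = flow_sum L n \<alpha> u x0"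
proof -
  define g where "g i k s = c i * exp (\<alpha> i * s) * (- s) ^ (n i - k) / fact (n i - k)" for i k s
  have g_int: "integrable \<eta> (\<lambda>s. indicat_real {..0} s *\<^sub>R g i k s)" if "i \<in> {1..L}" "k \<le> n i" for i k
    using int[OF that] by (simp add: set_integrable_def g_def)
  have split: "erlang_kernel L n \<alpha> c (u - s) =
      (\<Sum>i = 1..L. \<Sum>k = 0..n i. exp (- \<alpha> i * u) * (u ^ k / fact k) * g i k s)" for s
  proof -
    have "c i * exp (- \<alpha> i * (u - s)) * (u - s) ^ n i / fact (n i) =
        (\<Sum>k = 0..n i. exp (- \<alpha> i * u) * (u ^ k / fact k) * g i k s)" for i
    proof -
      have "exp (- \<alpha> i * (u - s)) = exp (- \<alpha> i * u) * exp (\<alpha> i * s)"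
        by (simp add: exp_add[symmetric] algebra_simps)
      then have "c i * exp (- \<alpha> i * (u - s)) * (u - s) ^ n i / fact (n i) =
          exp (- \<alpha> i * u) * (c i * exp (\<alpha> i * s)) * ((u + - s) ^ n i / fact (n i))"
        by simp
      also have "\<dots> = (\<Sum>k = 0..n i. exp (- \<alpha> i * u) * (c i * exp (\<alpha> i * s)) *
          ((u ^ k / fact k) * ((- s) ^ (n i - k) / fact (n i - k))))"
        unfolding binomial_fact_split by (rule sum_distrib_left)
      also have "\<dots> = (\<Sum>k = 0..n i. exp (- \<alpha> i * u) * (u ^ k / fact k) * g i k s)"
        by (intro sum.cong refl) (simp add: g_def)
      finally show ?thesis .
    qed
    then show ?thesis unfolding erlang_kernel_def by simp
  qed
  have "(LINT s:{..0}|\<eta>. erlang_kernel L n \<alpha> c (u - s)) =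
      (\<integral>s. (\<Sum>i = 1..L. \<Sum>k = 0..n i. exp (- \<alpha> i * u) * (u ^ k / fact k) * (indicat_real {..0} s *\<^sub>R g i k s)) \<partial>\<eta>)"
    unfolding set_lebesgue_integral_def split
    by (intro Bochner_Integration.integral_cong refl) (simp add: sum_distrib_left mult_ac)
  also have "\<dots> = (\<Sum>i = 1..L. \<Sum>k = 0..n i. exp (- \<alpha> i * u) * (u ^ k / fact k) * (\<integral>s. indicat_real {..0} s *\<^sub>R g i k s \<partial>\<eta>))"
    using g_int
    by (subst Bochner_Integration.integral_sum; (intro Bochner_Integration.integrable_sum integrable_mult_right sum.cong refl)?)
       (auto simp: Bochner_Integration.integral_sum)
  also have "\<dots> = (\<Sum>i = 1..L. \<Sum>k = 0..n i. exp (- \<alpha> i * u) * (u ^ k / fact k) * x0 i k)"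
    by (intro sum.cong refl) (simp add: x0 g_def set_lebesgue_integral_def)
  also have "\<dots> = flow_sum L n \<alpha> u x0"
    by (simp add: flow_sum_def flow_def sum_distrib_left mult.assoc)
  finally show ?thesis .
qed

lemma subalgebra_pair:
  assumes "subalgebra M N" "subalgebra M' N'"
  shows "subalgebra (M \<Otimes>\<^sub>M M') (N \<Otimes>\<^sub>M N')"
proof -
  have "id \<in> measurable (M \<Otimes>\<^sub>M M') (N \<Otimes>\<^sub>M N')"
  proof -
    have "(\<lambda>w. (fst w, snd w)) \<in> measurable (M \<Otimes>\<^sub>M M') (N \<Otimes>\<^sub>M N')"
      by (intro measurable_Pair measurable_compose[OF measurable_fst measurable_from_subalg[OF assms(1)]]
          measurable_compose[OF measurable_snd measurable_from_subalg[OF assms(2)]] measurable_ident_sets refl)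
    then show ?thesis by (simp add: id_def)
  qed
  moreover have "space (N \<Otimes>\<^sub>M N') = space (M \<Otimes>\<^sub>M M')"
    using assms by (simp add: space_pair_measure subalgebra_def)
  ultimately show ?thesis
    using sets.sets_into_space[of _ "N \<Otimes>\<^sub>M N'"]
    by (fastforce simp: subalgebra_def measurable_def Int_absorb2)
qed

lemma subalgebra_refl: "subalgebra M M"
  by (simp add: subalgebra_def)

section \<open>The draws before a given draw\<close>

lemma space_past[simp]: "space (past M \<tau> a U b) = space M"
  by (simp add: past_def space_measure_of_conv)

lemma sets_past: "sets (past M \<tau> a U b) = sigma_sets (space M)
    ({\<tau> i -` B \<inter> space M | i B. i < a \<and> B \<in> sets borel} \<union>
     {U i -` B \<inter> space M | i B. i < b \<and> B \<in> sets borel})"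
  unfolding past_def by (rule sets_measure_of) auto

lemma subalgebra_past:
  assumes "\<And>i. \<tau> i \<in> borel_measurable M" "\<And>i. U i \<in> borel_measurable M"
  shows "subalgebra M (past M \<tau> a U b)"
  unfolding subalgebra_def space_past sets_past
  using assms by (intro conjI refl sets.sigma_sets_subset) (auto intro: measurable_sets)

lemma past_mono: "a \<le> a' \<Longrightarrow> b \<le> b' \<Longrightarrow> subalgebra (past M \<tau> a' U b') (past M \<tau> a U b)"
  unfolding subalgebra_def space_past sets_past
  by (intro conjI refl sigma_sets_mono') (auto, (metis order_less_le_trans)+)

lemma measurable_past_wait: "i < a \<Longrightarrow> \<tau> i \<in> borel_measurable (past M \<tau> a U b)"
  by (intro measurableI) (auto simp: sets_past intro!: sigma_sets.Basic)

lemma measurable_past_mark: "i < b \<Longrightarrow> U i \<in> borel_measurable (past M \<tau> a U b)"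
  by (intro measurableI) (auto simp: sets_past intro!: sigma_sets.Basic)

lemma emeasure_exp_law:
  assumes "0 < r" "B \<in> sets borel"
  shows "emeasure (exp_law r) (real_of_ereal -` B) = (\<integral>\<^sup>+y\<in>B. ennreal (exponential_density r y) \<partial>lborel)"
proof -
  have B: "real_of_ereal -` B \<in> sets borel"
    using measurable_sets[OF borel_measurable_real_of_ereal[OF measurable_ident_sets[OF refl]] assms(2)] by simp
  have "emeasure (exp_law r) (real_of_ereal -` B) =
      emeasure (density lborel (\<lambda>x. ennreal (exponential_density r x))) (ereal -` (real_of_ereal -` B) \<inter> space lborel)"
    using assms(1) B by (simp add: exp_law_def emeasure_distr)
  also have "ereal -` (real_of_ereal -` B) \<inter> space lborel = B" by auto
  also have "emeasure (density lborel (\<lambda>x. ennreal (exponential_density r x))) B = (\<integral>\<^sup>+y\<in>B. ennreal (exponential_density r y) \<partial>lborel)"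
    using assms(2) by (simp add: emeasure_density)
  finally show ?thesis .
qed

lemma emeasure_uniform_unit:
  assumes "B \<in> sets borel"
  shows "emeasure (uniform_measure lborel {0..1::real}) B = (\<integral>\<^sup>+v\<in>B. indicator {0..1} v \<partial>lborel)"
proof -
  have "(\<integral>\<^sup>+v\<in>B. indicator {0..1} v \<partial>lborel) = (\<integral>\<^sup>+v. indicator ({0..1} \<inter> B) v \<partial>lborel)"
    by (intro nn_integral_cong) (auto simp: indicator_def)
  then show ?thesis using assms by (simp add: emeasure_uniform_measure divide_ennreal_def)
qed

section \<open>The coupled candidate process\<close>

definition exp_draws :: "(nat \<Rightarrow> real) measure" where
  "exp_draws = PiM UNIV (\<lambda>_. density lborel (\<lambda>x. ennreal (exponential_density 1 x)))"

definition uniform_draws :: "(nat \<Rightarrow> real) measure" where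
  "uniform_draws = PiM UNIV (\<lambda>_. density lborel (indicator {0..1}))"

lemma prob_exp_density: "prob_space (density lborel (\<lambda>x. ennreal (exponential_density 1 x)))"
  by (rule prob_space_exponential_density) simp

lemma prob_uniform_density: "prob_space (density lborel (indicator {0..1::real}))"
  by (rule prob_spaceI) (simp add: emeasure_density)

lemma prob_exp_draws: "prob_space exp_draws"
proof -
  interpret product_prob_space "\<lambda>_::nat. density lborel (\<lambda>x. ennreal (exponential_density 1 x))" UNIV
    unfolding product_prob_space_def product_prob_space_axioms_def product_sigma_finite_def
    using prob_exp_density prob_space_imp_sigma_finite by blast
  show ?thesis unfolding exp_draws_def by (rule P.prob_space_axioms)
qed

lemma prob_uniform_draws: "prob_space uniform_draws"
proof -
  interpret product_prob_space "\<lambda>_::nat. density lborel (indicator {0..1::real})" UNIV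
    unfolding product_prob_space_def product_prob_space_axioms_def product_sigma_finite_def
    using prob_uniform_density prob_space_imp_sigma_finite by blast
  show ?thesis unfolding uniform_draws_def by (rule P.prob_space_axioms)
qed

lemma sets_draws:
  "sets exp_draws = sets (PiM UNIV (\<lambda>_::nat. borel :: real measure))"
  "sets uniform_draws = sets (PiM UNIV (\<lambda>_::nat. borel :: real measure))"
  unfolding exp_draws_def uniform_draws_def by (intro sets_PiM_cong; simp)+

lemma space_draws[simp]: "space exp_draws = UNIV" "space uniform_draws = UNIV"
  using sets_draws[THEN sets_eq_imp_space_eq] by (simp_all add: space_PiM)

text \<open>
  A point of the product space \<open>\<Omega>\<close> below consists of an outcome of the given draws, a sequence
  of standard exponential variables and a sequence of uniform variables.
\<close>

locale coupling = hawkes_params L n \<alpha> f a b for L n \<alpha> f a b +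
  fixes c :: "nat \<Rightarrow> real" and x0 :: vec and T :: real
    and M :: "'w measure" and \<tau> :: "nat \<Rightarrow> 'w \<Rightarrow> ereal" and U :: "nat \<Rightarrow> 'w \<Rightarrow> real"
  assumes T_pos: "0 < T" and valid: "valid_draws f L n \<alpha> c T x0 M \<tau> U"
begin

abbreviation "run m j \<equiv> loop_run f L n \<alpha> c T x0 (\<lambda>i. \<tau> i m) (\<lambda>i. U i m) j"

lemma prob_M: "prob_space M"
  using valid by (simp add: valid_draws_def)

lemma wait_law: "has_cond_law M (past M \<tau> j U j) {m. clock (run m j) < ereal T} (\<tau> j)
    (\<lambda>m. exp_law (rate (pos (run m j))))"
  using valid by (simp add: valid_draws_def Let_def)

lemma mark_law: "has_cond_law M (past M \<tau> (Suc j) U j)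
    {m. clock (run m j) < ereal T \<and> \<tau> j m \<le> ereal T - clock (run m j)} (U j)
    (\<lambda>m. uniform_measure lborel {0..1})"
  using valid by (simp add: valid_draws_def Let_def)

lemma draws_measurable: "\<tau> j \<in> borel_measurable M" "U j \<in> borel_measurable M"
  using wait_law[of j] mark_law[of j] by (simp_all add: has_cond_law_def)

definition \<Omega> :: "('w \<times> (nat \<Rightarrow> real) \<times> (nat \<Rightarrow> real)) measure" where
  "\<Omega> = M \<Otimes>\<^sub>M (exp_draws \<Otimes>\<^sub>M uniform_draws)"

text \<open>
  Before the horizon the wait is that of the algorithm; afterwards a fresh exponential
  variable is scaled to the current rate. The value \<open>T + 1\<close> replaces the wait \<open>\<infinity>\<close> at rate 0, and
  waits at a positive rate that are infinite or not positive, which are null events. As it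
  always leads beyond the horizon, the coupled process keeps to the draws that the algorithm
  has made, for every outcome.
\<close>

definition wait :: "vec \<Rightarrow> real \<Rightarrow> ereal \<Rightarrow> real \<Rightarrow> real" where
  "wait x D t e = (let w = (if D < T then real_of_ereal t else e / rate x) in
     if 0 < rate x \<and> 0 < w then w else T + 1)"

text \<open>
  A draw \<open>u\<close> of the algorithm is made only if the candidate itself comes no later than the
  horizon.
\<close>

definition mark :: "real \<Rightarrow> real \<Rightarrow> real \<Rightarrow> real \<Rightarrow> real" where
  "mark D w u v = (if D < T \<and> D + w \<le> T then u else v)"

primrec chain :: "nat \<Rightarrow> 'w \<times> (nat \<Rightarrow> real) \<times> (nat \<Rightarrow> real) \<Rightarrow> vec \<times> real" where
  "chain 0 \<omega> = (x0, 0)"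
| "chain (Suc j) \<omega> = (let x = fst (chain j \<omega>); D = snd (chain j \<omega>);
      w = wait x D (\<tau> j (fst \<omega>)) (fst (snd \<omega>) j);
      v = mark D w (U j (fst \<omega>)) (snd (snd \<omega>) j);
      y = flow n \<alpha> w x
    in (if v \<le> f (flow_sum L n \<alpha> w x) / rate x then kick L n c y else y, D + w))"

definition X :: "nat \<Rightarrow> 'w \<times> (nat \<Rightarrow> real) \<times> (nat \<Rightarrow> real) \<Rightarrow> vec" where
  "X j \<omega> = fst (chain j \<omega>)"

definition D :: "nat \<Rightarrow> 'w \<times> (nat \<Rightarrow> real) \<times> (nat \<Rightarrow> real) \<Rightarrow> real" where
  "D j \<omega> = snd (chain j \<omega>)"

definition W :: "nat \<Rightarrow> 'w \<times> (nat \<Rightarrow> real) \<times> (nat \<Rightarrow> real) \<Rightarrow> real" where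
  "W j \<omega> = wait (X j \<omega>) (D j \<omega>) (\<tau> j (fst \<omega>)) (fst (snd \<omega>) j)"

definition V :: "nat \<Rightarrow> 'w \<times> (nat \<Rightarrow> real) \<times> (nat \<Rightarrow> real) \<Rightarrow> real" where
  "V j \<omega> = mark (D j \<omega>) (W j \<omega>) (U j (fst \<omega>)) (snd (snd \<omega>) j)"

lemma chain_simps:
  "X 0 \<omega> = x0" "D 0 \<omega> = 0" "D (Suc j) \<omega> = D j \<omega> + W j \<omega>"
  "X (Suc j) \<omega> = (if V j \<omega> \<le> f (flow_sum L n \<alpha> (W j \<omega>) (X j \<omega>)) / rate (X j \<omega>)
       then kick L n c (flow n \<alpha> (W j \<omega>) (X j \<omega>)) else flow n \<alpha> (W j \<omega>) (X j \<omega>))"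
  by (simp_all add: X_def D_def W_def V_def Let_def)

lemma wait_pos: "0 < wait x d t e"
  using T_pos by (simp add: wait_def Let_def)

lemma W_pos: "0 < W j \<omega>"
  unfolding W_def by (rule wait_pos)

lemma D_nonneg: "0 \<le> D j \<omega>"
  by (induction j) (simp_all add: chain_simps W_pos add_nonneg_nonneg less_imp_le)

text \<open>
  A wait that ends before the horizon was drawn by the algorithm, since the substitute \<open>T + 1\<close>
  ends after it.
\<close>

lemma W_before_horizon:
  assumes "D j \<omega> < T" "D j \<omega> + W j \<omega> \<le> T"
  shows "0 < rate (X j \<omega>)" "\<tau> j (fst \<omega>) = ereal (W j \<omega>)"
proof -
  have "W j \<omega> \<noteq> T + 1" using assms D_nonneg[of j \<omega>] by simp
  then have *: "0 < rate (X j \<omega>)" "0 < real_of_ereal (\<tau> j (fst \<omega>))" "W j \<omega> = real_of_ereal (\<tau> j (fst \<omega>))"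
    using assms(1) by (auto simp: W_def wait_def Let_def split: if_splits)
  then show "0 < rate (X j \<omega>)" by simp
  show "\<tau> j (fst \<omega>) = ereal (W j \<omega>)" using *(2,3) by (cases "\<tau> j (fst \<omega>)") auto
qed

text \<open>
  As long as \<open>D j < T\<close>, no substitute \<open>T + 1\<close> has been used, so the two processes agree for every
  outcome and not only almost surely. Hence an event of the past on which \<open>D j < T\<close> is an event
  on which the algorithm makes its \<open>j\<close>-th draw, and there the conditional law of that draw is
  prescribed.
\<close>

lemma loop_run_before_horizon:
  "D j \<omega> < T \<Longrightarrow> clock (run (fst \<omega>) j) = ereal (D j \<omega>) \<and> pos (run (fst \<omega>) j) = X j \<omega>"
proof (induction j)
  case 0 then show ?case by (simp add: chain_simps zero_ereal_def)
next
  case (Suc j)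
  have D: "D j \<omega> < T" "D j \<omega> + W j \<omega> \<le> T" using Suc.prems W_pos[of j \<omega>] by (simp_all add: chain_simps)
  note IH = Suc.IH[OF D(1)]
  note W = W_before_horizon[OF D]
  have "V j \<omega> = U j (fst \<omega>)" using D by (simp add: V_def mark_def)
  then show ?case using IH W D
    by (simp add: loop_body_def Let_def chain_simps flow_sum_def)
qed

section \<open>Measurability of the coupled process\<close>

text \<open>
  Fresh draws are revealed at the same pace as the given ones, so that each is still
  independent of the past when it is used.
\<close>

definition hist :: "nat \<Rightarrow> nat \<Rightarrow> ('w \<times> (nat \<Rightarrow> real) \<times> (nat \<Rightarrow> real)) measure" where
  "hist p q = past M \<tau> p U q \<Otimes>\<^sub>M (coord_alg p \<Otimes>\<^sub>M coord_alg q)"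

lemma subalgebra_hist: "subalgebra \<Omega> (hist p q)"
  unfolding \<Omega>_def hist_def
  by (intro subalgebra_pair subalgebra_past draws_measurable subalgebra_coord_alg sets_draws)

lemma hist_mono: "p \<le> p' \<Longrightarrow> q \<le> q' \<Longrightarrow> subalgebra (hist p' q') (hist p q)"
  unfolding hist_def by (intro subalgebra_pair past_mono coord_alg_mono)

lemma hist_draws:
  "i < p \<Longrightarrow> (\<lambda>\<omega>. \<tau> i (fst \<omega>)) \<in> borel_measurable (hist p q)"
  "i < q \<Longrightarrow> (\<lambda>\<omega>. U i (fst \<omega>)) \<in> borel_measurable (hist p q)"
  "i < p \<Longrightarrow> (\<lambda>\<omega>. fst (snd \<omega>) i) \<in> borel_measurable (hist p q)"
  "i < q \<Longrightarrow> (\<lambda>\<omega>. snd (snd \<omega>) i) \<in> borel_measurable (hist p q)"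
  unfolding hist_def
  by (auto intro: measurable_compose[OF measurable_fst measurable_past_wait]
      measurable_compose[OF measurable_fst measurable_past_mark]
      measurable_compose[OF measurable_compose[OF measurable_snd measurable_fst] measurable_coord_alg]
      measurable_compose[OF measurable_compose[OF measurable_snd measurable_snd] measurable_coord_alg])

lemma wait_measurable:
  assumes [measurable]: "x \<in> measurable N borel" "d \<in> borel_measurable N" "t \<in> borel_measurable N" "e \<in> borel_measurable N"
  shows "(\<lambda>\<omega>. wait (x \<omega>) (d \<omega>) (t \<omega>) (e \<omega>)) \<in> borel_measurable N"
proof -
  have [measurable]: "(\<lambda>\<omega>. rate (x \<omega>)) \<in> borel_measurable N"
    by (rule measurable_compose[OF assms(1) measurable_rate])
  show ?thesis unfolding wait_def Let_def by measurable
qed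

lemma mark_measurable:
  assumes [measurable]: "d \<in> borel_measurable N" "w \<in> borel_measurable N" "u \<in> borel_measurable N" "v \<in> borel_measurable N"
  shows "(\<lambda>\<omega>. mark (d \<omega>) (w \<omega>) (u \<omega>) (v \<omega>)) \<in> borel_measurable N"
  unfolding mark_def by measurable

lemma step_measurable:
  assumes x: "x \<in> measurable N borel" and w: "w \<in> borel_measurable N" and v: "v \<in> borel_measurable N"
  shows "(\<lambda>\<omega>. if v \<omega> \<le> f (flow_sum L n \<alpha> (w \<omega>) (x \<omega>)) / rate (x \<omega>)
       then kick L n c (flow n \<alpha> (w \<omega>) (x \<omega>)) else flow n \<alpha> (w \<omega>) (x \<omega>)) \<in> measurable N borel"
proof (rule measurable_If)
  show "(\<lambda>\<omega>. flow n \<alpha> (w \<omega>) (x \<omega>)) \<in> measurable N borel" by (rule measurable_flow[OF w x])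
  then show "(\<lambda>\<omega>. kick L n c (flow n \<alpha> (w \<omega>) (x \<omega>))) \<in> measurable N borel"
    by (rule measurable_compose[OF _ measurable_kick])
  show "{\<omega> \<in> space N. v \<omega> \<le> f (flow_sum L n \<alpha> (w \<omega>) (x \<omega>)) / rate (x \<omega>)} \<in> sets N"
    by (rule borel_measurable_le[OF v borel_measurable_divide[OF
        measurable_compose[OF measurable_flow_sum[OF w x] f_meas] measurable_compose[OF x measurable_rate]]])
qed

text \<open>
  The state determines the wait, the wait and the state determine the mark, and all three the
  next state: one induction yields the measurability of all of them.
\<close>

lemma chain_measurable: "X j \<in> measurable (hist j j) borel \<and> D j \<in> borel_measurable (hist j j)"
  and W_measurable: "W j \<in> borel_measurable (hist (Suc j) j)"
  and V_measurable: "V j \<in> borel_measurable (hist (Suc j) (Suc j))"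
proof -
  have W: "W j \<in> borel_measurable (hist (Suc j) j)"
    if "X j \<in> measurable (hist j j) borel \<and> D j \<in> borel_measurable (hist j j)" for j
    unfolding W_def[abs_def] using that
    by (intro wait_measurable hist_draws) (auto intro: measurable_from_subalg[OF hist_mono[of j "Suc j" j j]])
  have V: "V j \<in> borel_measurable (hist (Suc j) (Suc j))"
    if "X j \<in> measurable (hist j j) borel \<and> D j \<in> borel_measurable (hist j j)" for j
    unfolding V_def[abs_def] using that W[OF that]
    by (intro mark_measurable hist_draws)
       (auto intro: measurable_from_subalg[OF hist_mono[of j "Suc j" j "Suc j"]]
          measurable_from_subalg[OF hist_mono[of "Suc j" "Suc j" j "Suc j"]])
  show *: "X j \<in> measurable (hist j j) borel \<and> D j \<in> borel_measurable (hist j j)" for j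
  proof (induction j)
    case 0
    have "X 0 = (\<lambda>_. x0)" "D 0 = (\<lambda>_. 0)" by (simp_all add: chain_simps fun_eq_iff)
    then show ?case by simp
  next
    case (Suc j)
    have m: "X j \<in> measurable (hist (Suc j) (Suc j)) borel" "D j \<in> borel_measurable (hist (Suc j) (Suc j))"
      "W j \<in> borel_measurable (hist (Suc j) (Suc j))"
      using Suc W[OF Suc] measurable_from_subalg[OF hist_mono[of j "Suc j" j "Suc j"]]
        measurable_from_subalg[OF hist_mono[of "Suc j" "Suc j" j "Suc j"]] by auto
    show ?case
      unfolding chain_simps[abs_def] using step_measurable[OF m(1,3) V[OF Suc]] m(2,3) by auto
  qed
  show "W j \<in> borel_measurable (hist (Suc j) j)" by (rule W[OF *])
  show "V j \<in> borel_measurable (hist (Suc j) (Suc j))" by (rule V[OF *])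
qed

end

lemma exponential_density_measurable:
  assumes [measurable]: "r \<in> borel_measurable N" "y \<in> borel_measurable N"
  shows "(\<lambda>w. exponential_density (r w) (y w)) \<in> borel_measurable N"
  unfolding exponential_density_def by measurable

lemma nn_integral_exponential_scale:
  fixes \<beta> :: "real \<Rightarrow> ennreal"
  assumes \<beta>[measurable]: "\<beta> \<in> borel_measurable borel" and r: "0 < r"
  shows "(\<integral>\<^sup>+y. \<beta> (y / r) * ennreal (exponential_density 1 y) \<partial>lborel) =
    (\<integral>\<^sup>+y. \<beta> y * ennreal (exponential_density r y) \<partial>lborel)"
proof -
  have dens: "ennreal r * ennreal (exponential_density 1 (r * y)) = ennreal (exponential_density r y)" for y
    using r by (auto simp: exponential_density_def ennreal_mult[symmetric] mult_less_0_iff mult.commute)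
  have "(\<integral>\<^sup>+y. \<beta> (y / r) * ennreal (exponential_density 1 y) \<partial>lborel) =
      ennreal \<bar>r\<bar> * (\<integral>\<^sup>+y. \<beta> ((0 + r * y) / r) * ennreal (exponential_density 1 (0 + r * y)) \<partial>lborel)"
    by (rule nn_integral_real_affine) (use r in auto)
  also have "\<dots> = ennreal r * (\<integral>\<^sup>+y. \<beta> y * ennreal (exponential_density 1 (r * y)) \<partial>lborel)"
    using r by simp
  also have "\<dots> = (\<integral>\<^sup>+y. ennreal r * (\<beta> y * ennreal (exponential_density 1 (r * y))) \<partial>lborel)"
    by (rule nn_integral_cmult[symmetric]) simp
  also have "\<dots> = (\<integral>\<^sup>+y. \<beta> y * ennreal (exponential_density r y) \<partial>lborel)"
    by (simp only: mult.left_commute[of "ennreal r"] dens)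
  finally show ?thesis .
qed

text \<open>
  The density vanishes below 0, and 0 itself is a null set.
\<close>

lemma nn_integral_exponential_positive:
  fixes \<phi> :: "real \<Rightarrow> ennreal"
  shows "(\<integral>\<^sup>+y. \<phi> (if 0 < y then y else z) * ennreal (exponential_density r y) \<partial>lborel) =
    (\<integral>\<^sup>+y. \<phi> y * ennreal (exponential_density r y) \<partial>lborel)"
proof (rule nn_integral_cong_AE)
  show "AE y in lborel. \<phi> (if 0 < y then y else z) * ennreal (exponential_density r y) =
      \<phi> y * ennreal (exponential_density r y)"
    using AE_lborel_singleton[of 0]
    by eventually_elim (auto simp: exponential_density_def not_less le_less)
qed

lemma measurable_positive_part:
  fixes \<beta> :: "real \<Rightarrow> ennreal"
  assumes [measurable]: "\<beta> \<in> borel_measurable borel"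
  shows "(\<lambda>y. \<beta> (if 0 < y then y else z)) \<in> borel_measurable borel"
  by measurable

lemma measurable_restrict_pred:
  fixes g :: "'a \<Rightarrow> ennreal"
  assumes [measurable]: "g \<in> borel_measurable N" "Measurable.pred N Q"
  shows "(\<lambda>w. g w * indicator {w. Q w} w) \<in> borel_measurable N"
  unfolding indicator_def mem_Collect_eq by measurable

lemma pair_lborel: "borel_measurable (N \<Otimes>\<^sub>M lborel) = borel_measurable (N \<Otimes>\<^sub>M borel)"
  by (intro measurable_cong_sets sets_pair_measure_cong refl sets_lborel)

lemma pred_horizon:
  fixes d w :: "'a \<Rightarrow> real"
  assumes [measurable]: "d \<in> borel_measurable N" "w \<in> borel_measurable N"
  shows "Measurable.pred N (\<lambda>x. d x < t \<and> d x + w x \<le> t)"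
    and "Measurable.pred N (\<lambda>x. \<not> (d x < t \<and> d x + w x \<le> t))"
    and "Measurable.pred N (\<lambda>x. 0 < w x \<and> d x < t)"
    and "Measurable.pred N (\<lambda>x. 0 < w x \<and> \<not> d x < t)"
    and "Measurable.pred N (\<lambda>x. d x < t)"
    and "Measurable.pred N (\<lambda>x. \<not> d x < t)"
    and "Measurable.pred N (\<lambda>x. 0 < w x)"
  by measurable

context coupling begin

section \<open>The conditional laws of the coupled draws\<close>

text \<open>
  Fubini, with the order of integration chosen so that the factor in question is innermost.
\<close>

lemma nn_integral_eq_by_sections:
  assumes g: "g \<in> borel_measurable \<Omega>" "g' \<in> borel_measurable \<Omega>"
  shows nn_integral_eq_by_M: "(\<And>e v. (\<integral>\<^sup>+m. g (m, e, v) \<partial>M) = (\<integral>\<^sup>+m. g' (m, e, v) \<partial>M)) \<Longrightarrow>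
      (\<integral>\<^sup>+\<omega>. g \<omega> \<partial>\<Omega>) = (\<integral>\<^sup>+\<omega>. g' \<omega> \<partial>\<Omega>)" (is "PROP ?M \<Longrightarrow> ?eq")
    and nn_integral_eq_by_exp_draws: "(\<And>m v. m \<in> space M \<Longrightarrow>
      (\<integral>\<^sup>+e. g (m, e, v) \<partial>exp_draws) = (\<integral>\<^sup>+e. g' (m, e, v) \<partial>exp_draws)) \<Longrightarrow>
      (\<integral>\<^sup>+\<omega>. g \<omega> \<partial>\<Omega>) = (\<integral>\<^sup>+\<omega>. g' \<omega> \<partial>\<Omega>)" (is "PROP ?E \<Longrightarrow> _")
    and nn_integral_eq_by_uniform_draws: "(\<And>m e. m \<in> space M \<Longrightarrow>
      (\<integral>\<^sup>+v. g (m, e, v) \<partial>uniform_draws) = (\<integral>\<^sup>+v. g' (m, e, v) \<partial>uniform_draws)) \<Longrightarrow>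
      (\<integral>\<^sup>+\<omega>. g \<omega> \<partial>\<Omega>) = (\<integral>\<^sup>+\<omega>. g' \<omega> \<partial>\<Omega>)" (is "PROP ?V \<Longrightarrow> _")
proof -
  interpret M: prob_space M by (rule prob_M)
  interpret E: prob_space exp_draws by (rule prob_exp_draws)
  interpret V: prob_space uniform_draws by (rule prob_uniform_draws)
  interpret EV: pair_prob_space exp_draws uniform_draws ..
  interpret \<Omega>: pair_sigma_finite M "exp_draws \<Otimes>\<^sub>M uniform_draws" ..
  have g': "g \<in> borel_measurable (M \<Otimes>\<^sub>M (exp_draws \<Otimes>\<^sub>M uniform_draws))"
    "g' \<in> borel_measurable (M \<Otimes>\<^sub>M (exp_draws \<Otimes>\<^sub>M uniform_draws))"
    using g by (simp_all add: \<Omega>_def)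
  have slice: "(\<lambda>w. k (m, w)) \<in> borel_measurable (exp_draws \<Otimes>\<^sub>M uniform_draws)"
    if "k \<in> borel_measurable (M \<Otimes>\<^sub>M (exp_draws \<Otimes>\<^sub>M uniform_draws))" "m \<in> space M" for k :: "_ \<Rightarrow> ennreal" and m
    by (rule measurable_compose[OF measurable_Pair1'[OF that(2)] that(1)])
  show "?eq" if *: "PROP ?M"
  proof -
    have "(\<integral>\<^sup>+\<omega>. k \<omega> \<partial>\<Omega>) = (\<integral>\<^sup>+w. (\<integral>\<^sup>+m. k (m, fst w, snd w) \<partial>M) \<partial>(exp_draws \<Otimes>\<^sub>M uniform_draws))"
      if "k \<in> borel_measurable (M \<Otimes>\<^sub>M (exp_draws \<Otimes>\<^sub>M uniform_draws))" for k :: "_ \<Rightarrow> ennreal"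
      unfolding \<Omega>_def using \<Omega>.nn_integral_snd[of k] that by simp
    then show ?thesis using g' by (simp only: *)
  qed
  show "?eq" if *: "PROP ?E"
  proof -
    have "(\<integral>\<^sup>+\<omega>. k \<omega> \<partial>\<Omega>) = (\<integral>\<^sup>+m. (\<integral>\<^sup>+v. (\<integral>\<^sup>+e. k (m, e, v) \<partial>exp_draws) \<partial>uniform_draws) \<partial>M)"
      if k: "k \<in> borel_measurable (M \<Otimes>\<^sub>M (exp_draws \<Otimes>\<^sub>M uniform_draws))" for k :: "_ \<Rightarrow> ennreal"
    proof -
      have "(\<integral>\<^sup>+\<omega>. k \<omega> \<partial>\<Omega>) = (\<integral>\<^sup>+m. (\<integral>\<^sup>+w. k (m, w) \<partial>(exp_draws \<Otimes>\<^sub>M uniform_draws)) \<partial>M)"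
        unfolding \<Omega>_def by (rule EV.P.nn_integral_fst[OF k, symmetric])
      also have "\<dots> = (\<integral>\<^sup>+m. (\<integral>\<^sup>+v. (\<integral>\<^sup>+e. k (m, e, v) \<partial>exp_draws) \<partial>uniform_draws) \<partial>M)"
        using slice[OF k] by (intro nn_integral_cong EV.nn_integral_snd[symmetric]) (simp add: case_prod_unfold)
      finally show ?thesis .
    qed
    note rep = this
    show ?thesis unfolding rep[OF g'(1)] rep[OF g'(2)]
      by (rule nn_integral_cong, rule nn_integral_cong, rule *)
  qed
  show "?eq" if *: "PROP ?V"
  proof -
    have "(\<integral>\<^sup>+\<omega>. k \<omega> \<partial>\<Omega>) = (\<integral>\<^sup>+m. (\<integral>\<^sup>+e. (\<integral>\<^sup>+v. k (m, e, v) \<partial>uniform_draws) \<partial>exp_draws) \<partial>M)"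
      if k: "k \<in> borel_measurable (M \<Otimes>\<^sub>M (exp_draws \<Otimes>\<^sub>M uniform_draws))" for k :: "_ \<Rightarrow> ennreal"
    proof -
      have "(\<integral>\<^sup>+\<omega>. k \<omega> \<partial>\<Omega>) = (\<integral>\<^sup>+m. (\<integral>\<^sup>+w. k (m, w) \<partial>(exp_draws \<Otimes>\<^sub>M uniform_draws)) \<partial>M)"
        unfolding \<Omega>_def by (rule EV.P.nn_integral_fst[OF k, symmetric])
      also have "\<dots> = (\<integral>\<^sup>+m. (\<integral>\<^sup>+e. (\<integral>\<^sup>+v. k (m, e, v) \<partial>uniform_draws) \<partial>exp_draws) \<partial>M)"
        using slice[OF k] by (intro nn_integral_cong V.nn_integral_fst[symmetric])
      finally show ?thesis .
    qed
    note rep = this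
    show ?thesis unfolding rep[OF g'(1)] rep[OF g'(2)]
      by (rule nn_integral_cong, rule nn_integral_cong, rule *)
  qed
qed

lemma hist_slices:
  "(\<lambda>m. (m, e, v)) \<in> measurable (past M \<tau> p U q) (hist p q)"
  "m \<in> space M \<Longrightarrow> (\<lambda>e. (m, e, v)) \<in> measurable (coord_alg p) (hist p q)"
  "m \<in> space M \<Longrightarrow> (\<lambda>v. (m, e, v)) \<in> measurable (coord_alg q) (hist p q)"
  unfolding hist_def by (auto intro!: measurable_Pair)

lemma measurable_hist: "g \<in> measurable (hist p q) N \<Longrightarrow> g \<in> measurable \<Omega> N"
  by (rule measurable_from_subalg[OF subalgebra_hist])

lemma measurable_hist_pair:
  "\<psi> \<in> borel_measurable (hist p q \<Otimes>\<^sub>M borel) \<Longrightarrow> \<psi> \<in> borel_measurable (\<Omega> \<Otimes>\<^sub>M borel)"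
  by (rule measurable_from_subalg[OF subalgebra_pair[OF subalgebra_hist subalgebra_refl]])

lemma nn_integral_split_on:
  assumes [measurable]: "g \<in> borel_measurable \<Omega>" "Measurable.pred \<Omega> Q"
  shows "(\<integral>\<^sup>+\<omega>. g \<omega> \<partial>\<Omega>) = (\<integral>\<^sup>+\<omega>. g \<omega> * indicator {\<omega>. Q \<omega>} \<omega> \<partial>\<Omega>) + (\<integral>\<^sup>+\<omega>. g \<omega> * indicator {\<omega>. \<not> Q \<omega>} \<omega> \<partial>\<Omega>)"
proof -
  have [measurable]: "(\<lambda>\<omega>. g \<omega> * indicator {\<omega>. Q \<omega>} \<omega>) \<in> borel_measurable \<Omega>"
    "(\<lambda>\<omega>. g \<omega> * indicator {\<omega>. \<not> Q \<omega>} \<omega>) \<in> borel_measurable \<Omega>"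
    unfolding indicator_def mem_Collect_eq by measurable
  show ?thesis
    by (subst nn_integral_add[symmetric]) (auto intro!: nn_integral_cong simp: indicator_def)
qed

text \<open>
  Before the horizon the fresh draws are held fixed: sections of the past are events of the
  past of the given draws, and the prescribed law of the algorithm's wait applies. After the
  horizon the given draws are held fixed and the fresh exponential variable is independent of
  its predecessors.
\<close>

lemma wait_cond_law:
  assumes \<psi>: "\<psi> \<in> borel_measurable (hist j j \<Otimes>\<^sub>M borel)"
  shows "(\<integral>\<^sup>+\<omega>\<in>{\<omega>. 0 < rate (X j \<omega>)}. \<psi> (\<omega>, W j \<omega>) \<partial>\<Omega>) =
    (\<integral>\<^sup>+\<omega>\<in>{\<omega>. 0 < rate (X j \<omega>)}. (\<integral>\<^sup>+y. \<psi> (\<omega>, y) * ennreal (exponential_density (rate (X j \<omega>)) y) \<partial>lborel) \<partial>\<Omega>)"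
proof -
  have XD: "X j \<in> measurable (hist j j) borel" "D j \<in> borel_measurable (hist j j)"
    using chain_measurable by auto
  have rate_meas: "(\<lambda>\<omega>. rate (X j \<omega>)) \<in> borel_measurable (hist j j)"
    by (rule measurable_compose[OF XD(1) measurable_rate])
  have W_meas: "W j \<in> borel_measurable \<Omega>"
    by (rule measurable_hist[OF W_measurable])
  define I where "I \<omega> = (\<integral>\<^sup>+y. \<psi> (\<omega>, y) * ennreal (exponential_density (rate (X j \<omega>)) y) \<partial>lborel)" for \<omega>
  have I: "I \<in> borel_measurable \<Omega>"
  proof -
    have "(\<lambda>w. exponential_density (rate (X j (fst w))) (snd w)) \<in> borel_measurable (\<Omega> \<Otimes>\<^sub>M borel)"
      by (rule exponential_density_measurable[OF measurable_compose[OF measurable_fst measurable_hist[OF rate_meas]] measurable_snd])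
    from borel_measurable_times_ennreal[OF measurable_hist_pair[OF \<psi>] measurable_compose[OF this measurable_ennreal]]
    have "(\<lambda>(\<omega>, y). \<psi> (\<omega>, y) * ennreal (exponential_density (rate (X j \<omega>)) y)) \<in> borel_measurable (\<Omega> \<Otimes>\<^sub>M lborel)"
      by (simp only: case_prod_unfold prod.collapse pair_lborel)
    then show ?thesis unfolding I_def[abs_def] by (rule lborel.borel_measurable_nn_integral)
  qed
  define g where "g \<omega> = \<psi> (\<omega>, W j \<omega>) * indicator {\<omega>. 0 < rate (X j \<omega>)} \<omega>" for \<omega>
  define g' where "g' \<omega> = I \<omega> * indicator {\<omega>. 0 < rate (X j \<omega>)} \<omega>" for \<omega>
  have \<psi>W: "(\<lambda>\<omega>. \<psi> (\<omega>, W j \<omega>)) \<in> borel_measurable \<Omega>"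
    by (rule measurable_compose[OF measurable_Pair[OF measurable_ident_sets[OF refl] W_meas] measurable_hist_pair[OF \<psi>]])
  have g: "g \<in> borel_measurable \<Omega>" "g' \<in> borel_measurable \<Omega>"
    unfolding g_def[abs_def] g'_def[abs_def]
    by (rule measurable_restrict_pred[OF \<psi>W pred_horizon(7)[OF measurable_hist[OF XD(2)] measurable_hist[OF rate_meas]]],
        rule measurable_restrict_pred[OF I pred_horizon(7)[OF measurable_hist[OF XD(2)] measurable_hist[OF rate_meas]]])
  have gi: "(\<lambda>\<omega>. g \<omega> * indicator {\<omega>. D j \<omega> < T} \<omega>) \<in> borel_measurable \<Omega>"
    "(\<lambda>\<omega>. g' \<omega> * indicator {\<omega>. D j \<omega> < T} \<omega>) \<in> borel_measurable \<Omega>"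
    "(\<lambda>\<omega>. g \<omega> * indicator {\<omega>. \<not> D j \<omega> < T} \<omega>) \<in> borel_measurable \<Omega>"
    "(\<lambda>\<omega>. g' \<omega> * indicator {\<omega>. \<not> D j \<omega> < T} \<omega>) \<in> borel_measurable \<Omega>"
    by (intro measurable_restrict_pred g pred_horizon(5,6)[OF measurable_hist[OF XD(2)] measurable_hist[OF XD(2)]])+
  have before: "(\<integral>\<^sup>+\<omega>. g \<omega> * indicator {\<omega>. D j \<omega> < T} \<omega> \<partial>\<Omega>) = (\<integral>\<^sup>+\<omega>. g' \<omega> * indicator {\<omega>. D j \<omega> < T} \<omega> \<partial>\<Omega>)"
  proof (rule nn_integral_eq_by_M[OF gi(1,2)])
    fix e v :: "nat \<Rightarrow> real"
    let ?s = "\<lambda>m. (m, e, v)" and ?past = "past M \<tau> j U j"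
    define H where "H = {m \<in> space M. 0 < rate (X j (?s m)) \<and> D j (?s m) < T}"
    define k where "k m y = ennreal (exponential_density (rate (X j (?s m))) y)" for m y
    define \<phi> where "\<phi> w = \<psi> (?s (fst w), if 0 < snd w then snd w else T + 1)" for w
    have s: "?s \<in> measurable ?past (hist j j)" by (rule hist_slices)
    define r d where "r m = rate (X j (?s m))" and "d m = D j (?s m)" for m
    have rd[measurable]: "r \<in> borel_measurable ?past" "d \<in> borel_measurable ?past"
      unfolding r_def[abs_def] d_def[abs_def]
      by (rule measurable_compose[OF s rate_meas], rule measurable_compose[OF s XD(2)])
    have H: "H \<in> sets ?past"
    proof -
      have "{m \<in> space ?past. 0 < r m \<and> d m < T} \<in> sets ?past"
        using pred_horizon(3)[OF rd(2,1), of T] unfolding pred_def .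
      then show ?thesis by (simp only: H_def d_def r_def space_past space_coord_alg UNIV_I simp_thms)
    qed
    have tau: "(\<lambda>m. real_of_ereal (\<tau> j m)) \<in> borel_measurable M"
      using draws_measurable(1)[of j] by measurable
    have "(\<integral>\<^sup>+m\<in>H. \<phi> (m, real_of_ereal (\<tau> j m)) \<partial>M) = (\<integral>\<^sup>+m\<in>H. (\<integral>\<^sup>+y. \<phi> (m, y) * k m y \<partial>lborel) \<partial>M)"
    proof (rule cond_law_nn_integral[OF _ subalgebra_past[OF draws_measurable] tau H])
      show "finite_measure M" using prob_M by (simp add: prob_space_def)
      show "(\<lambda>(m, y). k m y) \<in> borel_measurable (?past \<Otimes>\<^sub>M borel)"
        unfolding k_def case_prod_unfold r_def[symmetric]
        by (intro measurable_compose[OF _ measurable_ennreal] exponential_density_measurable) measurable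
      have "(\<lambda>w. (?s (fst w), if 0 < snd w then snd w else T + 1)) \<in> measurable (?past \<Otimes>\<^sub>M borel) (hist j j \<Otimes>\<^sub>M borel)"
        by (intro measurable_Pair measurable_compose[OF measurable_fst s]) measurable
      from measurable_compose[OF this \<psi>] show "\<phi> \<in> borel_measurable (?past \<Otimes>\<^sub>M borel)"
        by (simp add: \<phi>_def[abs_def])
      fix A and B :: "real set" assume A: "A \<in> sets ?past" "A \<subseteq> H" and B: "B \<in> sets borel"
      have state: "clock (run m j) < ereal T" "pos (run m j) = X j (?s m)" "0 < rate (X j (?s m))" if "m \<in> A" for m
        using that A(2) loop_run_before_horizon[of j "?s m"] by (auto simp: H_def)
      have "real_of_ereal -` B \<in> sets borel"
        using measurable_sets[OF borel_measurable_real_of_ereal[OF measurable_ident_sets[OF refl]] B] by simp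
      then have "emeasure M (A \<inter> \<tau> j -` (real_of_ereal -` B)) =
          (\<integral>\<^sup>+m\<in>A. emeasure (exp_law (rate (pos (run m j)))) (real_of_ereal -` B) \<partial>M)"
        using wait_law[of j] A(1) state(1) unfolding has_cond_law_def by blast
      also have "\<dots> = (\<integral>\<^sup>+m\<in>A. (\<integral>\<^sup>+y\<in>B. k m y \<partial>lborel) \<partial>M)"
        by (intro nn_integral_cong) (auto simp: indicator_def k_def state(2) emeasure_exp_law[OF state(3) B] split: if_splits)
      finally show "emeasure M (A \<inter> (\<lambda>m. real_of_ereal (\<tau> j m)) -` B) = (\<integral>\<^sup>+m\<in>A. (\<integral>\<^sup>+y\<in>B. k m y \<partial>lborel) \<partial>M)"
        by (simp add: vimage_def)
    qed
    moreover have "(\<integral>\<^sup>+m. g (?s m) * indicator {\<omega>. D j \<omega> < T} (?s m) \<partial>M) = (\<integral>\<^sup>+m\<in>H. \<phi> (m, real_of_ereal (\<tau> j m)) \<partial>M)"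
      by (intro nn_integral_cong) (auto simp: g_def H_def \<phi>_def indicator_def W_def wait_def Let_def)
    moreover have "(\<integral>\<^sup>+m. g' (?s m) * indicator {\<omega>. D j \<omega> < T} (?s m) \<partial>M) =
        (\<integral>\<^sup>+m\<in>H. (\<integral>\<^sup>+y. \<phi> (m, y) * k m y \<partial>lborel) \<partial>M)"
    proof (rule nn_integral_cong)
      fix m assume "m \<in> space M"
      moreover have "(\<integral>\<^sup>+y. \<phi> (m, y) * k m y \<partial>lborel) = I (?s m)"
        unfolding \<phi>_def k_def I_def fst_conv snd_conv
        by (rule nn_integral_exponential_positive[of "\<lambda>y. \<psi> (?s m, y)"])
      ultimately show "g' (?s m) * indicator {\<omega>. D j \<omega> < T} (?s m) =
          (\<integral>\<^sup>+y. \<phi> (m, y) * k m y \<partial>lborel) * indicator H m"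
        by (simp add: g'_def H_def indicator_def)
    qed
    ultimately show "(\<integral>\<^sup>+m. g (?s m) * indicator {\<omega>. D j \<omega> < T} (?s m) \<partial>M) =
        (\<integral>\<^sup>+m. g' (?s m) * indicator {\<omega>. D j \<omega> < T} (?s m) \<partial>M)" by simp
  qed
  have after: "(\<integral>\<^sup>+\<omega>. g \<omega> * indicator {\<omega>. \<not> D j \<omega> < T} \<omega> \<partial>\<Omega>) = (\<integral>\<^sup>+\<omega>. g' \<omega> * indicator {\<omega>. \<not> D j \<omega> < T} \<omega> \<partial>\<Omega>)"
  proof (rule nn_integral_eq_by_exp_draws[OF gi(3,4)])
    fix m and v :: "nat \<Rightarrow> real" assume m: "m \<in> space M"
    let ?s = "\<lambda>e. (m, e, v)"
    define H where "H = {e. 0 < rate (X j (?s e)) \<and> \<not> D j (?s e) < T}"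
    define r where "r e = rate (X j (?s e))" for e
    define \<phi> where "\<phi> w = \<psi> (?s (fst w), if 0 < snd w / r (fst w) then snd w / r (fst w) else T + 1) * indicator H (fst w)" for w
    have s: "?s \<in> measurable (coord_alg j) (hist j j)" by (rule hist_slices(2)[OF m])
    define d where "d e = D j (?s e)" for e
    have rd[measurable]: "r \<in> borel_measurable (coord_alg j)" "d \<in> borel_measurable (coord_alg j)"
      unfolding r_def[abs_def] d_def[abs_def]
      by (rule measurable_compose[OF s rate_meas], rule measurable_compose[OF s XD(2)])
    have H[measurable]: "H \<in> sets (coord_alg j)"
    proof -
      have "{e \<in> space (coord_alg j). 0 < r e \<and> \<not> d e < T} \<in> sets (coord_alg j)"
        using pred_horizon(4)[OF rd(2,1), of T] unfolding pred_def .
      then show ?thesis by (simp only: H_def d_def r_def space_past space_coord_alg UNIV_I simp_thms)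
    qed
    have \<phi>: "\<phi> \<in> borel_measurable (coord_alg j \<Otimes>\<^sub>M borel)"
    proof -
      have "(\<lambda>w. (?s (fst w), if 0 < snd w / r (fst w) then snd w / r (fst w) else T + 1)) \<in> measurable (coord_alg j \<Otimes>\<^sub>M borel) (hist j j \<Otimes>\<^sub>M borel)"
        by (intro measurable_Pair measurable_compose[OF measurable_fst s]) measurable
      from measurable_compose[OF this \<psi>]
      have [measurable]: "(\<lambda>w. \<psi> (?s (fst w), if 0 < snd w / r (fst w) then snd w / r (fst w) else T + 1)) \<in> borel_measurable (coord_alg j \<Otimes>\<^sub>M borel)" .
      have [measurable]: "(\<lambda>w. indicator H (fst w) :: ennreal) \<in> borel_measurable (coord_alg j \<Otimes>\<^sub>M borel)"
        by (rule measurable_compose[OF measurable_fst]) simp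
      show ?thesis unfolding \<phi>_def[abs_def] by measurable
    qed
    have "(\<integral>\<^sup>+e. \<phi> (e, e j) \<partial>exp_draws) = (\<integral>\<^sup>+e. (\<integral>\<^sup>+y. \<phi> (e, y) * ennreal (exponential_density 1 y) \<partial>lborel) \<partial>exp_draws)"
      unfolding exp_draws_def by (rule iid_draw[OF _ prob_exp_density \<phi>]) measurable
    moreover have "(\<integral>\<^sup>+e. g (?s e) * indicator {\<omega>. \<not> D j \<omega> < T} (?s e) \<partial>exp_draws) = (\<integral>\<^sup>+e. \<phi> (e, e j) \<partial>exp_draws)"
      by (intro nn_integral_cong) (auto simp: g_def H_def \<phi>_def r_def indicator_def W_def wait_def Let_def)
    moreover have "(\<integral>\<^sup>+e. g' (?s e) * indicator {\<omega>. \<not> D j \<omega> < T} (?s e) \<partial>exp_draws) =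
        (\<integral>\<^sup>+e. (\<integral>\<^sup>+y. \<phi> (e, y) * ennreal (exponential_density 1 y) \<partial>lborel) \<partial>exp_draws)"
    proof (rule nn_integral_cong)
      fix e
      show "g' (?s e) * indicator {\<omega>. \<not> D j \<omega> < T} (?s e) = (\<integral>\<^sup>+y. \<phi> (e, y) * ennreal (exponential_density 1 y) \<partial>lborel)"
      proof (cases "e \<in> H")
        case True
        then have r: "0 < r e" by (simp add: H_def r_def)
        define \<beta> where "\<beta> y = \<psi> (?s e, y)" for y
        have \<beta>: "\<beta> \<in> borel_measurable borel"
        proof -
          have "?s e \<in> space (hist j j)" using m by (simp add: hist_def space_pair_measure)
          from measurable_compose[OF measurable_Pair1'[OF this] \<psi>] show ?thesis by (simp add: \<beta>_def[abs_def])
        qed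
        have "(\<integral>\<^sup>+y. \<phi> (e, y) * ennreal (exponential_density 1 y) \<partial>lborel) =
            (\<integral>\<^sup>+y. \<beta> (if 0 < y / r e then y / r e else T + 1) * ennreal (exponential_density 1 y) \<partial>lborel)"
          unfolding \<phi>_def \<beta>_def fst_conv snd_conv using True by simp
        also have "\<dots> = (\<integral>\<^sup>+y. \<beta> (if 0 < y then y else T + 1) * ennreal (exponential_density (r e) y) \<partial>lborel)"
          by (rule nn_integral_exponential_scale[OF measurable_positive_part[OF \<beta>] r])
        also have "\<dots> = I (?s e)" unfolding nn_integral_exponential_positive by (simp add: I_def \<beta>_def r_def)
        finally show ?thesis using True by (simp add: g'_def H_def)
      qed (auto simp: \<phi>_def g'_def H_def indicator_def)
    qed
    ultimately show "(\<integral>\<^sup>+e. g (?s e) * indicator {\<omega>. \<not> D j \<omega> < T} (?s e) \<partial>exp_draws) =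
        (\<integral>\<^sup>+e. g' (?s e) * indicator {\<omega>. \<not> D j \<omega> < T} (?s e) \<partial>exp_draws)" by simp
  qed
  have pred: "Measurable.pred \<Omega> (\<lambda>\<omega>. D j \<omega> < T)"
    by (rule pred_horizon(5)[OF measurable_hist[OF XD(2)] measurable_hist[OF XD(2)]])
  have "(\<integral>\<^sup>+\<omega>. g \<omega> \<partial>\<Omega>) = (\<integral>\<^sup>+\<omega>. g' \<omega> \<partial>\<Omega>)"
    unfolding nn_integral_split_on[OF g(1) pred] nn_integral_split_on[OF g(2) pred] before after ..
  then show ?thesis by (simp add: g_def g'_def I_def)
qed

text \<open>
  The same two cases, now separated by whether the candidate comes before the horizon.
\<close>

lemma mark_cond_law:
  assumes \<psi>: "\<psi> \<in> borel_measurable (hist (Suc j) j \<Otimes>\<^sub>M borel)"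
  shows "(\<integral>\<^sup>+\<omega>. \<psi> (\<omega>, V j \<omega>) \<partial>\<Omega>) = (\<integral>\<^sup>+\<omega>. (\<integral>\<^sup>+v. \<psi> (\<omega>, v) * indicator {0..1} v \<partial>lborel) \<partial>\<Omega>)"
proof -
  let ?P = "\<lambda>\<omega>. D j \<omega> < T \<and> D j \<omega> + W j \<omega> \<le> T"
  have DW: "D j \<in> borel_measurable (hist (Suc j) j)" "W j \<in> borel_measurable (hist (Suc j) j)"
    using measurable_from_subalg[OF hist_mono[of j "Suc j" j j]] chain_measurable[of j] W_measurable[of j] by auto
  have V_meas: "V j \<in> borel_measurable \<Omega>" by (rule measurable_hist[OF V_measurable])
  define g where "g \<omega> = \<psi> (\<omega>, V j \<omega>)" for \<omega>
  define g' where "g' \<omega> = (\<integral>\<^sup>+v. \<psi> (\<omega>, v) * indicator {0..1} v \<partial>lborel)" for \<omega>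
  have g: "g \<in> borel_measurable \<Omega>"
    unfolding g_def[abs_def]
    by (rule measurable_compose[OF measurable_Pair[OF measurable_ident_sets[OF refl] V_meas] measurable_hist_pair[OF \<psi>]])
  have g': "g' \<in> borel_measurable \<Omega>"
  proof -
    have "(\<lambda>w. indicator {0..1::real} (snd w) :: ennreal) \<in> borel_measurable (\<Omega> \<Otimes>\<^sub>M borel)"
      by (rule measurable_compose[OF measurable_snd borel_measurable_indicator[OF borel_closed[OF closed_atLeastAtMost]]])
    from borel_measurable_times_ennreal[OF measurable_hist_pair[OF \<psi>] this]
    have "(\<lambda>(\<omega>, v). \<psi> (\<omega>, v) * indicator {0..1} v) \<in> borel_measurable (\<Omega> \<Otimes>\<^sub>M lborel)"
      by (simp only: case_prod_unfold prod.collapse pair_lborel)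
    then show ?thesis unfolding g'_def[abs_def] by (rule lborel.borel_measurable_nn_integral)
  qed
  have gi: "(\<lambda>\<omega>. g \<omega> * indicator {\<omega>. ?P \<omega>} \<omega>) \<in> borel_measurable \<Omega>"
    "(\<lambda>\<omega>. g' \<omega> * indicator {\<omega>. ?P \<omega>} \<omega>) \<in> borel_measurable \<Omega>"
    "(\<lambda>\<omega>. g \<omega> * indicator {\<omega>. \<not> ?P \<omega>} \<omega>) \<in> borel_measurable \<Omega>"
    "(\<lambda>\<omega>. g' \<omega> * indicator {\<omega>. \<not> ?P \<omega>} \<omega>) \<in> borel_measurable \<Omega>"
    by (intro measurable_restrict_pred g g' pred_horizon(1,2)[OF measurable_hist[OF DW(1)] measurable_hist[OF DW(2)]])+
  have before: "(\<integral>\<^sup>+\<omega>. g \<omega> * indicator {\<omega>. ?P \<omega>} \<omega> \<partial>\<Omega>) = (\<integral>\<^sup>+\<omega>. g' \<omega> * indicator {\<omega>. ?P \<omega>} \<omega> \<partial>\<Omega>)"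
  proof (rule nn_integral_eq_by_M[OF gi(1,2)])
    fix e v :: "nat \<Rightarrow> real"
    let ?s = "\<lambda>m. (m, e, v)" and ?past = "past M \<tau> (Suc j) U j"
    define H where "H = {m \<in> space M. ?P (?s m)}"
    define \<phi> where "\<phi> w = \<psi> (?s (fst w), snd w)" for w
    have s: "?s \<in> measurable ?past (hist (Suc j) j)" by (rule hist_slices)
    define d w where "d m = D j (?s m)" and "w m = W j (?s m)" for m
    have dw: "d \<in> borel_measurable ?past" "w \<in> borel_measurable ?past"
      unfolding d_def[abs_def] w_def[abs_def]
      by (rule measurable_compose[OF s DW(1)], rule measurable_compose[OF s DW(2)])
    have H: "H \<in> sets ?past"
    proof -
      have "{m \<in> space ?past. d m < T \<and> d m + w m \<le> T} \<in> sets ?past"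
        using pred_horizon(1)[OF dw, of T] unfolding pred_def .
      then show ?thesis by (simp only: H_def d_def w_def space_past space_coord_alg UNIV_I simp_thms)
    qed
    have "(\<integral>\<^sup>+m\<in>H. \<phi> (m, U j m) \<partial>M) = (\<integral>\<^sup>+m\<in>H. (\<integral>\<^sup>+y. \<phi> (m, y) * indicator {0..1} y \<partial>lborel) \<partial>M)"
    proof (rule cond_law_nn_integral[OF _ subalgebra_past[OF draws_measurable] draws_measurable(2) H])
      show "finite_measure M" using prob_M by (simp add: prob_space_def)
      show "(\<lambda>(m, y). indicator {0..1::real} y) \<in> borel_measurable (?past \<Otimes>\<^sub>M borel)"
        unfolding case_prod_unfold by (rule measurable_compose[OF measurable_snd borel_measurable_indicator[OF borel_closed[OF closed_atLeastAtMost]]])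
      have "(\<lambda>w. (?s (fst w), snd w)) \<in> measurable (?past \<Otimes>\<^sub>M borel) (hist (Suc j) j \<Otimes>\<^sub>M borel)"
        by (intro measurable_Pair measurable_compose[OF measurable_fst s]) measurable
      from measurable_compose[OF this \<psi>] show "\<phi> \<in> borel_measurable (?past \<Otimes>\<^sub>M borel)"
        by (simp add: \<phi>_def[abs_def])
      fix A and B :: "real set" assume A: "A \<in> sets ?past" "A \<subseteq> H" and B: "B \<in> sets borel"
      have "m \<in> {m. clock (run m j) < ereal T \<and> \<tau> j m \<le> ereal T - clock (run m j)}" if "m \<in> A" for m
      proof -
        have P: "?P (?s m)" using that A(2) by (auto simp: H_def)
        then show ?thesis
          using loop_run_before_horizon[of j "?s m"] W_before_horizon(2)[of j "?s m"] by simp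
      qed
      then have "A \<subseteq> {m. clock (run m j) < ereal T \<and> \<tau> j m \<le> ereal T - clock (run m j)}" by blast
      then have "emeasure M (A \<inter> U j -` B) = (\<integral>\<^sup>+m\<in>A. emeasure (uniform_measure lborel {0..1}) B \<partial>M)"
        using mark_law[of j] A(1) B unfolding has_cond_law_def by blast
      then show "emeasure M (A \<inter> U j -` B) = (\<integral>\<^sup>+m\<in>A. (\<integral>\<^sup>+y\<in>B. indicator {0..1} y \<partial>lborel) \<partial>M)"
        by (simp only: emeasure_uniform_unit[OF B])
    qed
    moreover have "(\<integral>\<^sup>+m. g (?s m) * indicator {\<omega>. ?P \<omega>} (?s m) \<partial>M) = (\<integral>\<^sup>+m\<in>H. \<phi> (m, U j m) \<partial>M)"
      by (intro nn_integral_cong) (auto simp: g_def H_def \<phi>_def indicator_def V_def mark_def)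
    moreover have "(\<integral>\<^sup>+m. g' (?s m) * indicator {\<omega>. ?P \<omega>} (?s m) \<partial>M) =
        (\<integral>\<^sup>+m\<in>H. (\<integral>\<^sup>+y. \<phi> (m, y) * indicator {0..1} y \<partial>lborel) \<partial>M)"
      by (intro nn_integral_cong) (auto simp: g'_def H_def \<phi>_def indicator_def)
    ultimately show "(\<integral>\<^sup>+m. g (?s m) * indicator {\<omega>. ?P \<omega>} (?s m) \<partial>M) =
        (\<integral>\<^sup>+m. g' (?s m) * indicator {\<omega>. ?P \<omega>} (?s m) \<partial>M)" by simp
  qed
  have after: "(\<integral>\<^sup>+\<omega>. g \<omega> * indicator {\<omega>. \<not> ?P \<omega>} \<omega> \<partial>\<Omega>) = (\<integral>\<^sup>+\<omega>. g' \<omega> * indicator {\<omega>. \<not> ?P \<omega>} \<omega> \<partial>\<Omega>)"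
  proof (rule nn_integral_eq_by_uniform_draws[OF gi(3,4)])
    fix m and e :: "nat \<Rightarrow> real" assume m: "m \<in> space M"
    let ?s = "\<lambda>v. (m, e, v)"
    define H where "H = {v. \<not> ?P (?s v)}"
    define \<phi> where "\<phi> w = \<psi> (?s (fst w), snd w) * indicator H (fst w)" for w
    have s: "?s \<in> measurable (coord_alg j) (hist (Suc j) j)" by (rule hist_slices(3)[OF m])
    define d w where "d v = D j (?s v)" and "w v = W j (?s v)" for v
    have dw: "d \<in> borel_measurable (coord_alg j)" "w \<in> borel_measurable (coord_alg j)"
      unfolding d_def[abs_def] w_def[abs_def]
      by (rule measurable_compose[OF s DW(1)], rule measurable_compose[OF s DW(2)])
    have H[measurable]: "H \<in> sets (coord_alg j)"
    proof -
      have "{v \<in> space (coord_alg j). \<not> (d v < T \<and> d v + w v \<le> T)} \<in> sets (coord_alg j)"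
        using pred_horizon(2)[OF dw, of T] unfolding pred_def .
      then show ?thesis by (simp only: H_def d_def w_def space_past space_coord_alg UNIV_I simp_thms)
    qed
    have \<phi>: "\<phi> \<in> borel_measurable (coord_alg j \<Otimes>\<^sub>M borel)"
    proof -
      have "(\<lambda>w. (?s (fst w), snd w)) \<in> measurable (coord_alg j \<Otimes>\<^sub>M borel) (hist (Suc j) j \<Otimes>\<^sub>M borel)"
        by (intro measurable_Pair measurable_compose[OF measurable_fst s]) measurable
      from measurable_compose[OF this \<psi>]
      have [measurable]: "(\<lambda>w. \<psi> (?s (fst w), snd w)) \<in> borel_measurable (coord_alg j \<Otimes>\<^sub>M borel)" .
      have [measurable]: "(\<lambda>w. indicator H (fst w) :: ennreal) \<in> borel_measurable (coord_alg j \<Otimes>\<^sub>M borel)"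
        by (rule measurable_compose[OF measurable_fst]) simp
      show ?thesis unfolding \<phi>_def[abs_def] by measurable
    qed
    have "(\<integral>\<^sup>+v. \<phi> (v, v j) \<partial>uniform_draws) = (\<integral>\<^sup>+v. (\<integral>\<^sup>+y. \<phi> (v, y) * indicator {0..1} y \<partial>lborel) \<partial>uniform_draws)"
      unfolding uniform_draws_def by (rule iid_draw[OF _ prob_uniform_density \<phi>]) measurable
    moreover have "(\<integral>\<^sup>+v. g (?s v) * indicator {\<omega>. \<not> ?P \<omega>} (?s v) \<partial>uniform_draws) = (\<integral>\<^sup>+v. \<phi> (v, v j) \<partial>uniform_draws)"
      by (intro nn_integral_cong) (auto simp: g_def H_def \<phi>_def indicator_def V_def mark_def)
    moreover have "(\<integral>\<^sup>+v. g' (?s v) * indicator {\<omega>. \<not> ?P \<omega>} (?s v) \<partial>uniform_draws) =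
        (\<integral>\<^sup>+v. (\<integral>\<^sup>+y. \<phi> (v, y) * indicator {0..1} y \<partial>lborel) \<partial>uniform_draws)"
      by (intro nn_integral_cong) (auto simp: g'_def H_def \<phi>_def indicator_def)
    ultimately show "(\<integral>\<^sup>+v. g (?s v) * indicator {\<omega>. \<not> ?P \<omega>} (?s v) \<partial>uniform_draws) =
        (\<integral>\<^sup>+v. g' (?s v) * indicator {\<omega>. \<not> ?P \<omega>} (?s v) \<partial>uniform_draws)" by simp
  qed
  have pred: "Measurable.pred \<Omega> ?P"
    by (rule pred_horizon(1)[OF measurable_hist[OF DW(1)] measurable_hist[OF DW(2)]])
  have "(\<integral>\<^sup>+\<omega>. g \<omega> \<partial>\<Omega>) = (\<integral>\<^sup>+\<omega>. g' \<omega> \<partial>\<Omega>)"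
    unfolding nn_integral_split_on[OF g pred] nn_integral_split_on[OF g' pred] before after ..
  then show ?thesis by (simp add: g_def g'_def)
qed

lemma prob_\<Omega>: "prob_space \<Omega>"
proof -
  interpret M: prob_space M by (rule prob_M)
  interpret E: prob_space exp_draws by (rule prob_exp_draws)
  interpret V: prob_space uniform_draws by (rule prob_uniform_draws)
  interpret EV: pair_prob_space exp_draws uniform_draws ..
  interpret O: pair_prob_space M "exp_draws \<Otimes>\<^sub>M uniform_draws" ..
  show ?thesis unfolding \<Omega>_def by (rule O.P.prob_space_axioms)
qed

sublocale thinning L n \<alpha> f a b \<Omega> c x0 X W V "\<lambda>j. hist j j" "\<lambda>j. hist (Suc j) j"
proof (rule thinning.intro[OF hawkes_params_axioms prob_\<Omega>], rule thinning_axioms.intro)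
  show "1 \<le> W j \<omega>" if "rate (X j \<omega>) = 0" for j \<omega>
    using that T_pos by (simp add: W_def wait_def Let_def)
qed (use chain_simps W_pos subalgebra_hist hist_mono W_measurable V_measurable chain_measurable wait_cond_law mark_cond_law
  in auto)

end

context coupling begin

section \<open>The algorithm and the candidates agree up to the horizon\<close>

lemma time_eq_D: "time j \<omega> = D j \<omega>"
  by (induction j) (simp_all add: time_Suc chain_simps)

text \<open>
  At rate 0 the algorithm almost surely draws \<open>\<infinity>\<close> and stops. The coupled process stays in step,
  because its substitute \<open>T + 1\<close> also ends after the horizon.
\<close>

lemma AE_wait_infinite:
  "AE \<omega> in \<Omega>. D j \<omega> < T \<longrightarrow> rate (X j \<omega>) = 0 \<longrightarrow> \<tau> j (fst \<omega>) = \<infinity>"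
proof -
  have XD: "X j \<in> measurable (hist j j) borel" "D j \<in> borel_measurable (hist j j)"
    using chain_measurable by auto
  have rate_meas: "(\<lambda>\<omega>. rate (X j \<omega>)) \<in> borel_measurable (hist j j)"
    by (rule measurable_compose[OF XD(1) measurable_rate])
  define r where "r \<omega> = rate (X j \<omega>)" for \<omega>
  define t where "t \<omega> = \<tau> j (fst \<omega>)" for \<omega> :: "'w \<times> (nat \<Rightarrow> real) \<times> (nat \<Rightarrow> real)"
  define g :: "'w \<times> (nat \<Rightarrow> real) \<times> (nat \<Rightarrow> real) \<Rightarrow> ennreal"
    where "g = indicator {\<omega>. D j \<omega> < T \<and> r \<omega> = 0 \<and> t \<omega> \<noteq> \<infinity>}"
  have DO: "D j \<in> borel_measurable \<Omega>" "r \<in> borel_measurable \<Omega>" "t \<in> borel_measurable \<Omega>"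
    unfolding r_def[abs_def] t_def[abs_def]
    by (rule measurable_hist[OF XD(2)], rule measurable_hist[OF rate_meas],
        rule measurable_hist[OF hist_draws(1)[of j "Suc j" 0]]) simp
  have set: "{\<omega> \<in> space \<Omega>. D j \<omega> < T \<and> r \<omega> = 0 \<and> t \<omega> \<noteq> \<infinity>} \<in> sets \<Omega>"
    using DO by measurable
  then have g: "g \<in> borel_measurable \<Omega>"
    unfolding g_def by (subst borel_measurable_indicator_iff) (simp add: Int_def conj_commute)
  have "(\<integral>\<^sup>+\<omega>. g \<omega> \<partial>\<Omega>) = (\<integral>\<^sup>+\<omega>. 0 \<partial>\<Omega>)"
  proof (rule nn_integral_eq_by_M[OF g])
    fix e v :: "nat \<Rightarrow> real"
    let ?s = "\<lambda>m. (m, e, v)" and ?past = "past M \<tau> j U j"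
    define rr dd where "rr m = rate (X j (?s m))" and "dd m = D j (?s m)" for m
    define H where "H = {m \<in> space M. dd m < T \<and> rr m = 0}"
    have s: "?s \<in> measurable ?past (hist j j)" by (rule hist_slices)
    have "rr \<in> borel_measurable ?past" "dd \<in> borel_measurable ?past"
      unfolding rr_def[abs_def] dd_def[abs_def]
      by (rule measurable_compose[OF s rate_meas], rule measurable_compose[OF s XD(2)])
    then have "{m \<in> space ?past. dd m < T \<and> rr m = 0} \<in> sets ?past" by measurable
    then have H: "H \<in> sets ?past" by (simp only: H_def space_past)
    have state: "clock (run m j) < ereal T" "pos (run m j) = X j (?s m)" "rate (X j (?s m)) = 0" if "m \<in> H" for m
      using that loop_run_before_horizon[of j "?s m"] by (auto simp: H_def dd_def rr_def)
    have B: "- {\<infinity> :: ereal} \<in> sets borel" by simp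
    have "(\<integral>\<^sup>+m. g (?s m) \<partial>M) = (\<integral>\<^sup>+m. indicator (H \<inter> \<tau> j -` (- {\<infinity>})) m \<partial>M)"
      by (intro nn_integral_cong) (auto simp: g_def H_def r_def t_def rr_def dd_def indicator_def)
    also have "\<dots> = emeasure M (H \<inter> \<tau> j -` (- {\<infinity>}))"
    proof (rule nn_integral_indicator)
      have "subalgebra M ?past" by (rule subalgebra_past[OF draws_measurable])
      then have "H \<in> sets M" using H by (auto simp: subalgebra_def)
      moreover have "\<tau> j -` (- {\<infinity>}) \<inter> space M \<in> sets M" by (rule measurable_sets[OF draws_measurable(1) B])
      ultimately have "H \<inter> (\<tau> j -` (- {\<infinity>}) \<inter> space M) \<in> sets M" by (rule sets.Int)
      then show "H \<inter> \<tau> j -` (- {\<infinity>}) \<in> sets M" by (simp add: H_def Int_def conj_ac)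
    qed
    also have "\<dots> = (\<integral>\<^sup>+m\<in>H. emeasure (exp_law (rate (pos (run m j)))) (- {\<infinity>}) \<partial>M)"
    proof -
      have "H \<subseteq> {m. clock (run m j) < ereal T}" using state(1) by blast
      then show ?thesis using wait_law[of j] H B unfolding has_cond_law_def by blast
    qed
    also have "\<dots> = (\<integral>\<^sup>+m. 0 \<partial>M)"
      using B by (intro nn_integral_cong) (auto simp: indicator_def state exp_law_def)
    finally show "(\<integral>\<^sup>+m. g (?s m) \<partial>M) = (\<integral>\<^sup>+m. 0 \<partial>M)" .
  qed simp
  then have "AE \<omega> in \<Omega>. g \<omega> = 0" using nn_integral_0_iff_AE[OF g] by simp
  then show ?thesis
    by (rule AE_mp) (rule AE_I2, auto simp: g_def r_def t_def indicator_def split: if_splits)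
qed

text \<open>
  At a positive rate the wait has a density and avoids the single value \<open>T + 1\<close>. So the
  substitute was not used.
\<close>

lemma AE_wait_not_default:
  "AE \<omega> in \<Omega>. 0 < rate (X j \<omega>) \<longrightarrow> W j \<omega> \<noteq> T + 1"
proof -
  define g :: "'w \<times> (nat \<Rightarrow> real) \<times> (nat \<Rightarrow> real) \<Rightarrow> ennreal"
    where "g \<omega> = indicator {T + 1} (W j \<omega>) * indicator {\<omega>. 0 < rate (X j \<omega>)} \<omega>" for \<omega>
  have WO: "W j \<in> borel_measurable \<Omega>" by (rule measurable_hist[OF W_measurable])
  have RO: "(\<lambda>\<omega>. rate (X j \<omega>)) \<in> borel_measurable \<Omega>"
    by (rule measurable_hist[OF measurable_compose[OF conjunct1[OF chain_measurable] measurable_rate]])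
  have single: "(indicator {T + 1} :: real \<Rightarrow> ennreal) \<in> borel_measurable borel" by simp
  have g: "g \<in> borel_measurable \<Omega>"
    unfolding g_def[abs_def]
    by (rule measurable_restrict_pred[OF measurable_compose[OF WO single] pred_horizon(7)[OF WO RO]])
  have "(\<lambda>w. indicator {T + 1} (snd w) :: ennreal) \<in> borel_measurable (hist j j \<Otimes>\<^sub>M borel)"
    by (rule measurable_compose[OF measurable_snd single])
  from law_W[OF this] have "(\<integral>\<^sup>+\<omega>. g \<omega> \<partial>\<Omega>) = (\<integral>\<^sup>+\<omega>\<in>{\<omega>. 0 < rate (X j \<omega>)}.
      (\<integral>\<^sup>+y. indicator {T + 1} y * ennreal (exponential_density (rate (X j \<omega>)) y) \<partial>lborel) \<partial>\<Omega>)"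
    by (simp only: g_def snd_conv)
  also have "\<dots> = (\<integral>\<^sup>+\<omega>. 0 \<partial>\<Omega>)"
  proof (rule nn_integral_cong)
    fix \<omega>
    have "(\<integral>\<^sup>+y. indicator {T + 1} y * ennreal (exponential_density (rate (X j \<omega>)) y) \<partial>lborel) = (\<integral>\<^sup>+y. 0 \<partial>(lborel :: real measure))"
      by (rule nn_integral_cong_AE, rule AE_mp[OF AE_lborel_singleton[of "T + 1"]], rule AE_I2) (simp add: indicator_def)
    then show "(\<integral>\<^sup>+y. indicator {T + 1} y * ennreal (exponential_density (rate (X j \<omega>)) y) \<partial>lborel) *
        indicator {\<omega>. 0 < rate (X j \<omega>)} \<omega> = 0" by simp
  qed
  finally have "AE \<omega> in \<Omega>. g \<omega> = 0" using nn_integral_0_iff_AE[OF g] by simp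
  then show ?thesis
    by (rule AE_mp) (rule AE_I2, auto simp: g_def indicator_def split: if_splits)
qed

text \<open>
  On these outcomes the algorithm terminates and its output counts the accepted points.
\<close>

definition good :: "'w \<times> (nat \<Rightarrow> real) \<times> (nat \<Rightarrow> real) \<Rightarrow> bool" where
  "good \<omega> \<longleftrightarrow> unbounded \<omega> \<and> (\<forall>j. 0 < rate (X j \<omega>) \<longrightarrow> W j \<omega> \<noteq> T + 1) \<and>
     (\<forall>j. D j \<omega> < T \<longrightarrow> rate (X j \<omega>) = 0 \<longrightarrow> \<tau> j (fst \<omega>) = \<infinity>)"

lemma AE_good: "AE \<omega> in \<Omega>. good \<omega>"
  unfolding good_def
  by (intro AE_conjI AE_unbounded) (simp_all only: AE_all_countable AE_wait_not_default AE_wait_infinite simp_thms)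

lemma count_to_pts_Suc: "count_to t (pts (Suc j) \<omega>) = count_to t (pts j \<omega>) + (if acc j \<omega> \<and> time (Suc j) \<omega> \<le> t then 1 else 0)"
proof -
  have pos: "0 < time (Suc j) \<omega>" using time_less_iff[of 0 \<omega> "Suc j"] by simp
  have notin: "time (Suc j) \<omega> \<notin> pts j \<omega>"
  proof
    assume "time (Suc j) \<omega> \<in> pts j \<omega>"
    from pts_le[OF this] have "time (Suc j) \<omega> \<le> time j \<omega>" by simp
    then show False by (simp add: time_le_iff)
  qed
  show ?thesis
  proof (cases "acc j \<omega> \<and> time (Suc j) \<omega> \<le> t")
    case True
    then have "pts (Suc j) \<omega> \<inter> {0<..t} = insert (time (Suc j) \<omega>) (pts j \<omega> \<inter> {0<..t})"
      using pos by (auto simp: pts_Suc)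
    then show ?thesis using True notin finite_pts[of j \<omega>] by (simp add: count_to_def)
  next
    case False
    then have "pts (Suc j) \<omega> \<inter> {0<..t} = pts j \<omega> \<inter> {0<..t}"
      by (auto simp: pts_Suc)
    then show ?thesis using False by (simp add: count_to_def)
  qed
qed

lemma count_to_pts_after: "time j \<omega> \<le> t \<Longrightarrow> count_to t (pts j \<omega>) = count_to (time j \<omega>) (pts j \<omega>)"
proof -
  assume t: "time j \<omega> \<le> t"
  have "pts j \<omega> \<inter> {0<..t} = pts j \<omega> \<inter> {0<..time j \<omega>}"
    using pts_le[of _ j \<omega>] t by force
  then show ?thesis by (simp add: count_to_def)
qed

definition counts_agree :: "nat \<Rightarrow> 'w \<times> (nat \<Rightarrow> real) \<times> (nat \<Rightarrow> real) \<Rightarrow> bool" where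
  "counts_agree j \<omega> \<longleftrightarrow> (\<forall>t. 0 \<le> t \<longrightarrow> t \<le> D j \<omega> \<longrightarrow> t \<le> T \<longrightarrow> cnt (run (fst \<omega>) j) t = count_to t (pts j \<omega>))"

text \<open>
  A pass of the loop either ends at the next candidate time, which then is at most \<open>T\<close>, or it is
  cut at \<open>T\<close>. In the second case the candidate lies after the horizon, and its acceptance does
  not change the counts up to \<open>T\<close>.
\<close>

lemma loop_step_agrees:
  assumes good: "good \<omega>" and D: "D j \<omega> < T" and agrees: "counts_agree j \<omega>"
  shows "counts_agree (Suc j) \<omega>" and "T \<le> D (Suc j) \<omega> \<Longrightarrow> \<not> clock (run (fst \<omega>) (Suc j)) < ereal T"
proof -
  let ?m = "fst \<omega>"
  obtain "clock (run ?m j) = ereal (D j \<omega>)" "pos (run ?m j) = X j \<omega>"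
    using loop_run_before_horizon[OF D] by blast
  note st = this
  have N: "cnt (run ?m j) t = count_to t (pts j \<omega>)" if "0 \<le> t" "t \<le> D j \<omega>" for t
    using agrees that D by (simp add: counts_agree_def)
  have ND: "cnt (run ?m j) (D j \<omega>) = count_to t (pts j \<omega>)" if "D j \<omega> \<le> t" for t
    using N[of "D j \<omega>"] D_nonneg[of j \<omega>] count_to_pts_after[of j \<omega> t] that by (simp add: time_eq_D)
  have run_Suc: "run ?m (Suc j) = loop_body f L n \<alpha> c T (\<tau> j ?m) (U j ?m) (run ?m j)"
    using st D by simp
  note DS = chain_simps(3)[of j \<omega>] and W = W_pos[of j \<omega>]
  have *: "counts_agree (Suc j) \<omega> \<and> (T \<le> D (Suc j) \<omega> \<longrightarrow> \<not> clock (run ?m (Suc j)) < ereal T)"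
  proof (cases "D j \<omega> + W j \<omega> \<le> T")
    case True
    note W' = W_before_horizon[OF D True]
    have V: "V j \<omega> = U j ?m" using D True by (simp add: V_def mark_def)
    have acc: "acc j \<omega> \<longleftrightarrow> U j ?m \<le> f (\<Sum>i = 1..L. flow n \<alpha> (W j \<omega>) (X j \<omega>) i 0) / rate (X j \<omega>)"
      by (simp add: acc_def V flow_sum_def)
    have cnt: "cnt (run ?m (Suc j)) t =
        (if acc j \<omega> then (if D j \<omega> \<le> t \<and> t < D j \<omega> + W j \<omega> then cnt (run ?m j) (D j \<omega>)
           else if t = D j \<omega> + W j \<omega> then cnt (run ?m j) (D j \<omega>) + 1 else cnt (run ?m j) t)
         else (if D j \<omega> \<le> t \<and> t \<le> D j \<omega> + W j \<omega> then cnt (run ?m j) (D j \<omega>) else cnt (run ?m j) t))" for t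
      unfolding run_Suc using True by (simp add: loop_body_def Let_def st W'(2) acc)
    have clock: "clock (run ?m (Suc j)) = ereal (D (Suc j) \<omega>)"
      unfolding run_Suc using True by (simp add: loop_body_def Let_def st W'(2) DS)
    have "cnt (run ?m (Suc j)) t = count_to t (pts (Suc j) \<omega>)" if t: "0 \<le> t" "t \<le> D (Suc j) \<omega>" for t
    proof -
      consider "t < D j \<omega>" | "D j \<omega> \<le> t" "t < D j \<omega> + W j \<omega>" | "t = D j \<omega> + W j \<omega>"
      proof -
        have "t < D j \<omega> \<or> (D j \<omega> \<le> t \<and> t < D j \<omega> + W j \<omega>) \<or> t = D j \<omega> + W j \<omega>"
          using t DS by linarith
        then show thesis using that by blast
      qed
      then show ?thesis
      proof cases
        case 1 then show ?thesis unfolding cnt using N[of t] t W by (simp add: count_to_pts_Suc time_eq_D DS)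
      next
        case 2 then show ?thesis unfolding cnt using ND[of t] by (simp add: count_to_pts_Suc time_eq_D DS)
      next
        case 3 then show ?thesis unfolding cnt using ND[of t] W by (simp add: count_to_pts_Suc time_eq_D DS)
      qed
    qed
    then show ?thesis using clock by (simp add: counts_agree_def)
  next
    case False
    have late: "ereal T - ereal (D j \<omega>) < \<tau> j ?m"
    proof (cases "0 < rate (X j \<omega>)")
      case True
      then have "W j \<omega> \<noteq> T + 1" using good by (simp add: good_def)
      then have "W j \<omega> = real_of_ereal (\<tau> j ?m)" "0 < real_of_ereal (\<tau> j ?m)"
        using D by (auto simp: W_def wait_def Let_def split: if_splits)
      then have "\<tau> j ?m = ereal (W j \<omega>)" by (cases "\<tau> j ?m") auto
      then show ?thesis using False by simp
    next
      case False
      then have "\<tau> j ?m = \<infinity>" using good D rate_nonneg[of "X j \<omega>"] by (simp add: good_def)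
      then show ?thesis by simp
    qed
    have cnt: "cnt (run ?m (Suc j)) t = (if D j \<omega> \<le> t \<and> t \<le> T then cnt (run ?m j) (D j \<omega>) else cnt (run ?m j) t)" for t
      unfolding run_Suc using late by (simp add: loop_body_def Let_def st not_le[symmetric])
    have clock: "clock (run ?m (Suc j)) = ereal (D j \<omega>) + \<tau> j ?m"
      unfolding run_Suc using late by (simp add: loop_body_def Let_def st not_le[symmetric])
    have "\<not> clock (run ?m (Suc j)) < ereal T"
      unfolding clock using late by (cases "\<tau> j ?m") auto
    moreover have "cnt (run ?m (Suc j)) t = count_to t (pts (Suc j) \<omega>)" if "0 \<le> t" "t \<le> T" for t
      unfolding cnt using N[of t] ND[of t] that False by (simp add: count_to_pts_Suc time_eq_D DS)
    ultimately show ?thesis by (simp add: counts_agree_def)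
  qed
  show "counts_agree (Suc j) \<omega>" using * by blast
  show "T \<le> D (Suc j) \<omega> \<Longrightarrow> \<not> clock (run (fst \<omega>) (Suc j)) < ereal T" using * by blast
qed

lemma output_agrees:
  assumes good: "good \<omega>"
  shows "terminates f L n \<alpha> c T x0 (\<lambda>j. \<tau> j (fst \<omega>)) (\<lambda>j. U j (fst \<omega>))"
    and "0 \<le> t \<Longrightarrow> t \<le> T \<Longrightarrow>
      alg_output f L n \<alpha> c T x0 (\<lambda>j. \<tau> j (fst \<omega>)) (\<lambda>j. U j (fst \<omega>)) t = count_to t (points \<omega>)"
proof -
  have ub: "unbounded \<omega>" using good by (simp add: good_def)
  obtain j0 where "\<forall>j\<ge>j0. T < time j \<omega>" using unbounded_eventually[OF ub] by blast
  then have "T < D j0 \<omega>" by (simp add: time_eq_D)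
  then have ex: "\<exists>j. T \<le> D j \<omega>" by (intro exI[of _ j0]) simp
  define J where "J = (LEAST j. T \<le> D j \<omega>)"
  have J: "T \<le> D J \<omega>" unfolding J_def by (rule LeastI_ex[OF ex])
  have before: "D j \<omega> < T" if "j < J" for j
    using not_less_Least[of j "\<lambda>j. T \<le> D j \<omega>"] that by (simp add: J_def)
  have agrees: "counts_agree j \<omega>" if "j \<le> J" for j
    using that
  proof (induction j)
    case 0 then show ?case by (simp add: counts_agree_def chain_simps pts_def count_to_def)
  next
    case (Suc j) then show ?case by (intro loop_step_agrees(1)[OF good] before) auto
  qed
  obtain J' where J': "J = Suc J'" using J T_pos by (cases J) (auto simp: chain_simps)
  have stop: "\<not> clock (run (fst \<omega>) J) < ereal T"
    unfolding J' by (rule loop_step_agrees(2)[OF good before agrees]) (use J J' in auto)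
  have go: "clock (run (fst \<omega>) j) < ereal T" if "j < J" for j
    using loop_run_before_horizon[OF before[OF that]] before[OF that] by simp
  have least: "(LEAST j. \<not> clock (run (fst \<omega>) j) < ereal T) = J"
  proof (rule Least_equality[where P = "\<lambda>j. \<not> clock (run (fst \<omega>) j) < ereal T", OF stop])
    fix j assume "\<not> clock (run (fst \<omega>) j) < ereal T"
    then show "J \<le> j" using go[of j] by (meson not_le)
  qed
  show "terminates f L n \<alpha> c T x0 (\<lambda>j. \<tau> j (fst \<omega>)) (\<lambda>j. U j (fst \<omega>))"
    unfolding terminates_def using stop by blast
  show "alg_output f L n \<alpha> c T x0 (\<lambda>j. \<tau> j (fst \<omega>)) (\<lambda>j. U j (fst \<omega>)) t = count_to t (points \<omega>)"
    if t: "0 \<le> t" "t \<le> T"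
  proof -
    have "t < time (Suc J) \<omega>" using J t time_less_iff[of J \<omega> "Suc J"] by (simp add: time_eq_D)
    then have "points \<omega> \<inter> {0<..t} = pts J \<omega> \<inter> {0<..t}" by (rule points_upto[OF ub])
    then have "count_to t (points \<omega>) = count_to t (pts J \<omega>)" by (simp add: count_to_def)
    moreover have "cnt (run (fst \<omega>) J) t = count_to t (pts J \<omega>)"
      using agrees[OF order_refl] t J unfolding counts_agree_def by (meson order_trans)
    ultimately show ?thesis unfolding alg_output_def least by simp
  qed
qed

section \<open>Measurability of the output\<close>

text \<open>
  The body of the loop evaluates the counting path at the random clock time. Hence the path
  has to be measurable jointly in time and outcome.
\<close>

lemma run_measurable:
  "(\<lambda>m. pos (run m j)) \<in> measurable M borel \<and> (\<lambda>m. clock (run m j)) \<in> borel_measurable M \<and>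
   (\<lambda>w. cnt (run (snd w) j) (fst w)) \<in> measurable (borel \<Otimes>\<^sub>M M) (count_space UNIV)"
proof (induction j)
  case 0 then show ?case by simp
next
  case (Suc j)
  define x d N where "x m = pos (run m j)" and "d m = clock (run m j)"
    and "N w = cnt (run (snd w) j) (fst w)" for m and w :: "real \<times> 'w"
  have IH: "x \<in> measurable M borel" "d \<in> borel_measurable M" "N \<in> measurable (borel \<Otimes>\<^sub>M M) (count_space UNIV)"
    using Suc unfolding x_def[abs_def] d_def[abs_def] N_def[abs_def] by auto
  define tt where "tt = \<tau> j"
  have tt: "tt \<in> borel_measurable M" unfolding tt_def by (rule draws_measurable)
  have rt: "(\<lambda>m. real_of_ereal (tt m)) \<in> borel_measurable M" using tt by measurable
  define y where "y m = flow n \<alpha> (real_of_ereal (tt m)) (x m)" for m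
  have y: "y \<in> measurable M borel" unfolding y_def[abs_def] by (rule measurable_flow[OF rt IH(1)])
  define q where "q m = f (flow_sum L n \<alpha> (real_of_ereal (tt m)) (x m)) / rate (x m)" for m
  have q: "q \<in> borel_measurable M" unfolding q_def[abs_def]
    by (rule borel_measurable_divide[OF measurable_compose[OF measurable_flow_sum[OF rt IH(1)] f_meas]
        measurable_compose[OF IH(1) measurable_rate]])
  define k where "k m = kick L n c (y m)" for m
  have k: "k \<in> measurable M borel" unfolding k_def[abs_def] by (rule measurable_compose[OF y measurable_kick])
  define u where "u = U j"
  have u: "u \<in> borel_measurable M" unfolding u_def by (rule draws_measurable)
  note [measurable] = IH tt y q k u
  have pos: "pos (run m (Suc j)) = (if d m < ereal T then if tt m \<le> ereal T - d m then
      if u m \<le> q m then k m else y m else x m else x m)" for m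
    by (simp add: loop_body_def Let_def x_def d_def tt_def y_def q_def k_def u_def flow_sum_def)
  have clock: "clock (run m (Suc j)) = (if d m < ereal T then d m + tt m else d m)" for m
    by (simp add: loop_body_def Let_def d_def tt_def)
  define Nd where "Nd w = N (real_of_ereal (d (snd w)), snd w)" for w :: "real \<times> 'w"
  have [measurable]: "Nd \<in> measurable (borel \<Otimes>\<^sub>M M) (count_space UNIV)"
    unfolding Nd_def[abs_def] by measurable
  have cnt: "cnt (run (snd w) (Suc j)) (fst w) = (if d (snd w) < ereal T then
      if tt (snd w) \<le> ereal T - d (snd w) then
        if u (snd w) \<le> q (snd w) then
          if d (snd w) \<le> ereal (fst w) \<and> ereal (fst w) < d (snd w) + tt (snd w) then Nd w
          else if ereal (fst w) = d (snd w) + tt (snd w) then Nd w + 1 else N w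
        else if d (snd w) \<le> ereal (fst w) \<and> ereal (fst w) \<le> d (snd w) + tt (snd w) then Nd w else N w
      else if d (snd w) \<le> ereal (fst w) \<and> fst w \<le> T then Nd w else N w
     else N w)" for w
    by (simp add: loop_body_def Let_def N_def Nd_def x_def d_def tt_def q_def u_def flow_sum_def)
  show ?case
    unfolding pos clock cnt by (intro conjI) measurable
qed

lemma output_measurable:
  "(\<lambda>m. alg_output f L n \<alpha> c T x0 (\<lambda>j. \<tau> j m) (\<lambda>j. U j m) t) \<in> measurable M (count_space UNIV)"
proof -
  have clock: "(\<lambda>m. clock (run m j)) \<in> borel_measurable M" for j
    using run_measurable by blast
  have "Measurable.pred M (\<lambda>m. \<not> clock (run m j) < ereal T)" for j
    using clock[of j] by measurable
  then have least: "(\<lambda>m. LEAST j. \<not> clock (run m j) < ereal T) \<in> measurable M (count_space UNIV)"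
    by (rule measurable_Least)
  have "(\<lambda>m. cnt (run m j) t) \<in> measurable M (count_space UNIV)" for j
  proof -
    have "(\<lambda>m. (t, m)) \<in> measurable M (borel \<Otimes>\<^sub>M M)" by (rule measurable_Pair1') simp
    from measurable_compose[OF this conjunct2[OF conjunct2[OF run_measurable[of j]]]] show ?thesis by simp
  qed
  then show ?thesis unfolding alg_output_def by (rule measurable_compose_countable[OF _ least])
qed

lemma output_path_measurable:
  "(\<lambda>m. \<lambda>t\<in>{0..T}. alg_output f L n \<alpha> c T x0 (\<lambda>j. \<tau> j m) (\<lambda>j. U j m) t) \<in> measurable M (path_space T)"
  unfolding path_space_def by (rule measurable_restrict) (rule output_measurable)

section \<open>Termination and law of the output\<close>

lemma AE_terminates:
  "AE m in M. terminates f L n \<alpha> c T x0 (\<lambda>j. \<tau> j m) (\<lambda>j. U j m)"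
proof -
  interpret M: prob_space M by (rule prob_M)
  interpret E: prob_space exp_draws by (rule prob_exp_draws)
  interpret V: prob_space uniform_draws by (rule prob_uniform_draws)
  interpret EV: pair_prob_space exp_draws uniform_draws ..
  interpret O: pair_prob_space M "exp_draws \<Otimes>\<^sub>M uniform_draws" ..
  have "AE \<omega> in M \<Otimes>\<^sub>M (exp_draws \<Otimes>\<^sub>M uniform_draws).
      terminates f L n \<alpha> c T x0 (\<lambda>j. \<tau> j (fst \<omega>)) (\<lambda>j. U j (fst \<omega>))"
    using AE_good unfolding \<Omega>_def[symmetric] by (rule AE_mp) (rule AE_I2, blast intro: output_agrees(1))
  from O.AE_pair[OF this]
  have "AE m in M. AE w in exp_draws \<Otimes>\<^sub>M uniform_draws. terminates f L n \<alpha> c T x0 (\<lambda>j. \<tau> j m) (\<lambda>j. U j m)"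
    by simp
  then show ?thesis by (simp add: EV.P.AE_const)
qed

text \<open>
  Both laws are images of the same measure on the product space, under maps that agree almost
  surely.
\<close>

lemma path_law_output:
  "path_law M T (\<lambda>t m. alg_output f L n \<alpha> c T x0 (\<lambda>j. \<tau> j m) (\<lambda>j. U j m) t) =
   path_law point_law T (counting (\<lambda>\<Phi>. \<Phi>))"
proof -
  interpret E: prob_space exp_draws by (rule prob_exp_draws)
  interpret V: prob_space uniform_draws by (rule prob_uniform_draws)
  interpret EV: pair_prob_space exp_draws uniform_draws ..
  define g where "g m = (\<lambda>t\<in>{0..T}. alg_output f L n \<alpha> c T x0 (\<lambda>j. \<tau> j m) (\<lambda>j. U j m) t)" for m
  define g' where "g' \<Phi> = (\<lambda>t\<in>{0..T}. count_to t \<Phi>)" for \<Phi>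
  have g: "g \<in> measurable M (path_space T)" unfolding g_def[abs_def] by (rule output_path_measurable)
  have g': "g' \<in> measurable conf_space (path_space T)"
    unfolding g'_def[abs_def] path_space_def
    by (rule measurable_restrict) (rule measurable_conf_filt_space[OF count_to_measurable])
  have fst: "fst \<in> measurable \<Omega> M" unfolding \<Omega>_def by (rule measurable_fst)
  have M: "distr \<Omega> M fst = M" unfolding \<Omega>_def by (rule EV.P.distr_pair_fst)
  have "distr M (path_space T) g = distr (distr \<Omega> M fst) (path_space T) g" by (simp only: M)
  also have "\<dots> = distr \<Omega> (path_space T) (g \<circ> fst)" by (rule distr_distr[OF g fst])
  also have "\<dots> = distr \<Omega> (path_space T) (g' \<circ> points)"
  proof (rule distr_cong_AE[OF refl refl])
    show "AE \<omega> in \<Omega>. (g \<circ> fst) \<omega> = (g' \<circ> points) \<omega>"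
      using AE_good
    proof (rule AE_mp, intro AE_I2 impI)
      fix \<omega> assume "good \<omega>"
      then show "(g \<circ> fst) \<omega> = (g' \<circ> points) \<omega>"
        by (auto simp: g_def g'_def restrict_def fun_eq_iff output_agrees(2))
    qed
    show "g \<circ> fst \<in> measurable \<Omega> (path_space T)" by (rule measurable_comp[OF fst g])
    show "g' \<circ> points \<in> measurable \<Omega> (path_space T)" by (rule measurable_comp[OF points_meas g'])
  qed
  also have "\<dots> = distr point_law (path_space T) g'"
    unfolding point_law_def by (rule distr_distr[OF g' points_meas, symmetric])
  finally show ?thesis unfolding path_law_def counting_id g_def[abs_def] g'_def[abs_def] .
qed

end

lemma linear_growth:
  fixes f :: "real \<Rightarrow> real"
  assumes "bounded (range f) \<or> (\<exists>C. C-lipschitz_on UNIV f)"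
  shows "\<exists>a b. 0 \<le> b \<and> (\<forall>y. f y \<le> a + b * \<bar>y\<bar>)"
  using assms
proof
  assume "bounded (range f)"
  then obtain B where "\<And>y. \<bar>f y\<bar> \<le> B" by (auto simp: bounded_iff)
  then have "f y \<le> B + 0 * \<bar>y\<bar>" for y by (metis abs_ge_self add.right_neutral mult_zero_left order_trans)
  then show ?thesis by (intro exI[of _ B] exI[of _ 0]) simp
next
  assume "\<exists>C. C-lipschitz_on UNIV f"
  then obtain C where C: "C-lipschitz_on UNIV f" by blast
  have "f y \<le> f 0 + C * \<bar>y\<bar>" for y
    using lipschitz_onD[OF C, of y 0] by (simp add: dist_real_def)
  then show ?thesis using lipschitz_on_nonneg[OF C] by blast
qed

theorem proposition4:
  fixes f :: "real \<Rightarrow> real" and T :: real and L :: nat and n :: "nat \<Rightarrow> nat"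
    and c \<alpha> :: "nat \<Rightarrow> real" and x0 :: vec
    and M :: "'w measure" and \<tau> :: "nat \<Rightarrow> 'w \<Rightarrow> ereal" and U :: "nat \<Rightarrow> 'w \<Rightarrow> real"
  assumes "f \<in> borel_measurable borel" and "\<And>y. 0 \<le> f y"
    and "bounded (range f) \<or> (\<exists>C. C-lipschitz_on UNIV f)"
    and "0 < T" and "1 \<le> L" and "\<And>i. i \<in> {1..L} \<Longrightarrow> 0 < \<alpha> i"
    and "valid_draws f L n \<alpha> c T x0 M \<tau> U"
  defines "h \<equiv> erlang_kernel L n \<alpha> c"
    and "N \<equiv> (\<lambda>t \<omega>. alg_output f L n \<alpha> c T x0 (\<lambda>j. \<tau> j \<omega>) (\<lambda>j. U j \<omega>) t)"
  shows "(AE \<omega> in M. terminates f L n \<alpha> c T x0 (\<lambda>j. \<tau> j \<omega>) (\<lambda>j. U j \<omega>)) \<and>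
    (\<forall>\<eta>. initial_point_process \<eta> \<longrightarrow>
      (\<forall>t\<ge>0. set_integrable \<eta> {..0} (\<lambda>s. h (t - s))) \<longrightarrow>
      (\<forall>i\<in>{1..L}. \<forall>k\<le>n i.
        set_integrable \<eta> {..0} (\<lambda>s. c i * exp (\<alpha> i * s) * (- s) ^ (n i - k) / fact (n i - k)) \<and>
        x0 i k = (LINT s:{..0}|\<eta>. c i * exp (\<alpha> i * s) * (- s) ^ (n i - k) / fact (n i - k))) \<longrightarrow>
      (\<lambda>\<omega>. \<lambda>t\<in>{0..T}. N t \<omega>) \<in> measurable M (path_space T) \<and>
      (\<exists>(Q :: real set measure) \<Phi>.
        hawkes_process f h \<eta> Q \<Phi> \<and> path_law M T N = path_law Q T (counting \<Phi>)))"
proof -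
  obtain A B where growth: "0 \<le> B" "\<And>y. f y \<le> A + B * \<bar>y\<bar>"
    using linear_growth[OF assms(3)] by blast
  interpret coupling L n \<alpha> f A B c x0 T M \<tau> U
    by unfold_locales (use assms growth in auto)
  show ?thesis
  proof (intro conjI allI impI)
    show "AE \<omega> in M. terminates f L n \<alpha> c T x0 (\<lambda>j. \<tau> j \<omega>) (\<lambda>j. U j \<omega>)" by (rule AE_terminates)
    show "(\<lambda>\<omega>. \<lambda>t\<in>{0..T}. N t \<omega>) \<in> measurable M (path_space T)"
      unfolding N_def by (rule output_path_measurable)
    fix \<eta> :: "real measure"
    assume init: "\<forall>i\<in>{1..L}. \<forall>k\<le>n i.
        set_integrable \<eta> {..0} (\<lambda>s. c i * exp (\<alpha> i * s) * (- s) ^ (n i - k) / fact (n i - k)) \<and>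
        x0 i k = (LINT s:{..0}|\<eta>. c i * exp (\<alpha> i * s) * (- s) ^ (n i - k) / fact (n i - k))"
    have "hawkes_process f h \<eta> point_law (\<lambda>\<Phi>. \<Phi>)"
      unfolding h_def by (intro hawkes_process_point_law initial_intensity) (use init in auto)
    moreover have "path_law M T N = path_law point_law T (counting (\<lambda>\<Phi>. \<Phi>))"
      unfolding N_def by (rule path_law_output)
    ultimately show "\<exists>(Q :: real set measure) \<Phi>. hawkes_process f h \<eta> Q \<Phi> \<and> path_law M T N = path_law Q T (counting \<Phi>)"
      by blast
  qed
qed

end
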